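(* If $(\mathcal{K},\preccurlyeq)$ is a FUR-class, then $(\mathcal{K}^{eq},\preccurlyeq^{eq})$ is also a FUR-class.
   Context: SETTING. $(\mathcal{K},\preccurlyeq)$ is an abstract elementary class (AEC) with monster model $\mathbb{M}$: a $\delta$-model homogeneous and $\delta$-universal member of $\mathcal{K}$, $\delta$ a large cardinal. "Model" means $\mathcal{A}\in\mathcal{K}$, $\mathcal{A}\preccurlyeq\mathbb{M}$; models and parameter sets have size $<\delta$. $a\in X$ may be a finite tuple; juxtaposition denotes union or concatenation. TYPES. $\mathrm{Aut}(\mathbb{M}/A)$ is the group of automorphisms of $\mathbb{M}$ fixing $A$ pointwise. $a,b$ have the same Galois type over $A$, $t^g(a/A)=t^g(b/A)$, if $f(a)=b$ for some $f\in\mathrm{Aut}(\mathbb{M}/A)$; they have the same weak type, $t(a/A)=t(b/A)$, if $t^g(a/B)=t^g(b/B)$ for all finite $B\subseteq A$ (types of models are types of enumerations). For $A\subseteq B$ with $A$ finite, $t(a/B)$ splits over $A$ if there are $b,c\in B$ with $t(b/A)=t(c/A)$ but $t(ab/A)\ne t(ac/A)$. $a\downarrow^{ns}_B C$ means that $t(a/B\cup C)$ does not split over some finite $A\subseteq B$; $A\downarrow^{ns}_B C$ means $a\downarrow^{ns}_BC$ for each $a\in A$. FUR-CLASS. $\mathcal{K}$ is a FUR-class if it has AP and JEP, $LS(\mathcal{K})=\omega$, has arbitrarily large structures, contains no finite models, and satisfies: (AI) Every countable model $\mathcal{A}$ is s-saturated: for any $b\in\mathbb{M}$ and finite $A\subseteq\mathcal{A}$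 there is $a\in\mathcal{A}$ with $t(a/A)=t(b/A)$. (AII) For all $a$ and countable $\mathcal{A}$ there is an s-primary model $\mathcal{B}=\mathcal{A}a\cup\bigcup_{i<\omega}a_i$ over $\mathcal{A}a$. [s-primary: the $a_i$ are singletons and for all $n<\omega$ there is a finite $A_n\subset\mathcal{A}$ such that for all $(a',a_0',\dots,a_n')$ with $t(a'/\mathcal{A})=t(a/\mathcal{A})$: $t(a',a_0',\dots,a_n'/A_n)=t(a,a_0,\dots,a_n/A_n)$ implies $t(a',a_0',\dots,a_n'/\mathcal{A})=t(a,a_0,\dots,a_n/\mathcal{A})$.] (AIII) Let $\mathcal{A},\mathcal{B},\mathcal{C}$ be models with $\mathcal{A}\downarrow^{ns}_{\mathcal{B}}\mathcal{C}$ and $\mathcal{B}=\mathcal{A}\cap\mathcal{C}$. Then there is a unique (not only up to isomorphism) s-prime model $\mathcal{D}$ over $\mathcal{A}\cup\mathcal{C}$; furthermore, if $\mathcal{C}\subseteq\mathcal{C}'$ and $\mathcal{A}\downarrow^{ns}_{\mathcal{B}}\mathcal{C}'$, then $\mathcal{D}\downarrow^{ns}_{\mathcal{C}}\mathcal{C}'$. [For models $\mathcal{A}_i$, $i<\alpha$, and $A=\bigcup_{i<\alpha}\mathcal{A}_i$, a map $f:A\to\mathbb{M}$ is weakly elementary w.r.t. $(\mathcal{A}_i)_{i<\alpha}$ if $t(a/\emptyset)=t(f(a)/\emptyset)$ for all $a\in A$ and $f(\mathcal{A}_i)\preccurlyeq\mathbb{M}$ for all $i$. A model $\mathcal{D}$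 is s-prime over $A$ if for every model $\mathcal{B}$ and every $f:A\to\mathcal{B}$ weakly elementary w.r.t. $(\mathcal{A}_i)_{i<\alpha}$ there is an elementary embedding $g:\mathcal{D}\to\mathcal{B}$ with $f\subseteq g$.] (AIV) For each $a\in\mathbb{M}$ there is $n<\omega$ such that for every countable model $\mathcal{A}$ and finite $A\subset\mathcal{A}$, player II has a winning strategy in $GI(a,A,\mathcal{A})$ in $n$ moves. [$GI(a,A,\mathcal{A})$: start with $a_0=a$, $A_0=A$. At move $n$, player I chooses $a_{n+1}\in\mathbb{M}$ and a finite $A_{n+1}'\subseteq\mathcal{A}$ with $t(a_{n+1}/A_n)=t(a_n/A_n)$, $A_n\subseteq A'_{n+1}$ and $t(a_{n+1}/A'_{n+1})\ne t(a_n/A'_{n+1})$; then player II chooses a finite $A_{n+1}\subseteq\mathcal{A}$ with $A'_{n+1}\subseteq A_{n+1}$. Player II wins if player I can no longer move.] (AV) If $\mathcal{A}\subseteq\mathcal{B}$ are countable models, $a\in\mathbb{M}$ and $\mathcal{B}\downarrow^{ns}_{\mathcal{A}}a$, then $a\downarrow^{ns}_{\mathcal{A}}\mathcal{B}$. (AVI) For all models $\mathcal{A},\mathcal{B},\mathcal{D}$ with $\mathcal{A}\subseteq\mathcal{B}\cap\mathcal{D}$ there is a model $\mathcal{C}$ with $t(\mathcal{C}/\mathcal{A})=t(\mathcal{B}/\mathcal{A})$ and $\mathcal{C}\downarrow^{ns}_{\mathcal{A}}\mathcal{D}$. THE CLASS $\mathcal{K}^{eq}$. Let $\mathcal{E}$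 be a countable collection of $\emptyset$-invariant equivalence relations $E\subseteq\mathbb{M}^n\times\mathbb{M}^n$ (for various $n$), i.e. for each $E\in\mathcal{E}$ there is a countable collection $G_E$ of Galois types such that $(a,b)\in E$ iff $t^g(ab/\emptyset)\in G_E$; such an $E$ defines an equivalence relation on every model in $\mathcal{K}$. The identity relation $=$ is assumed to be in $\mathcal{E}$. For $\mathcal{A}\in\mathcal{K}$ let $\mathcal{A}^{eq}=\{a/E: a\in\mathcal{A},\ E\in\mathcal{E}\}$, identifying each $a$ with $a/{=}$. For each $E\in\mathcal{E}$ add to the language a predicate $P_E$ interpreted as $\{a/E:a\in\mathcal{A}\}$ and a function $F_E:\mathcal{A}^n\to\mathcal{A}^{eq}$ (suitable $n$) with $F_E(a)=a/E$; all the structure of $\mathcal{A}$ is retained on $P_=$. Then $\mathcal{K}^{eq}=\{\mathcal{A}^{eq}:\mathcal{A}\in\mathcal{K}\}$, and $\mathcal{A}^{eq}\preccurlyeq^{eq}\mathcal{B}^{eq}$ iff $\mathcal{A}^{eq}$ is a submodel of $\mathcal{B}^{eq}$ and $\mathcal{A}\preccurlyeq\mathcal{B}$. The monster model of $\mathcal{K}^{eq}$ is $\mathbb{M}^{eq}$. *)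

theory Defs
  imports "HOL-Library.Countable_Set"
begin

unbundle cardinal_syntax

section \<open>Structures\<close>

record ('f, 'r) vocab =
  funs :: "'f set"
  rels :: "'r set"
  far :: "'f \<Rightarrow> nat"
  rar :: "'r \<Rightarrow> nat"

text \<open>
  Function symbols may be interpreted by partial functions (\<open>None\<close> = undefined), because the
  functions \<open>F\<^sub>E\<close> of \<open>\<K>\<^sup>e\<^sup>q\<close> and the old functions are defined on the home sort only.  Ordinary
  total structures are a special case.
\<close>

record ('f, 'r, 'a) struct =
  car :: "'a set"
  fni :: "'f \<Rightarrow> 'a list \<Rightarrow> 'a option"
  rli :: "'r \<Rightarrow> 'a list set"

definition tuples :: "nat \<Rightarrow> 'a set \<Rightarrow> 'a list set" where
  "tuples n X = {xs. length xs = n \<and> set xs \<subseteq> X}"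

text \<open>The values outside the vocabulary and outside the carrier are fixed, so that equality of
  structures is equality of carriers and interpretations.\<close>

definition is_struct :: "('f, 'r) vocab \<Rightarrow> ('f, 'r, 'a) struct \<Rightarrow> bool" where
  "is_struct L A \<longleftrightarrow>
     (\<forall>r. rli A r \<subseteq> (if r \<in> rels L then tuples (rar L r) (car A) else {})) \<and>
     (\<forall>g xs y. fni A g xs = Some y \<longrightarrow>
        g \<in> funs L \<and> xs \<in> tuples (far L g) (car A) \<and> y \<in> car A)"

definition iso ::
  "('f, 'r) vocab \<Rightarrow> ('a \<Rightarrow> 'b) \<Rightarrow> ('f, 'r, 'a) struct \<Rightarrow> ('f, 'r, 'b) struct \<Rightarrow> bool" where
  "iso L h A B \<longleftrightarrow> is_struct L A \<and> is_struct L B \<and> bij_betw h (car A) (car B) \<and>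
     (\<forall>r\<in>rels L. \<forall>xs. set xs \<subseteq> car A \<longrightarrow> (map h xs \<in> rli B r \<longleftrightarrow> xs \<in> rli A r)) \<and>
     (\<forall>g\<in>funs L. \<forall>xs. set xs \<subseteq> car A \<longrightarrow> fni B g (map h xs) = map_option h (fni A g xs))"

definition substructure ::
  "('f, 'r) vocab \<Rightarrow> ('f, 'r, 'a) struct \<Rightarrow> ('f, 'r, 'a) struct \<Rightarrow> bool" where
  "substructure L A B \<longleftrightarrow> is_struct L A \<and> is_struct L B \<and> car A \<subseteq> car B \<and>
     (\<forall>r\<in>rels L. rli A r = {xs \<in> rli B r. set xs \<subseteq> car A}) \<and>
     (\<forall>g\<in>funs L. \<forall>xs. set xs \<subseteq> car A \<longrightarrow> fni A g xs = fni B g xs)"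

definition restr :: "('f, 'r, 'a) struct \<Rightarrow> 'a set \<Rightarrow> ('f, 'r, 'a) struct" where
  "restr A X = \<lparr>car = X,
     fni = (\<lambda>g xs. if set xs \<subseteq> X then Option.bind (fni A g xs) (\<lambda>y. if y \<in> X then Some y else None)
                   else None),
     rli = (\<lambda>r. {xs \<in> rli A r. set xs \<subseteq> X})\<rparr>"

text \<open>Used for chains of substructures only, where the value \<open>y\<close> below is unique.\<close>

definition union_struct :: "('f, 'r, 'a) struct set \<Rightarrow> ('f, 'r, 'a) struct" where
  "union_struct \<C> = \<lparr>car = (\<Union>A\<in>\<C>. car A),
     fni = (\<lambda>g xs. if \<exists>A\<in>\<C>. \<exists>y. fni A g xs = Some y
                   then Some (THE y. \<exists>A\<in>\<C>. fni A g xs = Some y) else None),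
     rli = (\<lambda>r. \<Union>A\<in>\<C>. rli A r)\<rparr>"

section \<open>Abstract elementary classes\<close>

text \<open>
  HOL has no proper classes.  A cardinal \<open>\<kappa>\<close> (in the theorem: any uncountable regular one) plays the
  role of the class of all cardinals: the sets are the sets of cardinality \<open>< \<kappa>\<close>, and a class
  consists of structures of cardinality \<open>< \<kappa>\<close> with elements in one type.  For \<open>\<kappa>\<close> inaccessible
  this is the usual reading in a Grothendieck universe.
\<close>

record ('f, 'r, 'a) aclass =
  voc :: "('f, 'r) vocab"
  mods :: "('f, 'r, 'a) struct set"
  strong :: "('f, 'r, 'a) struct \<Rightarrow> ('f, 'r, 'a) struct \<Rightarrow> bool"

definition embedding ::
  "('f, 'r, 'a) aclass \<Rightarrow> ('a \<Rightarrow> 'a) \<Rightarrow> ('f, 'r, 'a) struct \<Rightarrow> ('f, 'r, 'a) struct \<Rightarrow> bool" where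
  "embedding \<K> h A B \<longleftrightarrow> A \<in> mods \<K> \<and> (\<exists>B'. iso (voc \<K>) h A B' \<and> strong \<K> B' B)"

text \<open>\<open>\<mu>\<close> is an upper bound for the Loewenheim-Skolem number, which by convention is infinite and at
  least the size of the vocabulary.  Hence \<open>LS(\<K>) = \<omega>\<close> means \<open>LS_bound \<K> natLeq\<close>.\<close>

definition LS_bound :: "('f, 'r, 'a) aclass \<Rightarrow> 'c rel \<Rightarrow> bool" where
  "LS_bound \<K> \<mu> \<longleftrightarrow> Card_order \<mu> \<and> cinfinite \<mu> \<and>
     |funs (voc \<K>)| \<le>o \<mu> \<and> |rels (voc \<K>)| \<le>o \<mu> \<and>
     (\<forall>A\<in>mods \<K>. \<forall>X\<subseteq>car A. \<exists>B. strong \<K> B A \<and> X \<subseteq> car B \<and> |car B| \<le>o |X| +c \<mu>)"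

text \<open>A set of structures that is well-ordered by the strong submodel relation is the range of an
  increasing sequence indexed by an ordinal.\<close>

definition aec :: "'k rel \<Rightarrow> ('f, 'r, 'a) aclass \<Rightarrow> bool" where
  "aec \<kappa> \<K> \<longleftrightarrow>
     (\<forall>A\<in>mods \<K>. is_struct (voc \<K>) A \<and> |car A| <o \<kappa>) \<and>
     (\<forall>A B. strong \<K> A B \<longrightarrow> A \<in> mods \<K> \<and> B \<in> mods \<K> \<and> substructure (voc \<K>) A B) \<and>
     (\<forall>A\<in>mods \<K>. strong \<K> A A) \<and>
     (\<forall>A B C. strong \<K> A B \<longrightarrow> strong \<K> B C \<longrightarrow> strong \<K> A C) \<and>
     (\<forall>A B h. A \<in> mods \<K> \<longrightarrow> iso (voc \<K>) h A B \<longrightarrow> B \<in> mods \<K>) \<and>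
     (\<forall>A B A' B' h. strong \<K> A B \<longrightarrow> iso (voc \<K>) h B B' \<longrightarrow> iso (voc \<K>) h A A' \<longrightarrow>
        strong \<K> A' B') \<and>
     (\<forall>A B C. strong \<K> A C \<longrightarrow> strong \<K> B C \<longrightarrow> car A \<subseteq> car B \<longrightarrow> strong \<K> A B) \<and>
     (\<forall>\<C>. \<C> \<noteq> {} \<longrightarrow> \<C> \<subseteq> mods \<K> \<longrightarrow> |\<C>| <o \<kappa> \<longrightarrow>
        (\<forall>\<S>\<subseteq>\<C>. \<S> \<noteq> {} \<longrightarrow> (\<exists>A\<in>\<S>. \<forall>B\<in>\<S>. strong \<K> A B)) \<longrightarrow>
        union_struct \<C> \<in> mods \<K> \<and>
        (\<forall>A\<in>\<C>. strong \<K> A (union_struct \<C>)) \<and>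
        (\<forall>N. (\<forall>A\<in>\<C>. strong \<K> A N) \<longrightarrow> strong \<K> (union_struct \<C>) N)) \<and>
     (\<exists>\<mu>::'k rel. \<mu> <o \<kappa> \<and> LS_bound \<K> \<mu>)"

definition amalgamation :: "('f, 'r, 'a) aclass \<Rightarrow> bool" where
  "amalgamation \<K> \<longleftrightarrow> (\<forall>A B C. strong \<K> A B \<longrightarrow> strong \<K> A C \<longrightarrow>
     (\<exists>D\<in>mods \<K>. \<exists>f g. embedding \<K> f B D \<and> embedding \<K> g C D \<and> (\<forall>x\<in>car A. f x = g x)))"

definition joint_embedding :: "('f, 'r, 'a) aclass \<Rightarrow> bool" where
  "joint_embedding \<K> \<longleftrightarrow> (\<forall>A\<in>mods \<K>. \<forall>B\<in>mods \<K>.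
     \<exists>D\<in>mods \<K>. \<exists>f g. embedding \<K> f A D \<and> embedding \<K> g B D)"

definition arbitrarily_large :: "'k rel \<Rightarrow> ('f, 'r, 'a) aclass \<Rightarrow> bool" where
  "arbitrarily_large \<kappa> \<K> \<longleftrightarrow> (\<forall>X::'k set. |X| <o \<kappa> \<longrightarrow> (\<exists>A\<in>mods \<K>. |X| \<le>o |car A| ))"

section \<open>Types in the monster model\<close>

definition Aut :: "('f, 'r) vocab \<Rightarrow> ('f, 'r, 'a) struct \<Rightarrow> 'a set \<Rightarrow> ('a \<Rightarrow> 'a) set" where
  "Aut L M A = {h. iso L h M M \<and> (\<forall>x\<in>A. h x = x)}"

definition monster :: "'d rel \<Rightarrow> ('f, 'r, 'a) aclass \<Rightarrow> ('f, 'r, 'a) struct \<Rightarrow> bool" where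
  "monster \<delta> \<K> M \<longleftrightarrow> M \<in> mods \<K> \<and>
     (\<forall>A B h. strong \<K> A M \<longrightarrow> strong \<K> B M \<longrightarrow> |car A| <o \<delta> \<longrightarrow> |car B| <o \<delta> \<longrightarrow>
        iso (voc \<K>) h A B \<longrightarrow> (\<exists>g\<in>Aut (voc \<K>) M {}. \<forall>x\<in>car A. g x = h x)) \<and>
     (\<forall>A\<in>mods \<K>. |car A| <o \<delta> \<longrightarrow> (\<exists>h. embedding \<K> h A M))"

definition model ::
  "'d rel \<Rightarrow> ('f, 'r, 'a) aclass \<Rightarrow> ('f, 'r, 'a) struct \<Rightarrow> ('f, 'r, 'a) struct \<Rightarrow> bool" where
  "model \<delta> \<K> M A \<longleftrightarrow> A \<in> mods \<K> \<and> strong \<K> A M \<and> |car A| <o \<delta>"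

text \<open>The Galois type of a finite tuple is its orbit.\<close>

definition gtype ::
  "('f, 'r) vocab \<Rightarrow> ('f, 'r, 'a) struct \<Rightarrow> 'a set \<Rightarrow> 'a list \<Rightarrow> 'a list set" where
  "gtype L M A a = {map h a | h. h \<in> Aut L M A}"

definition same_type ::
  "('f, 'r) vocab \<Rightarrow> ('f, 'r, 'a) struct \<Rightarrow> 'a set \<Rightarrow> 'a list \<Rightarrow> 'a list \<Rightarrow> bool" where
  "same_type L M A a b \<longleftrightarrow> (\<forall>B\<subseteq>A. finite B \<longrightarrow> gtype L M B a = gtype L M B b)"

text \<open>The same notion for (possibly infinite) tuples, given as families \<open>x\<close>, \<open>y\<close> indexed by \<open>I\<close>.\<close>

definition same_type_fam ::
  "('f, 'r) vocab \<Rightarrow> ('f, 'r, 'a) struct \<Rightarrow> 'a set \<Rightarrow> 'i set \<Rightarrow> ('i \<Rightarrow> 'a) \<Rightarrow> ('i \<Rightarrow> 'a) \<Rightarrow> bool" where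
  "same_type_fam L M A I x y \<longleftrightarrow>
     (\<forall>B\<subseteq>A. finite B \<longrightarrow> (\<exists>h\<in>Aut L M B. \<forall>i\<in>I. h (x i) = y i))"

definition splits ::
  "('f, 'r) vocab \<Rightarrow> ('f, 'r, 'a) struct \<Rightarrow> 'a list \<Rightarrow> 'a set \<Rightarrow> 'a set \<Rightarrow> bool" where
  "splits L M a B A \<longleftrightarrow> (\<exists>b c. set b \<subseteq> B \<and> set c \<subseteq> B \<and>
     same_type L M A b c \<and> \<not> same_type L M A (a @ b) (a @ c))"

definition indep ::
  "('f, 'r) vocab \<Rightarrow> ('f, 'r, 'a) struct \<Rightarrow> 'a list \<Rightarrow> 'a set \<Rightarrow> 'a set \<Rightarrow> bool" where
  "indep L M a B C \<longleftrightarrow> (\<exists>A\<subseteq>B. finite A \<and> \<not> splits L M a (B \<union> C) A)"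

definition indep_set ::
  "('f, 'r) vocab \<Rightarrow> ('f, 'r, 'a) struct \<Rightarrow> 'a set \<Rightarrow> 'a set \<Rightarrow> 'a set \<Rightarrow> bool" where
  "indep_set L M A B C \<longleftrightarrow> (\<forall>a. set a \<subseteq> A \<longrightarrow> indep L M a B C)"

section \<open>FUR-classes\<close>

definition AI :: "'d rel \<Rightarrow> ('f, 'r, 'a) aclass \<Rightarrow> ('f, 'r, 'a) struct \<Rightarrow> bool" where
  "AI \<delta> \<K> M \<longleftrightarrow> (\<forall>\<A> b A. model \<delta> \<K> M \<A> \<longrightarrow> countable (car \<A>) \<longrightarrow> set b \<subseteq> car M \<longrightarrow>
     A \<subseteq> car \<A> \<longrightarrow> finite A \<longrightarrow> (\<exists>a. set a \<subseteq> car \<A> \<and> same_type (voc \<K>) M A a b))"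

definition s_primary ::
  "'d rel \<Rightarrow> ('f, 'r, 'a) aclass \<Rightarrow> ('f, 'r, 'a) struct \<Rightarrow> 'a list \<Rightarrow>
   ('f, 'r, 'a) struct \<Rightarrow> ('f, 'r, 'a) struct \<Rightarrow> bool" where
  "s_primary \<delta> \<K> M a \<A> \<B> \<longleftrightarrow> model \<delta> \<K> M \<B> \<and>
     (\<exists>s::nat \<Rightarrow> 'a. car \<B> = car \<A> \<union> set a \<union> range s \<and>
        (\<forall>n. \<exists>An\<subseteq>car \<A>. finite An \<and>
           (\<forall>a' s'. set a' \<subseteq> car M \<longrightarrow> set s' \<subseteq> car M \<longrightarrow> length s' = Suc n \<longrightarrow>
              same_type (voc \<K>) M (car \<A>) a' a \<longrightarrow>
              same_type (voc \<K>) M An (a' @ s') (a @ map s [0..<Suc n]) \<longrightarrow>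
              same_type (voc \<K>) M (car \<A>) (a' @ s') (a @ map s [0..<Suc n]))))"

definition AII :: "'d rel \<Rightarrow> ('f, 'r, 'a) aclass \<Rightarrow> ('f, 'r, 'a) struct \<Rightarrow> bool" where
  "AII \<delta> \<K> M \<longleftrightarrow> (\<forall>a \<A>. set a \<subseteq> car M \<longrightarrow> model \<delta> \<K> M \<A> \<longrightarrow> countable (car \<A>) \<longrightarrow>
     (\<exists>\<B>. s_primary \<delta> \<K> M a \<A> \<B>))"

text \<open>The family \<open>(\<A>\<^sub>i)\<^sub>i\<close> of models is given by the set \<open>\<S>\<close> of its members.\<close>

definition weakly_elementary ::
  "('f, 'r, 'a) aclass \<Rightarrow> ('f, 'r, 'a) struct \<Rightarrow> ('f, 'r, 'a) struct set \<Rightarrow> ('a \<Rightarrow> 'a) \<Rightarrow> bool" where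
  "weakly_elementary \<K> M \<S> f \<longleftrightarrow> f ` (\<Union>A\<in>\<S>. car A) \<subseteq> car M \<and>
     (\<forall>a. set a \<subseteq> (\<Union>A\<in>\<S>. car A) \<longrightarrow> same_type (voc \<K>) M {} a (map f a)) \<and>
     (\<forall>A\<in>\<S>. strong \<K> (restr M (f ` car A)) M)"

definition s_prime ::
  "'d rel \<Rightarrow> ('f, 'r, 'a) aclass \<Rightarrow> ('f, 'r, 'a) struct \<Rightarrow> ('f, 'r, 'a) struct set \<Rightarrow>
   ('f, 'r, 'a) struct \<Rightarrow> bool" where
  "s_prime \<delta> \<K> M \<S> D \<longleftrightarrow> model \<delta> \<K> M D \<and> (\<Union>A\<in>\<S>. car A) \<subseteq> car D \<and>
     (\<forall>B f. model \<delta> \<K> M B \<longrightarrow> f ` (\<Union>A\<in>\<S>. car A) \<subseteq> car B \<longrightarrow> weakly_elementary \<K> M \<S> f \<longrightarrow>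
        (\<exists>g. embedding \<K> g D B \<and> (\<forall>x\<in>(\<Union>A\<in>\<S>. car A). g x = f x)))"

definition AIII :: "'d rel \<Rightarrow> ('f, 'r, 'a) aclass \<Rightarrow> ('f, 'r, 'a) struct \<Rightarrow> bool" where
  "AIII \<delta> \<K> M \<longleftrightarrow> (\<forall>A B C. model \<delta> \<K> M A \<longrightarrow> model \<delta> \<K> M B \<longrightarrow> model \<delta> \<K> M C \<longrightarrow>
     indep_set (voc \<K>) M (car A) (car B) (car C) \<longrightarrow> car B = car A \<inter> car C \<longrightarrow>
     (\<exists>D. s_prime \<delta> \<K> M {A, C} D \<and> (\<forall>D'. s_prime \<delta> \<K> M {A, C} D' \<longrightarrow> D' = D) \<and>
        (\<forall>C'. model \<delta> \<K> M C' \<longrightarrow> car C \<subseteq> car C' \<longrightarrow>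
           indep_set (voc \<K>) M (car A) (car B) (car C') \<longrightarrow>
           indep_set (voc \<K>) M (car D) (car C) (car C'))))"

text \<open>
  The game \<open>GI(a, A, \<A>)\<close>.  A history is the list of the moves \<open>(a\<^sub>k, A'\<^sub>k)\<close> of player I; a strategy
  \<open>\<sigma>\<close> of player II maps each nonempty history to the answer of II to its last move.
\<close>

definition gi_move ::
  "('f, 'r) vocab \<Rightarrow> ('f, 'r, 'a) struct \<Rightarrow> 'a set \<Rightarrow>
   'a list \<times> 'a set \<Rightarrow> 'a list \<times> 'a set \<Rightarrow> bool" where
  "gi_move L M X p m \<longleftrightarrow>
     set (fst m) \<subseteq> car M \<and> finite (snd m) \<and> snd p \<subseteq> snd m \<and> snd m \<subseteq> X \<and>
     same_type L M (snd p) (fst m) (fst p) \<and> \<not> same_type L M (snd m) (fst m) (fst p)"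

definition gi_pos ::
  "'a list \<Rightarrow> 'a set \<Rightarrow> (('a list \<times> 'a set) list \<Rightarrow> 'a set) \<Rightarrow>
   ('a list \<times> 'a set) list \<Rightarrow> 'a list \<times> 'a set" where
  "gi_pos a A \<sigma> ms = (if ms = [] then (a, A) else (fst (last ms), \<sigma> ms))"

inductive gi_play ::
  "('f, 'r) vocab \<Rightarrow> ('f, 'r, 'a) struct \<Rightarrow> 'a set \<Rightarrow> 'a list \<Rightarrow> 'a set \<Rightarrow>
   (('a list \<times> 'a set) list \<Rightarrow> 'a set) \<Rightarrow> ('a list \<times> 'a set) list \<Rightarrow> bool"
  for L M X a A \<sigma> where
  gi_start: "gi_play L M X a A \<sigma> []"
| gi_step: "gi_play L M X a A \<sigma> ms \<Longrightarrow> gi_move L M X (gi_pos a A \<sigma> ms) m \<Longrightarrow>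
     gi_play L M X a A \<sigma> (ms @ [m])"

definition II_wins ::
  "('f, 'r) vocab \<Rightarrow> ('f, 'r, 'a) struct \<Rightarrow> 'a set \<Rightarrow> 'a list \<Rightarrow> 'a set \<Rightarrow> nat \<Rightarrow> bool" where
  "II_wins L M X a A n \<longleftrightarrow> (\<exists>\<sigma>. \<forall>ms. gi_play L M X a A \<sigma> ms \<longrightarrow>
     length ms \<le> n \<and>
     (ms \<noteq> [] \<longrightarrow> finite (\<sigma> ms) \<and> snd (last ms) \<subseteq> \<sigma> ms \<and> \<sigma> ms \<subseteq> X))"

definition AIV :: "'d rel \<Rightarrow> ('f, 'r, 'a) aclass \<Rightarrow> ('f, 'r, 'a) struct \<Rightarrow> bool" where
  "AIV \<delta> \<K> M \<longleftrightarrow> (\<forall>a. set a \<subseteq> car M \<longrightarrow> (\<exists>n. \<forall>\<A> A. model \<delta> \<K> M \<A> \<longrightarrow> countable (car \<A>) \<longrightarrow>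
     A \<subseteq> car \<A> \<longrightarrow> finite A \<longrightarrow> II_wins (voc \<K>) M (car \<A>) a A n))"

definition AV :: "'d rel \<Rightarrow> ('f, 'r, 'a) aclass \<Rightarrow> ('f, 'r, 'a) struct \<Rightarrow> bool" where
  "AV \<delta> \<K> M \<longleftrightarrow> (\<forall>\<A> \<B> a. model \<delta> \<K> M \<A> \<longrightarrow> model \<delta> \<K> M \<B> \<longrightarrow>
     countable (car \<A>) \<longrightarrow> countable (car \<B>) \<longrightarrow> car \<A> \<subseteq> car \<B> \<longrightarrow> set a \<subseteq> car M \<longrightarrow>
     indep_set (voc \<K>) M (car \<B>) (car \<A>) (set a) \<longrightarrow> indep (voc \<K>) M a (car \<A>) (car \<B>))"

text \<open>In the next definition \<open>\<B>\<close> is enumerated by itself and \<open>\<C>\<close> by \<open>c\<close>.\<close>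

definition AVI :: "'d rel \<Rightarrow> ('f, 'r, 'a) aclass \<Rightarrow> ('f, 'r, 'a) struct \<Rightarrow> bool" where
  "AVI \<delta> \<K> M \<longleftrightarrow> (\<forall>\<A> \<B> \<D>. model \<delta> \<K> M \<A> \<longrightarrow> model \<delta> \<K> M \<B> \<longrightarrow> model \<delta> \<K> M \<D> \<longrightarrow>
     car \<A> \<subseteq> car \<B> \<inter> car \<D> \<longrightarrow>
     (\<exists>\<C> c. model \<delta> \<K> M \<C> \<and> c ` car \<B> = car \<C> \<and>
        same_type_fam (voc \<K>) M (car \<A>) (car \<B>) (\<lambda>b. b) c \<and>
        indep_set (voc \<K>) M (car \<C>) (car \<A>) (car \<D>)))"

definition fur_class ::
  "'k rel \<Rightarrow> 'd rel \<Rightarrow> ('f, 'r, 'a) aclass \<Rightarrow> ('f, 'r, 'a) struct \<Rightarrow> bool" where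
  "fur_class \<kappa> \<delta> \<K> M \<longleftrightarrow>
     aec \<kappa> \<K> \<and> monster \<delta> \<K> M \<and>
     amalgamation \<K> \<and> joint_embedding \<K> \<and> LS_bound \<K> natLeq \<and>
     arbitrarily_large \<kappa> \<K> \<and> (\<forall>A\<in>mods \<K>. infinite (car A)) \<and>
     AI \<delta> \<K> M \<and> AII \<delta> \<K> M \<and> AIII \<delta> \<K> M \<and> AIV \<delta> \<K> M \<and> AV \<delta> \<K> M \<and> AVI \<delta> \<K> M"

section \<open>The class of imaginaries\<close>

definition id_rel :: "('f, 'r, 'a) struct \<Rightarrow> 'a list rel" where
  "id_rel M = {([x], [x]) | x. x \<in> car M}"

definition eq_collection ::
  "('f, 'r, 'a) aclass \<Rightarrow> ('f, 'r, 'a) struct \<Rightarrow> 'a list rel set \<Rightarrow> bool" where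
  "eq_collection \<K> M \<E> \<longleftrightarrow> countable \<E> \<and> id_rel M \<in> \<E> \<and>
     (\<forall>E\<in>\<E>. \<exists>n. equiv (tuples n (car M)) E \<and>
        (\<exists>G. countable G \<and> (\<forall>a\<in>tuples n (car M). \<forall>b\<in>tuples n (car M).
           (a, b) \<in> E \<longleftrightarrow> gtype (voc \<K>) M {} (a @ b) \<in> G)))"

definition eq_arity :: "('f, 'r, 'a) struct \<Rightarrow> 'a list rel \<Rightarrow> nat" where
  "eq_arity M E = (THE n. equiv (tuples n (car M)) E)"

text \<open>Equality of Galois types over the empty set of tuples in members of the class that need not
  be submodels of the monster.\<close>

definition same_gtype ::
  "('f, 'r, 'a) aclass \<Rightarrow> ('f, 'r, 'a) struct \<Rightarrow> 'a list \<Rightarrow> ('f, 'r, 'a) struct \<Rightarrow> 'a list \<Rightarrow> bool" where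
  "same_gtype \<K> A a B b \<longleftrightarrow>
     (\<exists>C\<in>mods \<K>. \<exists>f g. embedding \<K> f A C \<and> embedding \<K> g B C \<and> map f a = map g b)"

text \<open>The relation that \<open>E\<close> defines on an arbitrary member \<open>A\<close> of the class.  For \<open>A \<preceq> M\<close> it is the
  restriction of \<open>E\<close>.\<close>

definition eq_on ::
  "('f, 'r, 'a) aclass \<Rightarrow> ('f, 'r, 'a) struct \<Rightarrow> 'a list rel \<Rightarrow> ('f, 'r, 'a) struct \<Rightarrow> 'a list rel" where
  "eq_on \<K> M E A = {(a, b). a \<in> tuples (eq_arity M E) (car A) \<and> b \<in> tuples (eq_arity M E) (car A) \<and>
     (\<exists>(a', b')\<in>E. same_gtype \<K> A (a @ b) M (a' @ b'))}"

text \<open>The element \<open>a/E\<close> carries its sort \<open>E\<close> as a tag, so distinct sorts are disjoint.\<close>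

type_synonym 'a imag = "'a list rel \<times> 'a list set"

definition imag ::
  "('f, 'r, 'a) aclass \<Rightarrow> ('f, 'r, 'a) struct \<Rightarrow> ('f, 'r, 'a) struct \<Rightarrow> 'a list rel \<Rightarrow> 'a list \<Rightarrow> 'a imag" where
  "imag \<K> M A E a = (E, eq_on \<K> M E A `` {a})"

text \<open>The identification of \<open>x\<close> with \<open>x/=\<close>.\<close>

definition home ::
  "('f, 'r, 'a) aclass \<Rightarrow> ('f, 'r, 'a) struct \<Rightarrow> ('f, 'r, 'a) struct \<Rightarrow> 'a \<Rightarrow> 'a imag" where
  "home \<K> M A x = imag \<K> M A (id_rel M) [x]"

text \<open>In the vocabulary, the symbols \<open>F\<^sub>E\<close> and \<open>P\<^sub>E\<close> are \<open>Inr E\<close>.\<close>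

definition eq_voc ::
  "('f, 'r, 'a) aclass \<Rightarrow> ('f, 'r, 'a) struct \<Rightarrow> 'a list rel set \<Rightarrow>
   ('f + 'a list rel, 'r + 'a list rel) vocab" where
  "eq_voc \<K> M \<E> = \<lparr>funs = Inl ` funs (voc \<K>) \<union> Inr ` \<E>, rels = Inl ` rels (voc \<K>) \<union> Inr ` \<E>,
     far = case_sum (far (voc \<K>)) (eq_arity M), rar = case_sum (rar (voc \<K>)) (\<lambda>_. 1)\<rparr>"

definition eq_struct ::
  "('f, 'r, 'a) aclass \<Rightarrow> ('f, 'r, 'a) struct \<Rightarrow> 'a list rel set \<Rightarrow> ('f, 'r, 'a) struct \<Rightarrow>
   ('f + 'a list rel, 'r + 'a list rel, 'a imag) struct" where
  "eq_struct \<K> M \<E> A =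
    (let \<eta> = home \<K> M A; \<theta> = the_inv_into (car A) \<eta> in
     \<lparr>car = {imag \<K> M A E a | E a. E \<in> \<E> \<and> a \<in> tuples (eq_arity M E) (car A)},
      fni = (\<lambda>g xs. if set xs \<subseteq> \<eta> ` car A then
               (case g of
                  Inl g' \<Rightarrow> map_option \<eta> (fni A g' (map \<theta> xs))
                | Inr E \<Rightarrow> if E \<in> \<E> \<and> length xs = eq_arity M E
                           then Some (imag \<K> M A E (map \<theta> xs)) else None)
             else None),
      rli = (\<lambda>r. case r of
                  Inl r' \<Rightarrow> map \<eta> ` rli A r'
                | Inr E \<Rightarrow> if E \<in> \<E> then {[imag \<K> M A E a] | a. a \<in> tuples (eq_arity M E) (car A)}
                           else {})\<rparr>)"

text \<open>The home sort \<open>P\<^sub>=\<close> of a structure for the extended vocabulary, with its original structure.\<close>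

definition home_sort ::
  "('f, 'r, 'a) struct \<Rightarrow> ('f + 'a list rel, 'r + 'a list rel, 'b) struct \<Rightarrow> ('f, 'r, 'b) struct" where
  "home_sort M B = restr \<lparr>car = car B, fni = (\<lambda>g. fni B (Inl g)), rli = (\<lambda>r. rli B (Inl r))\<rparr>
     {x. [x] \<in> rli B (Inr (id_rel M))}"

text \<open>The strong submodel relation of \<open>\<K>\<close> for isomorphic copies with elements in another type.\<close>

definition strong_copy ::
  "('f, 'r, 'a) aclass \<Rightarrow> ('f, 'r, 'b) struct \<Rightarrow> ('f, 'r, 'b) struct \<Rightarrow> bool" where
  "strong_copy \<K> X Y \<longleftrightarrow> (\<exists>A B h. strong \<K> A B \<and> iso (voc \<K>) h A X \<and> iso (voc \<K>) h B Y)"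

text \<open>
  \<open>\<K>\<^sup>e\<^sup>q\<close>, closed under isomorphism as a class of structures has to be.  As \<open>\<A>\<close> is identified with the
  home sort of \<open>\<A>\<^sup>e\<^sup>q\<close>, the condition \<open>\<A> \<preceq> \<B>\<close> in the definition of the strong submodel relation is
  imposed on the home sorts.
\<close>

definition eq_class ::
  "('f, 'r, 'a) aclass \<Rightarrow> ('f, 'r, 'a) struct \<Rightarrow> 'a list rel set \<Rightarrow>
   ('f + 'a list rel, 'r + 'a list rel, 'a imag) aclass" where
  "eq_class \<K> M \<E> =
    (let Q = {B. \<exists>A\<in>mods \<K>. \<exists>h. iso (eq_voc \<K> M \<E>) h (eq_struct \<K> M \<E> A) B} in
     \<lparr>voc = eq_voc \<K> M \<E>,
      mods = Q,
      strong = (\<lambda>A B. A \<in> Q \<and> B \<in> Q \<and> substructure (eq_voc \<K> M \<E>) A B \<and>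
                      strong_copy \<K> (home_sort M A) (home_sort M B))\<rparr>)"

end

theory Submission
  imports Defs
begin

text \<open>
  Up to isomorphism, a member of \<open>\<K>\<^sup>e\<^sup>q\<close> is a member \<open>A\<close> of \<open>\<K>\<close> together with a name for each class of
  tuples of \<open>A\<close>.  Embeddings preserve and reflect the relations that \<open>E\<close> defines, so that embeddings,
  unions of chains, models and automorphisms of \<open>\<M>\<^sup>e\<^sup>q\<close> correspond to those of the home sort.

  A tuple of imaginaries is the value of an invariant function at a home tuple.  Non-splitting over a
  finite set goes down to such values because two lifts of tuples with the same type can, by
  s-saturation, be chosen to have the same type.  This gives (AI), (AIII) and (AVI).  In (AIV) player
  II follows the strategy for a lift, which exists after one move.  For (AII) one needs a lift of \<open>x\<close> that
  is isolated over \<open>\<A>x\<close>; if there were none, player I would never be stuck in the game for a lift of \<open>x\<close>.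
  For (AV), (AVI) yields a copy \<open>\<B>'\<close> of \<open>\<B>\<close> over \<open>\<A>\<close> that is independent from a lift of \<open>a\<close>; by
  stationarity \<open>\<B>'\<close> and \<open>\<B>\<close> have the same type over \<open>\<A>a\<close>, so the symmetry for \<open>\<B>'\<close> in the home sort
  carries over to \<open>\<B>\<close>.
\<close>

section \<open>Transport of structure\<close>

text \<open>\<open>\<K>\<^sup>e\<^sup>q\<close> is closed under isomorphism, so its members carry no
  canonical home structure with elements of type \<open>'a\<close>. They are written
  \<open>eqst \<Phi> A\<close>, where \<open>\<Phi>\<close> is any naming of the classes of
  \<open>A\<close>. The home sort and the functions F_E determine \<open>A\<close> and
  \<open>\<Phi>\<close> up to one bijection, and each AEC axiom becomes the search for a naming
  common to the structures in question. For chains it comes from a single injection of all home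
  sorts into \<open>'a\<close>; there the regularity of \<open>\<kappa>\<close> and the existence of
  large members enter.

  The second obstacle is that an automorphism fixing a/E may move a. Going up is harmless: weak
  types are tested on finite sets, a finite part of \<open>up X\<close> lies in \<open>up Z\<close>
  for some finite \<open>Z\<close> in \<open>X\<close>, and fixing \<open>Z\<close> fixes
  \<open>up Z\<close>. Going down, only home elements whose copies are among the parameters stay
  fixed. Hence finite bases of imaginaries are taken inside, or enlarged by, images of home sets
  under \<open>\<eta>\<close>.\<close>

definition copy :: "('a \<Rightarrow> 'b) \<Rightarrow> ('f, 'r, 'a) struct \<Rightarrow> ('f, 'r, 'b) struct" where
  "copy h A = \<lparr>car = h ` car A,
     fni = (\<lambda>g xs. if set xs \<subseteq> h ` car A
                   then map_option h (fni A g (map (inv_into (car A) h) xs)) else None),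
     rli = (\<lambda>r. map h ` rli A r)\<rparr>"

lemma car_copy [simp]: "car (copy h A) = h ` car A" by (simp add: copy_def)

lemma rli_copy: "rli (copy h A) r = map h ` rli A r" by (simp add: copy_def)

lemma tuplesD: "xs \<in> tuples n X \<Longrightarrow> length xs = n" "xs \<in> tuples n X \<Longrightarrow> set xs \<subseteq> X"
  by (auto simp: tuples_def)

lemma map_in_tuples: "xs \<in> tuples n X \<Longrightarrow> h ` X \<subseteq> Y \<Longrightarrow> map h xs \<in> tuples n Y"
  by (auto simp: tuples_def)

lemma map_inv_into_map: "inj_on h X \<Longrightarrow> set xs \<subseteq> X \<Longrightarrow> map (inv_into X h) (map h xs) = xs"
  by (auto simp: map_idI subset_iff)

lemma map_eq_iff_inj_on:
  "inj_on h X \<Longrightarrow> set xs \<subseteq> X \<Longrightarrow> set ys \<subseteq> X \<Longrightarrow> map h xs = map h ys \<longleftrightarrow> xs = ys" by (metis map_inv_into_map)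

lemma lists_image_subset: "set ys \<subseteq> h ` X \<Longrightarrow> \<exists>xs. set xs \<subseteq> X \<and> ys = map h xs"
  by (rule exI[of _ "map (inv_into X h) ys"]) (auto simp: inv_into_into subset_iff f_inv_into_f intro!: map_idI[symmetric])

lemma map_in_image_map:
  "inj_on h X \<Longrightarrow> R \<subseteq> {xs. set xs \<subseteq> X} \<Longrightarrow> set xs \<subseteq> X \<Longrightarrow> map h xs \<in> map h ` R \<longleftrightarrow> xs \<in> R"
  using map_eq_iff_inj_on[of h X xs] by (smt (verit, best) Ball_Collect image_iff)

lemma fni_copy:
  "inj_on h (car A) \<Longrightarrow> set xs \<subseteq> car A \<Longrightarrow> fni (copy h A) g (map h xs) = map_option h (fni A g xs)"
  using map_inv_into_map[of h "car A" xs] by (simp add: copy_def image_mono del: map_map)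

lemma is_struct_rliD: "is_struct L A \<Longrightarrow> xs \<in> rli A r \<Longrightarrow> r \<in> rels L \<and> xs \<in> tuples (rar L r) (car A)"
  unfolding is_struct_def by (cases "r \<in> rels L") (auto dest!: spec[of _ r])

lemma is_struct_fniD: "is_struct L A \<Longrightarrow> fni A g xs = Some y \<Longrightarrow>
    g \<in> funs L \<and> xs \<in> tuples (far L g) (car A) \<and> y \<in> car A" unfolding is_struct_def by blast

lemma is_struct_fni_None: "is_struct L A \<Longrightarrow> g \<notin> funs L \<or> \<not> set xs \<subseteq> car A \<Longrightarrow> fni A g xs = None"
  using is_struct_fniD[of L A g xs] by (cases "fni A g xs") (auto simp: tuples_def)

lemma is_structI:
  assumes "\<And>r xs. xs \<in> rli A r \<Longrightarrow> r \<in> rels L \<and> xs \<in> tuples (rar L r) (car A)"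
    and "\<And>g xs y. fni A g xs = Some y \<Longrightarrow> g \<in> funs L \<and> xs \<in> tuples (far L g) (car A) \<and> y \<in> car A"
  shows "is_struct L A"
  unfolding is_struct_def using assms by fastforce

lemma struct_eqI: "car A = car B \<Longrightarrow> (\<And>g xs. fni A g xs = fni B g xs) \<Longrightarrow> (\<And>r. rli A r = rli B r) \<Longrightarrow> A = B"
  for A B :: "('f, 'r, 'a) struct" by (cases A, cases B) (auto intro!: ext)

lemma is_struct_copy:
  assumes "is_struct L A" "inj_on h (car A)"
  shows "is_struct L (copy h A)"
proof (rule is_structI)
  fix r xs assume "xs \<in> rli (copy h A) r"
  then obtain ys where "ys \<in> rli A r" "xs = map h ys" by (auto simp: rli_copy)
  with is_struct_rliD[OF assms(1)] show "r \<in> rels L \<and> xs \<in> tuples (rar L r) (car (copy h A))"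
    by (force simp: tuples_def)
next
  fix g xs y assume a: "fni (copy h A) g xs = Some y"
  then have "set xs \<subseteq> h ` car A" by (auto simp: copy_def split: if_splits)
  then obtain ys where ys: "set ys \<subseteq> car A" "xs = map h ys" using lists_image_subset[of _ h] by blast
  with a assms obtain z where "fni A g ys = Some z" "y = h z" by (auto simp: fni_copy)
  with is_struct_fniD[OF assms(1)] ys
  show "g \<in> funs L \<and> xs \<in> tuples (far L g) (car (copy h A)) \<and> y \<in> car (copy h A)"
    by (force simp: tuples_def)
qed

lemma iso_copy:
  assumes "is_struct L A" "inj_on h (car A)"
  shows "iso L h A (copy h A)"
proof -
  have "rli A r \<subseteq> {xs. set xs \<subseteq> car A}" for r
    using is_struct_rliD[OF assms(1)] by (auto simp: tuples_def)
  then show ?thesis unfolding iso_def using assms is_struct_copy[OF assms]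
    by (auto simp: fni_copy inj_on_imp_bij_betw rli_copy map_in_image_map)
qed

text \<open>A structure has no values outside its vocabulary and carrier, so the bijection
  determines the target. From here on isomorphisms are handled by the operation \<open>copy\<close>,
  with equations in place of existence statements.\<close>

lemma iso_eq_copy:
  assumes "iso L h A B"
  shows "B = copy h A"
proof -
  have A: "is_struct L A" and B: "is_struct L B" and h: "inj_on h (car A)" "car B = h ` car A"
    and R: "\<And>r xs. r \<in> rels L \<Longrightarrow> set xs \<subseteq> car A \<Longrightarrow> map h xs \<in> rli B r \<longleftrightarrow> xs \<in> rli A r"
    and F: "\<And>g xs. g \<in> funs L \<Longrightarrow> set xs \<subseteq> car A \<Longrightarrow> fni B g (map h xs) = map_option h (fni A g xs)"
    using assms by (auto simp: iso_def bij_betw_def)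
  have 1: "rli B r = map h ` rli A r" for r
  proof (intro equalityI subsetI)
    fix ys assume ys: "ys \<in> rli B r"
    then have r: "r \<in> rels L" "set ys \<subseteq> h ` car A" using is_struct_rliD[OF B] h by (auto simp: tuples_def)
    then obtain xs where "set xs \<subseteq> car A" "ys = map h xs" using lists_image_subset[of _ h] by blast
    then show "ys \<in> map h ` rli A r" using R[OF r(1)] ys by blast
  next
    fix ys assume "ys \<in> map h ` rli A r"
    then obtain xs where xs: "xs \<in> rli A r" "ys = map h xs" by blast
    then have "r \<in> rels L" "set xs \<subseteq> car A" using is_struct_rliD[OF A] by (auto simp: tuples_def)
    then show "ys \<in> rli B r" using R xs by blast
  qed
  have 2: "fni B g ys = fni (copy h A) g ys" for g ys
  proof (cases "g \<in> funs L \<and> set ys \<subseteq> h ` car A")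
    case True
    then obtain xs where "set xs \<subseteq> car A" "ys = map h xs" using lists_image_subset[of _ h] by blast
    then show ?thesis using F True by (simp add: fni_copy h)
  next
    case False
    have "fni B g ys = None" using is_struct_fni_None[OF B, of g ys] False h by simp
    moreover have "fni (copy h A) g ys = None"
      using is_struct_fni_None[OF is_struct_copy[OF A h(1)], of g ys] False by simp
    ultimately show ?thesis by simp
  qed
  show ?thesis by (rule struct_eqI) (use h 1 2 in \<open>auto simp: rli_copy\<close>)
qed

lemma iso_iff_copy: "iso L h A B \<longleftrightarrow> is_struct L A \<and> inj_on h (car A) \<and> B = copy h A"
  using iso_eq_copy iso_copy by (metis iso_def bij_betw_def)

lemma copy_cong:
  assumes "is_struct L A" "\<And>x. x \<in> car A \<Longrightarrow> h x = g x"
  shows "copy h A = copy g A"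
proof (rule struct_eqI)
  show c: "car (copy h A) = car (copy g A)" using assms by auto
  \<comment> \<open>\<open>inv_into\<close> chooses by a condition that is tested on the carrier
    only, so the two inverses are equal as total functions.\<close>
  have i: "inv_into (car A) h = inv_into (car A) g"
    using assms(2) by (auto simp: inv_into_def fun_eq_iff intro!: arg_cong[where f = Eps])
  show "fni (copy h A) k xs = fni (copy g A) k xs" for k xs
  proof -
    have "map_option h (fni A k ys) = map_option g (fni A k ys)" for ys
      using is_struct_fniD[OF assms(1)] assms(2) by (cases "fni A k ys") auto
    then show ?thesis using c by (auto simp: copy_def i)
  qed
  show "rli (copy h A) r = rli (copy g A) r" for r
  proof -
    have "map h xs = map g xs" if "xs \<in> rli A r" for xs
      using is_struct_rliD[OF assms(1) that] assms(2) by (auto simp: tuples_def)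
    then show ?thesis unfolding rli_copy by (rule image_cong[OF refl])
  qed
qed

lemma copy_copy:
  assumes "is_struct L A" "inj_on h (car A)" "inj_on g (h ` car A)"
  shows "copy g (copy h A) = copy (g \<circ> h) A"
proof (rule struct_eqI)
  show "car (copy g (copy h A)) = car (copy (g \<circ> h) A)" by auto
  show "rli (copy g (copy h A)) r = rli (copy (g \<circ> h) A) r" for r by (auto simp: rli_copy image_comp)
  have gh: "inj_on (g \<circ> h) (car A)" using assms comp_inj_on by blast
  show "fni (copy g (copy h A)) k ys = fni (copy (g \<circ> h) A) k ys" for k ys
  proof (cases "set ys \<subseteq> (g \<circ> h) ` car A")
    case True
    then obtain xs where xs: "set xs \<subseteq> car A" "ys = map (g \<circ> h) xs" using lists_image_subset by blast
    have "fni (copy g (copy h A)) k (map g (map h xs)) = map_option g (map_option h (fni A k xs))"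
      using assms xs by (subst fni_copy) (auto simp: fni_copy)
    then show ?thesis using fni_copy[OF gh xs(1)] xs by (simp add: option.map_comp)
  next
    case False
    then show ?thesis by (auto simp: copy_def)
  qed
qed

lemma copy_ident:
  assumes "is_struct L A" "\<And>x. x \<in> car A \<Longrightarrow> h x = x"
  shows "copy h A = A"
proof -
  have "copy h A = copy (\<lambda>x. x) A" by (rule copy_cong[OF assms(1)]) (use assms in auto)
  also have "iso L (\<lambda>x. x) A A" using assms(1) by (auto simp: iso_def bij_betw_def option.map_ident)
  then have "copy (\<lambda>x. x) A = A" using iso_eq_copy by metis
  finally show ?thesis .
qed

lemma copy_inv_into: "is_struct L A \<Longrightarrow> inj_on h (car A) \<Longrightarrow> copy (inv_into (car A) h) (copy h A) = A"
  by (subst copy_copy) (auto intro: copy_ident inj_on_inv_into)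

text \<open>\<open>k\<close> is the transition map between two presentations of one structure. It
  will compare the home structures hidden in equal structures of imaginaries.\<close>

lemma copy_inj:
  assumes "is_struct L A" "is_struct L B" "inj_on h (car A)" "inj_on g (car B)" "copy h A = copy g B"
  defines "k \<equiv> inv_into (car B) g \<circ> h"
  shows "inj_on k (car A)" "B = copy k A" "\<And>x. x \<in> car A \<Longrightarrow> g (k x) = h x"
proof -
  have c: "h ` car A = g ` car B" by (metis assms(5) car_copy)
  have i: "inj_on (inv_into (car B) g) (h ` car A)" by (metis c inj_on_inv_into order_refl)
  show "inj_on k (car A)" unfolding k_def using i assms(3) comp_inj_on by blast
  have "B = copy (inv_into (car B) g) (copy g B)" using copy_inv_into assms by metis
  also have "\<dots> = copy (inv_into (car B) g) (copy h A)" using assms by simp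
  also have "\<dots> = copy k A" unfolding k_def using copy_copy[OF assms(1,3) i] .
  finally show "B = copy k A" .
  show "\<And>x. x \<in> car A \<Longrightarrow> g (k x) = h x" unfolding k_def using c by (metis comp_apply f_inv_into_f imageI)
qed

section \<open>Substructures are determined by their carriers\<close>

lemma substructureD:
  assumes "substructure L A B"
  shows "is_struct L A" "is_struct L B" "car A \<subseteq> car B"
    "rli A r = {xs \<in> rli B r. set xs \<subseteq> car A}"
    "set xs \<subseteq> car A \<Longrightarrow> fni A g xs = fni B g xs"
proof -
  show A: "is_struct L A" and B: "is_struct L B" and "car A \<subseteq> car B"
    using assms by (auto simp: substructure_def)
  show "rli A r = {xs \<in> rli B r. set xs \<subseteq> car A}"
  proof (cases "r \<in> rels L")
    case True then show ?thesis using assms by (auto simp: substructure_def)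
  next
    case False then show ?thesis using is_struct_rliD[OF A] is_struct_rliD[OF B] by blast
  qed
  show "fni A g xs = fni B g xs" if "set xs \<subseteq> car A"
  proof (cases "g \<in> funs L")
    case True then show ?thesis using assms that by (auto simp: substructure_def)
  next
    case False then show ?thesis
      using is_struct_fni_None[OF A, of g xs] is_struct_fni_None[OF B, of g xs] by simp
  qed
qed

text \<open>The conventions of \<open>is_struct\<close> leave no freedom once the carrier is known.
  This connects the operation \<open>restr\<close> in \<open>weakly_elementary\<close> with strong
  submodels.\<close>

lemma substructure_restr:
  assumes "substructure L A B"
  shows "A = restr B (car A)"
proof (rule struct_eqI)
  show "car A = car (restr B (car A))" by (simp add: restr_def)
  show "rli A r = rli (restr B (car A)) r" for r
    using substructureD(4)[OF assms] by (simp add: restr_def)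
  show "fni A g xs = fni (restr B (car A)) g xs" for g xs
  proof (cases "set xs \<subseteq> car A")
    case True
    then have "fni A g xs = fni B g xs" using substructureD(5)[OF assms] by blast
    with True show ?thesis using is_struct_fniD[OF substructureD(1)[OF assms], of g xs]
      by (cases "fni B g xs") (auto simp: restr_def)
  next
    case False
    then show ?thesis using is_struct_fni_None[OF substructureD(1)[OF assms], of g xs]
      by (simp add: restr_def)
  qed
qed

lemma substructure_eq: "substructure L A C \<Longrightarrow> substructure L B C \<Longrightarrow> car A = car B \<Longrightarrow> A = B"
  using substructure_restr by metis

section \<open>FUR-classes\<close>

lemma countable_iff_ordLeq: "countable X \<longleftrightarrow> |X| \<le>o natLeq"
proof -
  have "countable X \<longleftrightarrow> |X| \<le>o |UNIV :: nat set|"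
    unfolding countable_def card_of_ordLeq[symmetric] by auto
  also have "\<dots> \<longleftrightarrow> |X| \<le>o natLeq" using card_of_nat ordLeq_ordIso_trans ordIso_symmetric by blast
  finally show ?thesis .
qed

locale fur =
  fixes \<kappa> \<delta> :: "'k rel" and \<K> :: "('f, 'r, 'a) aclass" and M :: "('f, 'r, 'a) struct"
  assumes kappa: "Card_order \<kappa>" "regularCard \<kappa>" "natLeq <o \<kappa>"
    and delta: "Card_order \<delta>" "natLeq <o \<delta>" "\<delta> <o \<kappa>"
    and fur: "fur_class \<kappa> \<delta> \<K> M"
begin

abbreviation "L \<equiv> voc \<K>"

lemma aec: "aec \<kappa> \<K>" and mon: "monster \<delta> \<K> M" and amalg: "amalgamation \<K>"
  and joint: "joint_embedding \<K>" and LSb: "LS_bound \<K> natLeq" and arb: "arbitrarily_large \<kappa> \<K>"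
  and mods_infinite: "A \<in> mods \<K> \<Longrightarrow> infinite (car A)"
  and AI: "AI \<delta> \<K> M" and AII: "AII \<delta> \<K> M" and AIII: "AIII \<delta> \<K> M" and AIV: "AIV \<delta> \<K> M"
  and AV: "AV \<delta> \<K> M" and AVI: "AVI \<delta> \<K> M" using fur unfolding fur_class_def by auto

lemma mods_struct: "A \<in> mods \<K> \<Longrightarrow> is_struct L A" and mods_card: "A \<in> mods \<K> \<Longrightarrow> |car A| <o \<kappa>"
  using aec[unfolded aec_def, THEN conjunct1] by auto

lemma strongD:
  assumes "strong \<K> A B"
  shows "A \<in> mods \<K>" "B \<in> mods \<K>" "substructure L A B" "car A \<subseteq> car B" "is_struct L A" "is_struct L B"
proof -
  show "A \<in> mods \<K>" "B \<in> mods \<K>" "substructure L A B"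
    using aec[unfolded aec_def, THEN conjunct2, THEN conjunct1] assms by blast+
  then show "car A \<subseteq> car B" "is_struct L A" "is_struct L B" using substructureD by blast+
qed

lemma strong_refl: "A \<in> mods \<K> \<Longrightarrow> strong \<K> A A"
  using aec[unfolded aec_def, THEN conjunct2, THEN conjunct2, THEN conjunct1] by blast

lemma strong_trans: "strong \<K> A B \<Longrightarrow> strong \<K> B C \<Longrightarrow> strong \<K> A C"
  using aec[unfolded aec_def, THEN conjunct2, THEN conjunct2, THEN conjunct2, THEN conjunct1] by blast

lemma strong_subset: "strong \<K> A C \<Longrightarrow> strong \<K> B C \<Longrightarrow> car A \<subseteq> car B \<Longrightarrow> strong \<K> A B"
  using aec[unfolded aec_def, THEN conjunct2, THEN conjunct2, THEN conjunct2, THEN conjunct2, THEN conjunct2, THEN conjunct2, THEN conjunct1] by blast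

lemma strong_eq: "strong \<K> A C \<Longrightarrow> strong \<K> B C \<Longrightarrow> car A = car B \<Longrightarrow> A = B"
  using substructure_eq strongD(3) by blast

lemma strong_restr: "strong \<K> A B \<Longrightarrow> restr B (car A) = A"
  using substructure_restr strongD(3) by metis

lemma mods_copy: "A \<in> mods \<K> \<Longrightarrow> inj_on h (car A) \<Longrightarrow> copy h A \<in> mods \<K>"
  using aec[unfolded aec_def, THEN conjunct2, THEN conjunct2, THEN conjunct2, THEN conjunct2, THEN conjunct1] iso_copy[OF mods_struct, of A h] by blast

lemma copy_strong:
  assumes "strong \<K> A B" "inj_on h (car B)"
  shows "strong \<K> (copy h A) (copy h B)"
proof -
  have "inj_on h (car A)" using strongD(4)[OF assms(1)] assms(2) inj_on_subset by blast
  then have "iso L h A (copy h A)" "iso L h B (copy h B)" using strongD[OF assms(1)] assms(2) iso_copy by auto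
  then show ?thesis using aec[unfolded aec_def, THEN conjunct2, THEN conjunct2, THEN conjunct2, THEN conjunct2, THEN conjunct2, THEN conjunct1] assms(1) by blast
qed

lemma chain_union:
  assumes "\<C> \<noteq> {}" "\<C> \<subseteq> mods \<K>" "|\<C>| <o \<kappa>"
    "\<And>\<S>. \<S> \<subseteq> \<C> \<Longrightarrow> \<S> \<noteq> {} \<Longrightarrow> \<exists>A\<in>\<S>. \<forall>B\<in>\<S>. strong \<K> A B"
  shows "union_struct \<C> \<in> mods \<K>" "\<And>A. A \<in> \<C> \<Longrightarrow> strong \<K> A (union_struct \<C>)"
    "\<And>N. (\<And>A. A \<in> \<C> \<Longrightarrow> strong \<K> A N) \<Longrightarrow> strong \<K> (union_struct \<C>) N"
proof -
  have *: "\<forall>\<C>. \<C> \<noteq> {} \<longrightarrow> \<C> \<subseteq> mods \<K> \<longrightarrow> |\<C>| <o \<kappa> \<longrightarrow>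
        (\<forall>\<S>\<subseteq>\<C>. \<S> \<noteq> {} \<longrightarrow> (\<exists>A\<in>\<S>. \<forall>B\<in>\<S>. strong \<K> A B)) \<longrightarrow>
        union_struct \<C> \<in> mods \<K> \<and>
        (\<forall>A\<in>\<C>. strong \<K> A (union_struct \<C>)) \<and>
        (\<forall>N. (\<forall>A\<in>\<C>. strong \<K> A N) \<longrightarrow> strong \<K> (union_struct \<C>) N)"
    using aec[unfolded aec_def, THEN conjunct2, THEN conjunct2, THEN conjunct2, THEN conjunct2, THEN conjunct2, THEN conjunct2, THEN conjunct2, THEN conjunct1] .
  have **: "union_struct \<C> \<in> mods \<K> \<and>
        (\<forall>A\<in>\<C>. strong \<K> A (union_struct \<C>)) \<and>
        (\<forall>N. (\<forall>A\<in>\<C>. strong \<K> A N) \<longrightarrow> strong \<K> (union_struct \<C>) N)"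
    by (rule *[rule_format, OF assms(1,2,3)]) (use assms(4) in blast)
  then show "union_struct \<C> \<in> mods \<K>" "\<And>A. A \<in> \<C> \<Longrightarrow> strong \<K> A (union_struct \<C>)"
    "\<And>N. (\<And>A. A \<in> \<C> \<Longrightarrow> strong \<K> A N) \<Longrightarrow> strong \<K> (union_struct \<C>) N" by blast+
qed

lemma LS:
  assumes "A \<in> mods \<K>" "X \<subseteq> car A"
  obtains B where "strong \<K> B A" "X \<subseteq> car B" "|car B| \<le>o |X| +c natLeq"
  using LSb assms unfolding LS_bound_def by metis

lemma countable_submodel:
  assumes "A \<in> mods \<K>" "X \<subseteq> car A" "countable X"
  obtains B where "strong \<K> B A" "X \<subseteq> car B" "countable (car B)"
proof -
  obtain B where B: "strong \<K> B A" "X \<subseteq> car B" "|car B| \<le>o |X| +c natLeq" using LS[OF assms(1,2)] .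
  have "|X| +c natLeq \<le>o natLeq"
    using assms(3) countable_iff_ordLeq csum_absorb2[OF natLeq_Cinfinite] ordIso_iff_ordLeq by blast
  then have "countable (car B)" using B countable_iff_ordLeq ordLeq_transitive by blast
  then show thesis using B that by blast
qed

lemma countable_less_delta: "countable X \<Longrightarrow> |X| <o \<delta>"
  using countable_iff_ordLeq delta(2) ordLeq_ordLess_trans by blast

lemma embedding_iff: "embedding \<K> h A B \<longleftrightarrow> A \<in> mods \<K> \<and> inj_on h (car A) \<and> strong \<K> (copy h A) B"
  unfolding embedding_def iso_iff_copy using mods_struct by auto

lemma embedding_incl: "strong \<K> A B \<Longrightarrow> embedding \<K> (\<lambda>x. x) A B"
  unfolding embedding_iff using strongD(1,5) copy_ident[of L A "\<lambda>x. x"] by auto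

lemma embedding_comp:
  assumes "embedding \<K> h A B" "embedding \<K> g B C" shows "embedding \<K> (g \<circ> h) A C"
proof -
  have A: "A \<in> mods \<K>" "inj_on h (car A)" "strong \<K> (copy h A) B"
    and B: "inj_on g (car B)" "strong \<K> (copy g B) C" using assms unfolding embedding_iff by auto
  have "h ` car A \<subseteq> car B" using strongD(4)[OF A(3)] by simp
  then have gi: "inj_on g (h ` car A)" using B inj_on_subset by blast
  then have "copy g (copy h A) = copy (g \<circ> h) A" using copy_copy mods_struct A by blast
  then have "strong \<K> (copy (g \<circ> h) A) C" using copy_strong[OF A(3) B(1)] B(2) strong_trans by metis
  then show ?thesis using A gi comp_inj_on unfolding embedding_iff by blast
qed

lemma embedding_restrict: "embedding \<K> h B C \<Longrightarrow> strong \<K> A B \<Longrightarrow> embedding \<K> h A C"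
  using embedding_comp[OF embedding_incl] by (fastforce simp: comp_def)

lemma embedding_image: "embedding \<K> h A B \<Longrightarrow> h ` car A \<subseteq> car B"
  unfolding embedding_iff using strongD(4) by fastforce

lemma embedding_copy: "A \<in> mods \<K> \<Longrightarrow> inj_on h (car A) \<Longrightarrow> embedding \<K> h A (copy h A)"
  unfolding embedding_iff using mods_copy strong_refl by blast

lemma M_mods: "M \<in> mods \<K>" using mon by (simp add: monster_def)

lemma M_struct: "is_struct L M" using M_mods mods_struct by blast

lemma universal: "A \<in> mods \<K> \<Longrightarrow> |car A| <o \<delta> \<Longrightarrow> \<exists>h. embedding \<K> h A M"
  using mon unfolding monster_def by blast

lemma homogeneous:
  assumes "embedding \<K> h A M" "strong \<K> A M" "|car A| <o \<delta>"
  shows "\<exists>g\<in>Aut L M {}. \<forall>x\<in>car A. g x = h x"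
proof -
  have h: "inj_on h (car A)" "strong \<K> (copy h A) M" using assms(1) by (auto simp: embedding_iff)
  have "|car (copy h A)| <o \<delta>" using card_of_image assms(3) ordLeq_ordLess_trans by (simp, blast)
  moreover have "iso L h A (copy h A)" using iso_copy strongD(5)[OF assms(2)] h by blast
  ultimately show ?thesis using mon h assms(2,3) unfolding monster_def by blast
qed

text \<open>New structures have to live on the type \<open>'a\<close>. Large members of the class
  provide the space there for disjoint unions and for home sorts that consist of
  imaginaries.\<close>

lemma room:
  fixes X :: "'b set"
  assumes "|X| <o \<kappa>"
  obtains j :: "'b \<Rightarrow> 'a" where "inj_on j X"
proof -
  have "|X| \<le>o |Field \<kappa>|"
    using ordLess_imp_ordLeq[OF assms] card_of_Field_ordIso[OF kappa(1)] ordIso_symmetric ordLeq_ordIso_trans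
    by blast
  \<comment> \<open>\<open>arbitrarily_large\<close> speaks of sets of type \<open>'k set\<close>,
    so \<open>X\<close> is first moved into the field of \<open>\<kappa>\<close>.\<close>
  then obtain f where f: "inj_on f X" "f ` X \<subseteq> Field \<kappa>" unfolding card_of_ordLeq[symmetric] by blast
  have "|f ` X| <o \<kappa>" using card_of_image assms ordLeq_ordLess_trans by blast
  then obtain A where "A \<in> mods \<K>" "|f ` X| \<le>o |car A|" using arb unfolding arbitrarily_large_def by blast
  then obtain g where "inj_on g (f ` X)" "g ` (f ` X) \<subseteq> car A" unfolding card_of_ordLeq[symmetric] by blast
  from comp_inj_on[OF f(1) this(1)] show thesis by (rule that)
qed

lemma kappa_Cinfinite: "Cinfinite \<kappa>"
  using kappa natLeq_cinfinite cinfinite_mono ordLess_imp_ordLeq by blast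

lemma Plus_less_kappa: "|X| <o \<kappa> \<Longrightarrow> |Y| <o \<kappa> \<Longrightarrow> |X <+> Y| <o \<kappa>"
  using card_of_Plus_ordLess_infinite_Field[of \<kappa> X Y] kappa_Cinfinite by (auto simp: cinfinite_def)

lemma UN_less_kappa: "|I| <o \<kappa> \<Longrightarrow> (\<And>i. i \<in> I \<Longrightarrow> |X i| <o \<kappa>) \<Longrightarrow> |\<Union>i\<in>I. X i| <o \<kappa>"
  using card_of_UNION_ordLess_infinite_Field_regularCard[of \<kappa> I X] kappa_Cinfinite kappa by blast

lemma image_less_kappa: "|Y| <o \<kappa> \<Longrightarrow> |f ` Y| <o \<kappa>" using card_of_image ordLeq_ordLess_trans by blast

text \<open>Copies of the two structures that agree on the images of the common one are found
  inside the disjoint union of their carriers.\<close>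

lemma amalgamation_embeddings:
  assumes "embedding \<K> h A B" "embedding \<K> f A C"
  obtains D p q where "embedding \<K> p B D" "embedding \<K> q C D" "\<forall>x\<in>car A. p (h x) = q (f x)"
proof -
  have A: "A \<in> mods \<K>" and h: "inj_on h (car A)" "strong \<K> (copy h A) B"
    and f: "inj_on f (car A)" "strong \<K> (copy f A) C" using assms by (auto simp: embedding_iff)
  have B: "B \<in> mods \<K>" "h ` car A \<subseteq> car B" and C: "C \<in> mods \<K>" "f ` car A \<subseteq> car C"
    using strongD(2,4)[OF h(2)] strongD(2,4)[OF f(2)] by auto
  have "|car B <+> car C| <o \<kappa>" using Plus_less_kappa mods_card B(1) C(1) by metis
  from room[OF this] obtain i :: "'a + 'a \<Rightarrow> 'a" where i: "inj_on i (car B <+> car C)" .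
  \<comment> \<open>\<open>u\<close> glues \<open>B\<close> to \<open>C\<close> along
    \<open>A\<close>: a point h(x) is sent to f(x) in the right summand, every other point of
    \<open>B\<close> stays in the left one.\<close>
  define u where "u x = (if x \<in> h ` car A then Inr (f (inv_into (car A) h x)) else Inl x :: 'a + 'a)" for x
  have "f (inv_into (car A) h x) \<in> car C" if "x \<in> h ` car A" for x
    using C(2) inv_into_into[OF that] by blast
  then have u_in: "u ` car B \<subseteq> car B <+> car C"
    unfolding u_def image_subset_iff by (auto simp: Plus_def)
  have u: "inj_on u (car B)"
  proof (rule inj_onI)
    fix x y assume "x \<in> car B" "y \<in> car B" "u x = u y"
    moreover have "f (inv_into (car A) h x) = f (inv_into (car A) h y) \<Longrightarrow> x = y"
      if "x \<in> h ` car A" "y \<in> h ` car A"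
    proof -
      assume "f (inv_into (car A) h x) = f (inv_into (car A) h y)"
      then have "inv_into (car A) h x = inv_into (car A) h y"
        using inj_onD[OF f(1)] inv_into_into[OF that(1)] inv_into_into[OF that(2)] by blast
      then show "x = y" using f_inv_into_f[OF that(1)] f_inv_into_f[OF that(2)] by metis
    qed
    ultimately show "x = y" by (auto simp: u_def split: if_splits)
  qed
  define jB where "jB = i \<circ> u"
  define jC where "jC = i \<circ> Inr"
  have jB: "inj_on jB (car B)" unfolding jB_def by (rule comp_inj_on[OF u inj_on_subset[OF i u_in]])
  have "inj_on i (Inr ` car C)" using i by (rule inj_on_subset) auto
  then have jC: "inj_on jC (car C)" unfolding jC_def by (simp add: comp_inj_on)
  have eq: "jB (h x) = jC (f x)" if "x \<in> car A" for x
    using that h(1) by (simp add: jB_def jC_def u_def)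
  have jBh: "inj_on jB (h ` car A)" "inj_on jC (f ` car A)"
    by (rule inj_on_subset[OF jB B(2)], rule inj_on_subset[OF jC C(2)])
  have "copy jB (copy h A) = copy (jB \<circ> h) A" using copy_copy[OF mods_struct[OF A] h(1) jBh(1)] .
  also have "\<dots> = copy (jC \<circ> f) A" using eq by (intro copy_cong[OF mods_struct[OF A]]) auto
  also have "\<dots> = copy jC (copy f A)" using copy_copy[OF mods_struct[OF A] f(1) jBh(2)] by simp
  finally have e: "copy jB (copy h A) = copy jC (copy f A)" .
  have "strong \<K> (copy jB (copy h A)) (copy jB B)" "strong \<K> (copy jB (copy h A)) (copy jC C)"
    using copy_strong[OF h(2) jB] copy_strong[OF f(2) jC] e by auto
  then obtain D p q where D: "embedding \<K> p (copy jB B) D" "embedding \<K> q (copy jC C) D"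
      "\<forall>x\<in>car (copy jB (copy h A)). p x = q x" using amalg unfolding amalgamation_def by blast
  show thesis
  proof (rule that[of "p \<circ> jB" D "q \<circ> jC"])
    show "embedding \<K> (p \<circ> jB) B D" "embedding \<K> (q \<circ> jC) C D"
      by (rule embedding_comp[OF embedding_copy[OF B(1) jB] D(1)],
          rule embedding_comp[OF embedding_copy[OF C(1) jC] D(2)])
    show "\<forall>x\<in>car A. (p \<circ> jB) (h x) = (q \<circ> jC) (f x)"
    proof
      fix x assume x: "x \<in> car A"
      then show "(p \<circ> jB) (h x) = (q \<circ> jC) (f x)"
        using D(3)[rule_format, of "jB (h x)"] eq[OF x, symmetric] by simp
    qed
  qed
qed

lemma strong_copy_iff:
  "strong_copy \<K> X Y \<longleftrightarrow> (\<exists>A B h. strong \<K> A B \<and> inj_on h (car B) \<and> X = copy h A \<and> Y = copy h B)"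
proof
  assume "strong_copy \<K> X Y"
  then show "\<exists>A B h. strong \<K> A B \<and> inj_on h (car B) \<and> X = copy h A \<and> Y = copy h B"
    unfolding strong_copy_def iso_iff_copy by blast
next
  assume "\<exists>A B h. strong \<K> A B \<and> inj_on h (car B) \<and> X = copy h A \<and> Y = copy h B"
  then obtain A B h where h: "strong \<K> A B" "inj_on h (car B)" "X = copy h A" "Y = copy h B" by blast
  have "inj_on h (car A)" by (rule inj_on_subset[OF h(2) strongD(4)[OF h(1)]])
  then show "strong_copy \<K> X Y"
    unfolding strong_copy_def iso_iff_copy using h strongD(5,6)[OF h(1)] by blast
qed

text \<open>The condition on home sorts in the definition of \<open>eq_class\<close> lives on the
  type of imaginaries; this brings it back into \<open>\<K>\<close>, where the axioms apply.\<close>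

lemma strong_copy_transfer:
  fixes j :: "'b \<Rightarrow> 'a"
  assumes "strong_copy \<K> X Y" "inj_on j (car Y)"
  shows "strong \<K> (copy j X) (copy j Y)"
proof -
  obtain A B h where h: "strong \<K> A B" "inj_on h (car B)" "X = copy h A" "Y = copy h B"
    using assms(1) unfolding strong_copy_iff by blast
  have hA: "inj_on h (car A)" by (rule inj_on_subset[OF h(2) strongD(4)[OF h(1)]])
  have jB: "inj_on j (h ` car B)" using assms(2) h(4) by simp
  have jA: "inj_on j (h ` car A)" by (rule inj_on_subset[OF jB image_mono[OF strongD(4)[OF h(1)]]])
  have "copy j X = copy (j \<circ> h) A" "copy j Y = copy (j \<circ> h) B"
    unfolding h(3,4) by (rule copy_copy[OF strongD(5)[OF h(1)] hA jA],
      rule copy_copy[OF strongD(6)[OF h(1)] h(2) jB])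
  moreover have "inj_on (j \<circ> h) (car B)" using h(2) jB comp_inj_on by blast
  ultimately show ?thesis using copy_strong[OF h(1), of "j \<circ> h"] by simp
qed

end

section \<open>Automorphisms and types\<close>

lemma Aut_iff: "is_struct L M \<Longrightarrow> k \<in> Aut L M B \<longleftrightarrow> inj_on k (car M) \<and> copy k M = M \<and> (\<forall>x\<in>B. k x = x)"
  unfolding Aut_def iso_iff_copy by auto

lemma Aut_image: "k \<in> Aut L M B \<Longrightarrow> k ` car M = car M" unfolding Aut_def iso_def bij_betw_def by auto

lemma Aut_inj: "k \<in> Aut L M B \<Longrightarrow> inj_on k (car M)" unfolding Aut_def iso_def bij_betw_def by auto

lemma Aut_fix: "k \<in> Aut L M B \<Longrightarrow> x \<in> B \<Longrightarrow> k x = x" unfolding Aut_def by auto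

lemma Aut_mono: "k \<in> Aut L M B \<Longrightarrow> B' \<subseteq> B \<Longrightarrow> k \<in> Aut L M B'" unfolding Aut_def by auto

lemma Aut_map_closed: "k \<in> Aut L M B \<Longrightarrow> set a \<subseteq> car M \<Longrightarrow> set (map k a) \<subseteq> car M"
  using Aut_image by fastforce

lemma Aut_map_fix: "k \<in> Aut L M B \<Longrightarrow> set a \<subseteq> B \<Longrightarrow> map k a = a"
  using Aut_fix by (fastforce intro: map_idI)

lemma Aut_id: "is_struct L M \<Longrightarrow> (\<lambda>x. x) \<in> Aut L M B" unfolding Aut_iff by (simp add: copy_ident)

lemma Aut_comp:
  assumes M: "is_struct L M" and k: "k \<in> Aut L M B" and g: "g \<in> Aut L M B"
  shows "g \<circ> k \<in> Aut L M B"
proof -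
  have "inj_on g (k ` car M)" using Aut_inj[OF g] Aut_image[OF k] by simp
  then have "copy g (copy k M) = copy (g \<circ> k) M" "inj_on (g \<circ> k) (car M)"
    using copy_copy[OF M Aut_inj[OF k]] comp_inj_on[OF Aut_inj[OF k]] by auto
  then show ?thesis using k g unfolding Aut_iff[OF M] by simp
qed

lemma Aut_inv:
  assumes M: "is_struct L M" and k: "k \<in> Aut L M B" and B: "B \<subseteq> car M"
  shows "inv_into (car M) k \<in> Aut L M B"
proof -
  have i: "inj_on k (car M)" "copy k M = M" "\<forall>x\<in>B. k x = x" using k Aut_iff[OF M] by blast+
  have "inj_on (inv_into (car M) k) (car M)" using inj_on_inv_into[of "car M" k "car M"] Aut_image[OF k] by simp
  moreover have "copy (inv_into (car M) k) M = M" using copy_inv_into[OF M i(1)] i(2) by simp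
  moreover have "inv_into (car M) k x = x" if "x \<in> B" for x
    using inv_into_f_f[OF i(1)] that B i(3) by (metis subsetD)
  ultimately show ?thesis unfolding Aut_iff[OF M] by blast
qed

lemma Aut_map_inv:
  assumes "k \<in> Aut L M B" "set a \<subseteq> car M"
  shows "map (inv_into (car M) k) (map k a) = a"
  by (rule map_inv_into_map[OF Aut_inj[OF assms(1)] assms(2)])

lemma in_gtype_iff: "b \<in> gtype L M B a \<longleftrightarrow> (\<exists>k\<in>Aut L M B. map k a = b)" by (auto simp: gtype_def)

lemma gtype_eq_iff:
  assumes M: "is_struct L M" and a: "set a \<subseteq> car M" and B: "B \<subseteq> car M"
  shows "gtype L M B a = gtype L M B b \<longleftrightarrow> (\<exists>k\<in>Aut L M B. map k a = b)"
proof
  assume "gtype L M B a = gtype L M B b"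
  moreover have "b \<in> gtype L M B b" unfolding in_gtype_iff by (rule bexI[OF _ Aut_id[OF M]]) simp
  ultimately show "\<exists>k\<in>Aut L M B. map k a = b" using in_gtype_iff by metis
next
  assume "\<exists>k\<in>Aut L M B. map k a = b"
  then obtain k where k: "k \<in> Aut L M B" "b = map k a" by blast
  have "map h a \<in> gtype L M B b" if h: "h \<in> Aut L M B" for h
  proof -
    have "map h a = map (h \<circ> inv_into (car M) k) b"
      using Aut_map_inv[OF k(1) a] k(2) by (simp flip: map_map)
    moreover have "h \<circ> inv_into (car M) k \<in> Aut L M B" using Aut_comp[OF M Aut_inv[OF M k(1) B] h] .
    ultimately show ?thesis unfolding in_gtype_iff by metis
  qed
  moreover have "map h b \<in> gtype L M B a" if h: "h \<in> Aut L M B" for h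
  proof -
    have "map h b = map (h \<circ> k) a" using k(2) by simp
    then show ?thesis unfolding in_gtype_iff using Aut_comp[OF M k(1) h] by metis
  qed
  ultimately show "gtype L M B a = gtype L M B b" unfolding gtype_def[of _ _ _ a] gtype_def[of _ _ _ b]
    by (auto simp: gtype_def)
qed

lemma same_type_iff:
  assumes "is_struct L M" "set a \<subseteq> car M" "A \<subseteq> car M"
  shows "same_type L M A a b \<longleftrightarrow> (\<forall>B\<subseteq>A. finite B \<longrightarrow> (\<exists>k\<in>Aut L M B. map k a = b))"
  unfolding same_type_def using gtype_eq_iff[OF assms(1,2)] assms(3) by (meson order_trans)

lemma same_type_finite:
  assumes "is_struct L M" "set a \<subseteq> car M" "A \<subseteq> car M" "finite A"
  shows "same_type L M A a b \<longleftrightarrow> (\<exists>k\<in>Aut L M A. map k a = b)"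
  unfolding same_type_iff[OF assms(1-3)] using assms(4) Aut_mono by (meson order_refl)

lemma same_type_refl: "same_type L M A a a" by (simp add: same_type_def)

lemma same_type_sym: "same_type L M A a b \<Longrightarrow> same_type L M A b a" by (simp add: same_type_def)

lemma same_type_trans: "same_type L M A a b \<Longrightarrow> same_type L M A b c \<Longrightarrow> same_type L M A a c"
  by (simp add: same_type_def)

lemma same_type_mono: "same_type L M A a b \<Longrightarrow> B \<subseteq> A \<Longrightarrow> same_type L M B a b"
  by (auto simp: same_type_def)

lemma same_typeI:
  assumes "is_struct L M" "set a \<subseteq> car M" "A \<subseteq> car M"
    "\<And>B. B \<subseteq> A \<Longrightarrow> finite B \<Longrightarrow> \<exists>k\<in>Aut L M B. map k a = b"
  shows "same_type L M A a b"
  using same_type_iff[OF assms(1-3)] assms(4) by blast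

lemma same_typeE:
  assumes "same_type L M A a b" "is_struct L M" "set a \<subseteq> car M" "A \<subseteq> car M" "B \<subseteq> A" "finite B"
  obtains k where "k \<in> Aut L M B" "map k a = b"
  using same_type_iff[OF assms(2-4)] assms(1,5,6) by blast

lemma not_splits_subset: "\<not> splits L M a X A \<Longrightarrow> Y \<subseteq> X \<Longrightarrow> \<not> splits L M a Y A"
  unfolding splits_def by blast

lemma indep_subset:
  assumes "indep L M a B C" "C' \<subseteq> C"
  shows "indep L M a B C'"
proof -
  obtain A where A: "A \<subseteq> B" "finite A" "\<not> splits L M a (B \<union> C) A" using assms(1) unfolding indep_def by blast
  have "\<not> splits L M a (B \<union> C') A" by (rule not_splits_subset[OF A(3)]) (use assms(2) in blast)
  then show ?thesis unfolding indep_def using A(1,2) by blast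
qed

lemma map_id_fix: "map l p = p \<Longrightarrow> x \<in> set p \<Longrightarrow> l x = x" by (induction p) auto

text \<open>An enumeration \<open>g\<close> of the larger base is appended to both tuples. They
  still have the same type over \<open>F\<close>, and the automorphism that nonsplitting provides
  for the longer tuples fixes \<open>g\<close>, hence \<open>G\<close>.\<close>

lemma not_splits_base:
  assumes M: "is_struct L M" and X: "X \<subseteq> car M" and a: "set a \<subseteq> car M"
    and ns: "\<not> splits L M a X F" and F: "F \<subseteq> G" and G: "G \<subseteq> X" "finite G"
  shows "\<not> splits L M a X G"
proof
  assume "splits L M a X G"
  then obtain b c where b: "set b \<subseteq> X" and c: "set c \<subseteq> X" and bc: "same_type L M G b c"
    and n: "\<not> same_type L M G (a @ b) (a @ c)" unfolding splits_def by blast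
  have GM: "G \<subseteq> car M" and FM: "F \<subseteq> car M" and Ff: "finite F" and bM: "set b \<subseteq> car M"
    using X F G b finite_subset by auto
  obtain g where g: "set g = G" using finite_list[OF G(2)] by blast
  obtain k where k: "k \<in> Aut L M G" "map k b = c" using same_typeE[OF bc M bM GM order_refl G(2)] .
  have len: "length b = length c" using k(2) by auto
  have bg: "set (b @ g) \<subseteq> X" "set (c @ g) \<subseteq> X" using b c g G(1) by auto
  have "map k (b @ g) = c @ g" using k Aut_map_fix[OF k(1), of g] g by simp
  moreover have "set (b @ g) \<subseteq> car M" using bg(1) X by blast
  ultimately have "same_type L M F (b @ g) (c @ g)"
    using same_type_finite[OF M _ FM Ff] Aut_mono[OF k(1) F] by blast
  then have st: "same_type L M F (a @ b @ g) (a @ c @ g)" using ns bg unfolding splits_def by blast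
  have abg: "set (a @ b @ g) \<subseteq> car M" using a bM g GM by simp
  obtain l where l: "l \<in> Aut L M F" "map l (a @ b @ g) = a @ c @ g"
    using same_typeE[OF st M abg FM order_refl Ff] .
  have lg: "map l g = g" and lab: "map l (a @ b) = a @ c" using l(2) len by auto
  have "\<forall>x\<in>G. l x = x" using map_id_fix[OF lg] g by blast
  then have "l \<in> Aut L M G" using l(1) unfolding Aut_def by blast
  then show False using n same_type_finite[OF M _ GM G(2), of "a @ b"] lab a bM by auto
qed

section \<open>The relations that an invariant equivalence relation defines on the members of the class\<close>

context fur
begin

text \<open>Homogeneity concerns small submodels, while the given embeddings \<open>f\<close> and
  \<open>g\<close> start from all of \<open>M\<close>. They are cut down to countable models around
  \<open>a\<close> and \<open>b\<close>, and a countable model \<open>D\<close> that contains both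
  images is embedded into \<open>M\<close>.\<close>

lemma same_gtype_monster:
  assumes "same_gtype \<K> M a M b" "set a \<subseteq> car M" "set b \<subseteq> car M"
  shows "\<exists>k\<in>Aut L M {}. map k a = b"
proof -
  obtain C f g where C: "C \<in> mods \<K>" and f: "embedding \<K> f M C" and g: "embedding \<K> g M C"
    and eq: "map f a = map g b" using assms(1) unfolding same_gtype_def by blast
  obtain A where A: "strong \<K> A M" "set a \<subseteq> car A" "countable (car A)"
    using countable_submodel[OF M_mods assms(2) countable_finite] by blast
  obtain B where B: "strong \<K> B M" "set b \<subseteq> car B" "countable (car B)"
    using countable_submodel[OF M_mods assms(3) countable_finite] by blast
  have fA: "embedding \<K> f A C" and gB: "embedding \<K> g B C"
    by (rule embedding_restrict[OF f A(1)], rule embedding_restrict[OF g B(1)])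
  have im: "f ` car A \<union> g ` car B \<subseteq> car C" "countable (f ` car A \<union> g ` car B)"
    using embedding_image[OF fA] embedding_image[OF gB] A(3) B(3) by auto
  from countable_submodel[OF C im]
  obtain D where D: "strong \<K> D C" "f ` car A \<union> g ` car B \<subseteq> car D" "countable (car D)" .
  have fA: "embedding \<K> f A D" and gB: "embedding \<K> g B D"
    using fA gB D(2) strong_subset[OF _ D(1)] unfolding embedding_iff by auto
  obtain h where h: "embedding \<K> h D M"
    using universal[OF strongD(1)[OF D(1)] countable_less_delta[OF D(3)]] by blast
  obtain k where k: "k \<in> Aut L M {}" "\<forall>x\<in>car A. k x = (h \<circ> f) x"
    using homogeneous[OF embedding_comp[OF fA h] A(1) countable_less_delta[OF A(3)]] by blast
  obtain l where l: "l \<in> Aut L M {}" "\<forall>x\<in>car B. l x = (h \<circ> g) x"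
    using homogeneous[OF embedding_comp[OF gB h] B(1) countable_less_delta[OF B(3)]] by blast
  have "map k a = map h (map f a)" using k(2) A(2) by auto
  also have "\<dots> = map l b" using eq l(2) B(2) by auto
  finally have "map (inv_into (car M) l \<circ> k) a = b"
    using Aut_map_inv[OF l(1) assms(3)] by (simp flip: map_map)
  then show ?thesis using Aut_comp[OF M_struct k(1) Aut_inv[OF M_struct l(1)]] by blast
qed

text \<open>A witness for a tuple of \<open>B\<close> becomes one for \<open>A\<close> by
  composition with \<open>h\<close>. Conversely a witness over \<open>A\<close> has to be
  amalgamated with \<open>B\<close>; this is why the relations are not only preserved but also
  reflected.\<close>

lemma eq_on_embedding:
  assumes h: "embedding \<K> h A B" and a: "set a \<subseteq> car A" and b: "set b \<subseteq> car A"
  shows "(map h a, map h b) \<in> eq_on \<K> M E B \<longleftrightarrow> (a, b) \<in> eq_on \<K> M E A"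
proof -
  have t: "map h c \<in> tuples n (car B) \<longleftrightarrow> c \<in> tuples n (car A)" if "set c \<subseteq> car A" for c n
    using embedding_image[OF h] that by (auto simp: tuples_def)
  have "same_gtype \<K> B (map h c) M d \<longleftrightarrow> same_gtype \<K> A c M d" if c: "set c \<subseteq> car A" for c d
  proof
    assume "same_gtype \<K> B (map h c) M d"
    then obtain C f g where C: "C \<in> mods \<K>" "embedding \<K> f B C" "embedding \<K> g M C"
      "map f (map h c) = map g d" unfolding same_gtype_def by blast
    then have "map (f \<circ> h) c = map g d" by simp
    then show "same_gtype \<K> A c M d" unfolding same_gtype_def using C(1,3) embedding_comp[OF h C(2)] by blast
  next
    assume "same_gtype \<K> A c M d"
    then obtain C f g where C: "C \<in> mods \<K>" "embedding \<K> f A C" "embedding \<K> g M C"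
      "map f c = map g d" unfolding same_gtype_def by blast
    from amalgamation_embeddings[OF h C(2)]
    obtain D p q where D: "embedding \<K> p B D" "embedding \<K> q C D"
      "\<forall>x\<in>car A. p (h x) = q (f x)" .
    have "map p (map h c) = map q (map f c)" using D(3) c by auto
    also have "\<dots> = map (q \<circ> g) d" using C(4) by simp
    finally have "map p (map h c) = map (q \<circ> g) d" .
    moreover have "D \<in> mods \<K>" using D(1) strongD(2) unfolding embedding_iff by blast
    ultimately show "same_gtype \<K> B (map h c) M d" unfolding same_gtype_def
      using D(1) embedding_comp[OF C(3) D(2)] by blast
  qed
  from this[of "a @ b"] show ?thesis unfolding eq_on_def using t a b by simp
qed

text \<open>A member of the class may be too large to embed into \<open>M\<close>. Statements about
  finitely many of its elements can still be checked in \<open>M\<close>, through a countable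
  submodel.\<close>

lemma local_embedding:
  assumes "A \<in> mods \<K>" "finite X" "X \<subseteq> car A"
  obtains B h where "strong \<K> B A" "X \<subseteq> car B" "embedding \<K> h B M"
  using countable_submodel[OF assms(1,3) countable_finite[OF assms(2)]]
    universal[OF strongD(1) countable_less_delta] by metis

end

locale fur_eq = fur \<kappa> \<delta> \<K> M
  for \<kappa> \<delta> :: "'k rel" and \<K> :: "('f, 'r, 'a) aclass" and M :: "('f, 'r, 'a) struct" +
  fixes \<E> :: "'a list rel set"
  assumes eq_coll: "eq_collection \<K> M \<E>"
begin

abbreviation "ar \<equiv> eq_arity M"

abbreviation "\<iota> \<equiv> id_rel M"

lemma countable_E: "countable \<E>" and id_in_E: "\<iota> \<in> \<E>"
  using eq_coll by (auto simp: eq_collection_def)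

lemma tuples_nonempty: "\<exists>a. a \<in> tuples n (car M)"
proof -
  obtain x where "x \<in> car M" using mods_infinite[OF M_mods] by (metis finite.emptyI equals0I)
  then have "replicate n x \<in> tuples n (car M)" by (auto simp: tuples_def)
  then show ?thesis ..
qed

text \<open>Reflexivity puts some tuple of each candidate length into the field of \<open>E\<close>.
  It exists because \<open>M\<close> is nonempty, and tuples have only one length.\<close>

lemma arity_unique:
  assumes "equiv (tuples n (car M)) E"
  shows "ar E = n"
  unfolding eq_arity_def
proof (rule the_equality)
  show "equiv (tuples n (car M)) E" by fact
  fix m assume "equiv (tuples m (car M)) E"
  moreover obtain a where a: "a \<in> tuples m (car M)" using tuples_nonempty by blast
  ultimately have "(a, a) \<in> E" by (auto simp: equiv_def refl_on_def)
  then have "a \<in> tuples n (car M)" using assms by (auto simp: equiv_def refl_on_def)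
  then show "m = n" using a by (auto simp: tuples_def)
qed

lemma equiv_E: "E \<in> \<E> \<Longrightarrow> equiv (tuples (ar E) (car M)) E"
  using eq_coll arity_unique unfolding eq_collection_def by metis

lemma arity_id: "ar \<iota> = 1"
proof (rule arity_unique)
  have "tuples 1 (car M) = {[x] | x. x \<in> car M}" by (auto simp: tuples_def length_Suc_conv)
  then show "equiv (tuples 1 (car M)) \<iota>"
    by (auto simp: id_rel_def equiv_def refl_on_def sym_def trans_def)
qed

lemma E_Aut:
  assumes E: "E \<in> \<E>" and k: "k \<in> Aut L M {}"
    and a: "a \<in> tuples (ar E) (car M)" and b: "b \<in> tuples (ar E) (car M)"
  shows "(map k a, map k b) \<in> E \<longleftrightarrow> (a, b) \<in> E"
proof -
  obtain n G where n: "equiv (tuples n (car M)) E"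
    and G: "\<forall>a\<in>tuples n (car M). \<forall>b\<in>tuples n (car M). (a, b) \<in> E \<longleftrightarrow> gtype L M {} (a @ b) \<in> G"
    using eq_coll E unfolding eq_collection_def by blast
  have n: "n = ar E" using arity_unique[OF n] by simp
  have k': "map k a \<in> tuples n (car M)" "map k b \<in> tuples n (car M)"
    using map_in_tuples[OF a, of k "car M"] map_in_tuples[OF b, of k "car M"] Aut_image[OF k] n
    by simp_all
  have "gtype L M {} (a @ b) = gtype L M {} (map k a @ map k b)"
    by (subst gtype_eq_iff[OF M_struct]) (use k a b in \<open>auto simp: tuples_def\<close>)
  then show ?thesis using G k' a b n by auto
qed

lemma eq_on_monster:
  assumes E: "E \<in> \<E>"
  shows "eq_on \<K> M E M = E"
proof (intro set_eqI iffI; clarify)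
  fix a b assume "(a, b) \<in> eq_on \<K> M E M"
  then obtain a' b' where ab: "a \<in> tuples (ar E) (car M)" "b \<in> tuples (ar E) (car M)"
    and "(a', b') \<in> E" "same_gtype \<K> M (a @ b) M (a' @ b')" unfolding eq_on_def by auto
  moreover from this have ab': "a' \<in> tuples (ar E) (car M)" "b' \<in> tuples (ar E) (car M)"
    using equiv_E[OF E] by (auto simp: equiv_def refl_on_def)
  ultimately obtain k where k: "k \<in> Aut L M {}" "map k (a @ b) = a' @ b'"
    using same_gtype_monster[of "a @ b" "a' @ b'"] by (auto simp: tuples_def)
  then have "map k a = a'" "map k b = b'" using ab ab' by (auto simp: tuples_def)
  then show "(a, b) \<in> E" using E_Aut[OF E k(1) ab] \<open>(a', b') \<in> E\<close> by simp
next
  fix a b assume ab: "(a, b) \<in> E"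
  then have "a \<in> tuples (ar E) (car M)" "b \<in> tuples (ar E) (car M)"
    using equiv_E[OF E] by (auto simp: equiv_def refl_on_def)
  moreover have "same_gtype \<K> M (a @ b) M (a @ b)" unfolding same_gtype_def
    using M_mods embedding_incl[OF strong_refl[OF M_mods]] by blast
  ultimately show "(a, b) \<in> eq_on \<K> M E M" unfolding eq_on_def using ab by auto
qed

lemma eq_on_local:
  assumes "E \<in> \<E>" "strong \<K> B A" "embedding \<K> h B M" "set a \<subseteq> car B" "set b \<subseteq> car B"
  shows "(a, b) \<in> eq_on \<K> M E A \<longleftrightarrow> (map h a, map h b) \<in> E"
  using eq_on_embedding[OF assms(3-5), of E] eq_on_embedding[OF embedding_incl[OF assms(2)] assms(4,5), of E]
  by (simp add: eq_on_monster[OF assms(1)])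

lemma eq_on_tuples: "(a, b) \<in> eq_on \<K> M E A \<Longrightarrow> a \<in> tuples (ar E) (car A) \<and> b \<in> tuples (ar E) (car A)"
  by (auto simp: eq_on_def)

text \<open>Each of the laws involves at most three tuples. They lie in a countable submodel that
  embeds into \<open>M\<close>, and there the relation is \<open>E\<close> itself.\<close>

lemma equiv_eq_on:
  assumes E: "E \<in> \<E>" and A: "A \<in> mods \<K>"
  shows "equiv (tuples (ar E) (car A)) (eq_on \<K> M E A)"
proof -
  let ?T = "tuples (ar E) (car A)"
  have *: "(a, a) \<in> eq_on \<K> M E A" "(a, b) \<in> eq_on \<K> M E A \<longrightarrow> (b, a) \<in> eq_on \<K> M E A"
    "(a, b) \<in> eq_on \<K> M E A \<longrightarrow> (b, c) \<in> eq_on \<K> M E A \<longrightarrow> (a, c) \<in> eq_on \<K> M E A"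
    if t: "a \<in> ?T" "b \<in> ?T" "c \<in> ?T" for a b c
  proof -
    have "set a \<union> set b \<union> set c \<subseteq> car A" using t by (auto simp: tuples_def)
    then obtain B h where B: "strong \<K> B A" "set a \<union> set b \<union> set c \<subseteq> car B" "embedding \<K> h B M"
      using local_embedding[OF A, of "set a \<union> set b \<union> set c"] by blast
    have "set a \<subseteq> car B" "set b \<subseteq> car B" "set c \<subseteq> car B" using B(2) by auto
    moreover from this have "map h a \<in> tuples (ar E) (car M)"
      using t(1) map_in_tuples[OF _ embedding_image[OF B(3)], of a "ar E"] by (simp add: tuples_def)
    ultimately show "(a, a) \<in> eq_on \<K> M E A" "(a, b) \<in> eq_on \<K> M E A \<longrightarrow> (b, a) \<in> eq_on \<K> M E A"
      "(a, b) \<in> eq_on \<K> M E A \<longrightarrow> (b, c) \<in> eq_on \<K> M E A \<longrightarrow> (a, c) \<in> eq_on \<K> M E A"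
      using equiv_E[OF E] unfolding equiv_def refl_on_def
      by (auto simp: eq_on_local[OF E B(1,3)] dest: symD transD)
  qed
  show ?thesis
  proof (rule equivI)
    show "eq_on \<K> M E A \<subseteq> ?T \<times> ?T" using eq_on_tuples by auto
    show "refl_on ?T (eq_on \<K> M E A)" by (rule refl_onI) (rule *(1))
    show "sym (eq_on \<K> M E A)" by (rule symI) (use *(2) eq_on_tuples in metis)
    show "trans (eq_on \<K> M E A)" by (rule transI) (use *(3) eq_on_tuples in metis)
  qed
qed

lemma eq_on_id:
  assumes "A \<in> mods \<K>" "x \<in> car A" "y \<in> car A"
  shows "([x], [y]) \<in> eq_on \<K> M \<iota> A \<longleftrightarrow> x = y"
proof -
  obtain B h where B: "strong \<K> B A" "{x, y} \<subseteq> car B" "embedding \<K> h B M"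
    using local_embedding[OF assms(1), of "{x, y}"] assms by blast
  then have "([x], [y]) \<in> eq_on \<K> M \<iota> A \<longleftrightarrow> ([h x], [h y]) \<in> \<iota>"
    using eq_on_local[OF id_in_E B(1,3), of "[x]" "[y]"] by simp
  also have "\<dots> \<longleftrightarrow> h x = h y" using embedding_image[OF B(3)] B(2) by (auto simp: id_rel_def)
  also have "\<dots> \<longleftrightarrow> x = y" using B(2,3) by (auto simp: embedding_iff inj_on_def)
  finally show ?thesis .
qed

section \<open>Structures of imaginaries\<close>

abbreviation "LE \<equiv> eq_voc \<K> M \<E>"
abbreviation "Keq \<equiv> eq_class \<K> M \<E>"

abbreviation hm :: "('a list rel \<Rightarrow> 'a list \<Rightarrow> 'b) \<Rightarrow> 'a \<Rightarrow> 'b" where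
  "hm \<Phi> \<equiv> \<lambda>x. \<Phi> \<iota> [x]"

text \<open>Same shape as \<open>eq_struct\<close>, but with an arbitrary naming
  \<open>\<Phi>\<close> in place of \<open>imag\<close>. Isomorphic copies then have this form too,
  and a submodel is obtained by shrinking \<open>A\<close> while \<open>\<Phi>\<close> stays
  fixed.\<close>

definition eqst :: "('a list rel \<Rightarrow> 'a list \<Rightarrow> 'b) \<Rightarrow> ('f, 'r, 'a) struct \<Rightarrow>
    ('f + 'a list rel, 'r + 'a list rel, 'b) struct" where
  "eqst \<Phi> A =
     \<lparr>car = {\<Phi> E a | E a. E \<in> \<E> \<and> a \<in> tuples (ar E) (car A)},
      fni = (\<lambda>g xs. if set xs \<subseteq> hm \<Phi> ` car A then
               (case g of
                  Inl g' \<Rightarrow> map_option (hm \<Phi>) (fni A g' (map (the_inv_into (car A) (hm \<Phi>)) xs))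
                | Inr E \<Rightarrow> if E \<in> \<E> \<and> length xs = ar E
                           then Some (\<Phi> E (map (the_inv_into (car A) (hm \<Phi>)) xs)) else None)
             else None),
      rli = (\<lambda>r. case r of
                  Inl r' \<Rightarrow> map (hm \<Phi>) ` rli A r'
                | Inr E \<Rightarrow> if E \<in> \<E> then {[\<Phi> E a] | a. a \<in> tuples (ar E) (car A)} else {})\<rparr>"

text \<open>\<open>\<Phi> E\<close> induces a bijection from the \<open>E\<close>-classes of \<open>A\<close> to the sort \<open>E\<close> of \<open>eqst \<Phi> A\<close>.\<close>

definition good :: "('a list rel \<Rightarrow> 'a list \<Rightarrow> 'b) \<Rightarrow> ('f, 'r, 'a) struct \<Rightarrow> bool" where
  "good \<Phi> A \<longleftrightarrow> (\<forall>E\<in>\<E>. \<forall>E'\<in>\<E>. \<forall>a\<in>tuples (ar E) (car A). \<forall>b\<in>tuples (ar E') (car A).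
     \<Phi> E a = \<Phi> E' b \<longleftrightarrow> E = E' \<and> (a, b) \<in> eq_on \<K> M E A)"

lemma goodD:
  assumes "good \<Phi> A" "E \<in> \<E>" "E' \<in> \<E>" "a \<in> tuples (ar E) (car A)" "b \<in> tuples (ar E') (car A)"
  shows "\<Phi> E a = \<Phi> E' b \<longleftrightarrow> E = E' \<and> (a, b) \<in> eq_on \<K> M E A"
  using assms unfolding good_def by blast

lemma eq_struct_eqst: "eq_struct \<K> M \<E> A = eqst (imag \<K> M A) A"
proof -
  have "home \<K> M A = hm (imag \<K> M A)" by (auto simp: home_def)
  then show ?thesis unfolding eq_struct_def Let_def eqst_def by (simp only:)
qed

lemma car_eqst: "car (eqst \<Phi> A) = {\<Phi> E a | E a. E \<in> \<E> \<and> a \<in> tuples (ar E) (car A)}"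
  by (simp add: eqst_def)

lemma car_eqst_UN: "car (eqst \<Phi> A) = (\<Union>E\<in>\<E>. \<Phi> E ` tuples (ar E) (car A))" by (auto simp: car_eqst)

lemma in_eqst: "E \<in> \<E> \<Longrightarrow> a \<in> tuples (ar E) (car A) \<Longrightarrow> \<Phi> E a \<in> car (eqst \<Phi> A)" by (auto simp: car_eqst)

lemma eqst_cases:
  assumes "x \<in> car (eqst \<Phi> A)"
  obtains E a where "E \<in> \<E>" "a \<in> tuples (ar E) (car A)" "x = \<Phi> E a"
  using assms by (auto simp: car_eqst)

lemma tuples_id: "a \<in> tuples (ar \<iota>) X \<longleftrightarrow> (\<exists>x\<in>X. a = [x])"
  by (auto simp: tuples_def arity_id length_Suc_conv)

lemma singleton_in_tuples: "x \<in> X \<Longrightarrow> [x] \<in> tuples (ar \<iota>) X" by (simp add: tuples_id)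

lemma hm_in: "x \<in> car A \<Longrightarrow> hm \<Phi> x \<in> car (eqst \<Phi> A)" by (rule in_eqst[OF id_in_E singleton_in_tuples])

lemma hm_inj:
  assumes "A \<in> mods \<K>" "good \<Phi> A"
  shows "inj_on (hm \<Phi>) (car A)"
proof (rule inj_onI)
  fix x y assume x: "x \<in> car A" and y: "y \<in> car A" and "hm \<Phi> x = hm \<Phi> y"
  then have "([x], [y]) \<in> eq_on \<K> M \<iota> A"
    using goodD[OF assms(2) id_in_E id_in_E singleton_in_tuples[OF x] singleton_in_tuples[OF y]] by blast
  then show "x = y" using eq_on_id[OF assms(1) x y] by blast
qed

lemma the_inv_hm:
  assumes "A \<in> mods \<K>" "good \<Phi> A" "set xs \<subseteq> car A"
  shows "map (the_inv_into (car A) (hm \<Phi>)) (map (hm \<Phi>) xs) = xs"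
  using assms(3) by (auto intro!: map_idI simp: the_inv_into_f_f[OF hm_inj[OF assms(1,2)]] subset_iff)

lemma fni_eqst_Inl:
  assumes "A \<in> mods \<K>" "good \<Phi> A" "set xs \<subseteq> car A"
  shows "fni (eqst \<Phi> A) (Inl g) (map (hm \<Phi>) xs) = map_option (hm \<Phi>) (fni A g xs)"
proof -
  have "set (map (hm \<Phi>) xs) \<subseteq> hm \<Phi> ` car A" using assms(3) by auto
  then show ?thesis unfolding eqst_def using the_inv_hm[OF assms] by (simp del: map_map)
qed

lemma fni_eqst_Inr:
  assumes "A \<in> mods \<K>" "good \<Phi> A" "set xs \<subseteq> car A"
  shows "fni (eqst \<Phi> A) (Inr E) (map (hm \<Phi>) xs) =
    (if E \<in> \<E> \<and> length xs = ar E then Some (\<Phi> E xs) else None)"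
proof -
  have "set (map (hm \<Phi>) xs) \<subseteq> hm \<Phi> ` car A" using assms(3) by auto
  then show ?thesis unfolding eqst_def using the_inv_hm[OF assms] by (simp del: map_map)
qed

lemma fni_eqst_None: "\<not> set ys \<subseteq> hm \<Phi> ` car A \<Longrightarrow> fni (eqst \<Phi> A) g ys = None"
  unfolding eqst_def by simp

lemma rli_eqst_Inl: "rli (eqst \<Phi> A) (Inl r) = map (hm \<Phi>) ` rli A r" by (simp add: eqst_def)

lemma rli_eqst_Inr:
  "rli (eqst \<Phi> A) (Inr E) = (if E \<in> \<E> then {[\<Phi> E a] | a. a \<in> tuples (ar E) (car A)} else {})"
  by (simp add: eqst_def)

lemma eqst_eqI:
  assumes A: "A \<in> mods \<K>" "good \<Phi> A"
    and car: "car X = car (eqst \<Phi> A)"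
    and Inl: "\<And>g xs. set xs \<subseteq> car A \<Longrightarrow> fni X (Inl g) (map (hm \<Phi>) xs) = map_option (hm \<Phi>) (fni A g xs)"
    and Inr: "\<And>E xs. set xs \<subseteq> car A \<Longrightarrow> fni X (Inr E) (map (hm \<Phi>) xs) =
      (if E \<in> \<E> \<and> length xs = ar E then Some (\<Phi> E xs) else None)"
    and none: "\<And>g ys. \<not> set ys \<subseteq> hm \<Phi> ` car A \<Longrightarrow> fni X g ys = None"
    and rInl: "\<And>r. rli X (Inl r) = map (hm \<Phi>) ` rli A r"
    and rInr: "\<And>E. rli X (Inr E) = (if E \<in> \<E> then {[\<Phi> E a] | a. a \<in> tuples (ar E) (car A)} else {})"
  shows "X = eqst \<Phi> A"
proof (rule struct_eqI[OF car])
  show "fni X g ys = fni (eqst \<Phi> A) g ys" for g ys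
  proof (cases "set ys \<subseteq> hm \<Phi> ` car A")
    case True
    then obtain xs where xs: "set xs \<subseteq> car A" "ys = map (hm \<Phi>) xs" using lists_image_subset by blast
    show ?thesis unfolding xs(2)
      by (cases g) (simp_all only: Inl[OF xs(1)] Inr[OF xs(1)] fni_eqst_Inl[OF A xs(1)] fni_eqst_Inr[OF A xs(1)])
  next
    case False
    then show ?thesis using none fni_eqst_None by metis
  qed
  show "rli X r = rli (eqst \<Phi> A) r" for r
    by (cases r) (simp_all only: rInl rInr rli_eqst_Inl rli_eqst_Inr)
qed

lemma eq_voc_simps:
  "Inl g \<in> funs LE \<longleftrightarrow> g \<in> funs L" "Inr E \<in> funs LE \<longleftrightarrow> E \<in> \<E>"
  "Inl r \<in> rels LE \<longleftrightarrow> r \<in> rels L" "Inr E \<in> rels LE \<longleftrightarrow> E \<in> \<E>"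
  "far LE (Inl g) = far L g" "far LE (Inr E) = ar E"
  "rar LE (Inl r) = rar L r" "rar LE (Inr E) = 1" by (auto simp: eq_voc_def)

lemma hm_tuples: "xs \<in> tuples n (car A) \<Longrightarrow> map (hm \<Phi>) xs \<in> tuples n (car (eqst \<Phi> A))"
  by (rule map_in_tuples) (auto intro: hm_in)

lemma eqst_struct:
  assumes A: "A \<in> mods \<K>" "good \<Phi> A"
  shows "is_struct LE (eqst \<Phi> A)"
proof (rule is_structI)
  fix r xs assume xs: "xs \<in> rli (eqst \<Phi> A) r"
  show "r \<in> rels LE \<and> xs \<in> tuples (rar LE r) (car (eqst \<Phi> A))"
  proof (cases r)
    case (Inl s)
    then obtain ys where "ys \<in> rli A s" "xs = map (hm \<Phi>) ys" using xs by (auto simp: rli_eqst_Inl)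
    then show ?thesis using is_struct_rliD[OF mods_struct[OF A(1)], of ys s] hm_tuples[of ys "rar L s" A \<Phi>] Inl
      by (simp add: eq_voc_simps)
  next
    case (Inr E)
    then show ?thesis using xs in_eqst[of E _ A \<Phi>]
      by (auto simp: rli_eqst_Inr eq_voc_simps tuples_def split: if_splits)
  qed
next
  fix g ys y assume ys: "fni (eqst \<Phi> A) g ys = Some y"
  then have "set ys \<subseteq> hm \<Phi> ` car A" using fni_eqst_None[of ys \<Phi> A g] by force
  then obtain xs where xs: "set xs \<subseteq> car A" "ys = map (hm \<Phi>) xs" using lists_image_subset by blast
  show "g \<in> funs LE \<and> ys \<in> tuples (far LE g) (car (eqst \<Phi> A)) \<and> y \<in> car (eqst \<Phi> A)"
  proof (cases g)
    case (Inl f)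
    then obtain z where z: "fni A f xs = Some z" "y = hm \<Phi> z"
      using ys unfolding xs(2) by (auto simp: fni_eqst_Inl[OF A xs(1)])
    show ?thesis using is_struct_fniD[OF mods_struct[OF A(1)] z(1)] hm_tuples[of xs "far L f" A \<Phi>] hm_in[of z A \<Phi>] z(2)
      by (simp add: eq_voc_simps Inl xs(2))
  next
    case (Inr E)
    have E: "E \<in> \<E>" "length xs = ar E" "y = \<Phi> E xs"
      using ys unfolding xs(2) Inr fni_eqst_Inr[OF A xs(1)] by (auto split: if_splits)
    then have "xs \<in> tuples (ar E) (car A)" using xs(1) by (simp add: tuples_def)
    then show ?thesis using E hm_tuples[of xs "ar E" A \<Phi>] in_eqst[of E xs A \<Phi>] by (simp add: eq_voc_simps Inr xs(2))
  qed
qed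

lemma good_embedding:
  assumes "embedding \<K> k A B" "good \<Phi> B"
  shows "good (\<lambda>E a. \<Phi> E (map k a)) A"
  unfolding good_def
proof (intro ballI)
  fix E E' a b
  assume E: "E \<in> \<E>" "E' \<in> \<E>" and a: "a \<in> tuples (ar E) (car A)" and b: "b \<in> tuples (ar E') (car A)"
  have "(map k a, map k b) \<in> eq_on \<K> M E B \<longleftrightarrow> (a, b) \<in> eq_on \<K> M E A"
    by (rule eq_on_embedding[OF assms(1) tuplesD(2)[OF a] tuplesD(2)[OF b]])
  then show "\<Phi> E (map k a) = \<Phi> E' (map k b) \<longleftrightarrow> E = E' \<and> (a, b) \<in> eq_on \<K> M E A"
    using goodD[OF assms(2) E map_in_tuples[OF a embedding_image[OF assms(1)]]
        map_in_tuples[OF b embedding_image[OF assms(1)]]] by simp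
qed

lemma good_strong: "strong \<K> A B \<Longrightarrow> good \<Phi> B \<Longrightarrow> good \<Phi> A"
  using good_embedding[OF embedding_incl] by fastforce

lemma good_cong:
  assumes "good \<Phi> A" "\<And>E a. E \<in> \<E> \<Longrightarrow> a \<in> tuples (ar E) (car A) \<Longrightarrow> \<Psi> E a = \<Phi> E a"
  shows "good \<Psi> A"
  using assms unfolding good_def by simp

lemma good_comp:
  assumes "good \<Phi> A" "inj_on h (car (eqst \<Phi> A))"
  shows "good (\<lambda>E a. h (\<Phi> E a)) A"
  using assms(1) in_eqst inj_on_eq_iff[OF assms(2)] unfolding good_def by metis

lemma tuples_image: "tuples n (k ` X) = map k ` tuples n X"
proof
  show "tuples n (k ` X) \<subseteq> map k ` tuples n X"
  proof
    fix ys assume ys: "ys \<in> tuples n (k ` X)"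
    then obtain xs where "set xs \<subseteq> X" "ys = map k xs" using lists_image_subset tuplesD(2) by metis
    then show "ys \<in> map k ` tuples n X" using ys by (auto simp: tuples_def)
  qed
  show "map k ` tuples n X \<subseteq> tuples n (k ` X)" by (auto intro: map_in_tuples)
qed

text \<open>One computation for both changes of presentation: \<open>copy_eqst\<close> is the case
  where \<open>k\<close> is the identity and only the names change, \<open>eqst_copy\<close> the
  case where \<open>h\<close> is the identity and only the home structure changes.\<close>

lemma copy_eqst_copy:
  assumes A: "A \<in> mods \<K>" "good \<Phi> A" and k: "inj_on k (car A)" and g: "good \<Psi> (copy k A)"
    and h: "inj_on h (car (eqst \<Phi> A))"
    and hk: "\<And>E a. E \<in> \<E> \<Longrightarrow> a \<in> tuples (ar E) (car A) \<Longrightarrow> h (\<Phi> E a) = \<Psi> E (map k a)"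
  shows "copy h (eqst \<Phi> A) = eqst \<Psi> (copy k A)"
proof (rule eqst_eqI[OF mods_copy[OF A(1) k] g])
  have h1: "h (hm \<Phi> x) = hm \<Psi> (k x)" if "x \<in> car A" for x
    using hk[OF id_in_E singleton_in_tuples[OF that]] by simp
  have f: "fni (copy h (eqst \<Phi> A)) f (map (hm \<Psi>) (map k zs)) = map_option h (fni (eqst \<Phi> A) f (map (hm \<Phi>) zs))"
    if zs: "set zs \<subseteq> car A" for f zs
  proof -
    have "set (map (hm \<Phi>) zs) \<subseteq> car (eqst \<Phi> A)" using zs hm_in[of _ A \<Phi>] by auto
    moreover have "map (hm \<Psi>) (map k zs) = map h (map (hm \<Phi>) zs)" using h1 zs by auto
    ultimately show ?thesis using fni_copy[OF h] by metis
  qed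
  show "car (copy h (eqst \<Phi> A)) = car (eqst \<Psi> (copy k A))"
    unfolding car_copy car_eqst_UN image_UN image_image tuples_image
    by (intro SUP_cong image_cong refl hk)
  show "fni (copy h (eqst \<Phi> A)) (Inl f) (map (hm \<Psi>) xs) = map_option (hm \<Psi>) (fni (copy k A) f xs)"
    if x: "set xs \<subseteq> car (copy k A)" for f xs
  proof -
    obtain zs where zs: "set zs \<subseteq> car A" "xs = map k zs" using lists_image_subset[of xs k "car A"] x by auto
    have "map_option h (map_option (hm \<Phi>) (fni A f zs)) = map_option (hm \<Psi>) (map_option k (fni A f zs))"
      using is_struct_fniD[OF mods_struct[OF A(1)], of f zs] h1 by (cases "fni A f zs") auto
    then show ?thesis unfolding zs(2) f[OF zs(1)] fni_eqst_Inl[OF A zs(1)] fni_copy[OF k zs(1)] .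
  qed
  show "fni (copy h (eqst \<Phi> A)) (Inr E) (map (hm \<Psi>) xs) =
      (if E \<in> \<E> \<and> length xs = ar E then Some (\<Psi> E xs) else None)"
    if x: "set xs \<subseteq> car (copy k A)" for E xs
  proof -
    obtain zs where zs: "set zs \<subseteq> car A" "xs = map k zs" using lists_image_subset[of xs k "car A"] x by auto
    show ?thesis unfolding zs(2) f[OF zs(1)] fni_eqst_Inr[OF A zs(1)]
      using hk[of E zs] zs(1) by (simp add: tuples_def)
  qed
  show "fni (copy h (eqst \<Phi> A)) f ys = None" if n: "\<not> set ys \<subseteq> hm \<Psi> ` car (copy k A)" for f ys
  proof (cases "set ys \<subseteq> h ` car (eqst \<Phi> A)")
    case True
    then obtain xs where xs: "set xs \<subseteq> car (eqst \<Phi> A)" "ys = map h xs" using lists_image_subset by blast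
    have "\<not> set xs \<subseteq> hm \<Phi> ` car A" using n h1 unfolding xs(2) by (auto simp: subset_iff image_iff)
    from fni_eqst_None[of xs \<Phi> A f, OF this] show ?thesis unfolding xs(2) fni_copy[OF h xs(1)] by simp
  next
    case False then show ?thesis by (auto simp: copy_def)
  qed
  show "rli (copy h (eqst \<Phi> A)) (Inl r) = map (hm \<Psi>) ` rli (copy k A) r" for r
  proof -
    have "map h (map (hm \<Phi>) xs) = map (hm \<Psi>) (map k xs)" if "xs \<in> rli A r" for xs
      using is_struct_rliD[OF mods_struct[OF A(1)] that] h1 by (auto simp: tuples_def)
    then show ?thesis unfolding rli_copy rli_eqst_Inl image_image by (rule image_cong[OF refl])
  qed
  show "rli (copy h (eqst \<Phi> A)) (Inr E) =
      (if E \<in> \<E> then {[\<Psi> E a] | a. a \<in> tuples (ar E) (car (copy k A))} else {})" for E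
    by (simp add: rli_copy rli_eqst_Inr Setcompr_eq_image image_image tuples_image hk cong: image_cong)
qed

lemma copy_eqst:
  assumes A: "A \<in> mods \<K>" "good \<Phi> A" and h: "inj_on h (car (eqst \<Phi> A))"
  shows "copy h (eqst \<Phi> A) = eqst (\<lambda>E a. h (\<Phi> E a)) A"
  using copy_eqst_copy[of A \<Phi> "\<lambda>x. x" "\<lambda>E a. h (\<Phi> E a)" h] A h good_comp[OF A(2) h]
    copy_ident[OF mods_struct[OF A(1)], of "\<lambda>x. x"] by simp

lemma eqst_copy:
  assumes A: "A \<in> mods \<K>" "good \<Phi> A" and k: "inj_on k (car A)" and g: "good \<Psi> (copy k A)"
    and hk: "\<And>E a. E \<in> \<E> \<Longrightarrow> a \<in> tuples (ar E) (car A) \<Longrightarrow> \<Phi> E a = \<Psi> E (map k a)"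
  shows "eqst \<Phi> A = eqst \<Psi> (copy k A)"
  using copy_eqst_copy[OF A k g, of "\<lambda>x. x"] hk copy_ident[OF eqst_struct[OF A], of "\<lambda>x. x"] by simp

lemma home_sort_eqst:
  assumes A: "A \<in> mods \<K>" "good \<Phi> A"
  shows "home_sort M (eqst \<Phi> A) = copy (hm \<Phi>) A"
proof -
  have H: "{x. [x] \<in> rli (eqst \<Phi> A) (Inr \<iota>)} = hm \<Phi> ` car A"
    using id_in_E by (auto simp: rli_eqst_Inr tuples_id)
  show ?thesis
  proof (rule struct_eqI)
    show "car (home_sort M (eqst \<Phi> A)) = car (copy (hm \<Phi>) A)"
      using H by (simp add: home_sort_def restr_def)
    show "fni (home_sort M (eqst \<Phi> A)) g ys = fni (copy (hm \<Phi>) A) g ys" for g ys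
    proof (cases "set ys \<subseteq> hm \<Phi> ` car A")
      case True
      then obtain xs where xs: "set xs \<subseteq> car A" "ys = map (hm \<Phi>) xs" using lists_image_subset by blast
      have "fni (home_sort M (eqst \<Phi> A)) g ys = Option.bind (map_option (hm \<Phi>) (fni A g xs))
          (\<lambda>y. if y \<in> hm \<Phi> ` car A then Some y else None)"
        using True fni_eqst_Inl[OF A xs(1), of g] H unfolding home_sort_def restr_def xs(2) by simp
      also have "\<dots> = map_option (hm \<Phi>) (fni A g xs)"
        using is_struct_fniD[OF mods_struct[OF A(1)], of g xs] by (cases "fni A g xs") auto
      finally show ?thesis unfolding xs(2) fni_copy[OF hm_inj[OF A] xs(1)] .
    next
      case False
      then show ?thesis using H by (simp add: home_sort_def restr_def copy_def)
    qed
    show "rli (home_sort M (eqst \<Phi> A)) r = rli (copy (hm \<Phi>) A) r" for r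
    proof -
      have "set xs \<subseteq> hm \<Phi> ` car A" if xs: "xs \<in> map (hm \<Phi>) ` rli A r" for xs
      proof -
        obtain ys where ys: "ys \<in> rli A r" "xs = map (hm \<Phi>) ys" using xs by blast
        then show ?thesis using is_struct_rliD[OF mods_struct[OF A(1)] ys(1)]
          by (simp add: tuples_def image_mono)
      qed
      then show ?thesis using H unfolding home_sort_def restr_def
        by (auto simp: rli_copy rli_eqst_Inl)
    qed
  qed
qed

text \<open>The home sorts are copies of \<open>A\<close> and of \<open>B\<close>, and their
  equality yields \<open>k\<close>. The functions F_E belong to the structure, so their values at
  home tuples force the two namings to agree along \<open>k\<close>.\<close>

lemma eqst_unique:
  assumes A: "A \<in> mods \<K>" "good \<Phi> A" and B: "B \<in> mods \<K>" "good \<Psi> B" and eq: "eqst \<Phi> A = eqst \<Psi> B"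
  obtains k where "inj_on k (car A)" "B = copy k A" "\<forall>x\<in>car A. hm \<Psi> (k x) = hm \<Phi> x"
    "\<forall>E\<in>\<E>. \<forall>a\<in>tuples (ar E) (car A). \<Phi> E a = \<Psi> E (map k a)"
proof -
  define k where "k = inv_into (car B) (hm \<Psi>) \<circ> hm \<Phi>"
  have c: "copy (hm \<Phi>) A = copy (hm \<Psi>) B" using home_sort_eqst[OF A] home_sort_eqst[OF B] eq by simp
  note k = copy_inj[OF mods_struct[OF A(1)] mods_struct[OF B(1)] hm_inj[OF A] hm_inj[OF B] c, folded k_def]
  have "\<Phi> E a = \<Psi> E (map k a)" if E: "E \<in> \<E>" and a: "a \<in> tuples (ar E) (car A)" for E a
  proof -
    have ka: "map k a \<in> tuples (ar E) (car B)" using map_in_tuples[OF a, of k "car B"] k(2) by simp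
    have "map (hm \<Phi>) a = map (hm \<Psi>) (map k a)" using k(3) tuplesD[OF a] by auto
    then have "fni (eqst \<Phi> A) (Inr E) (map (hm \<Phi>) a) = fni (eqst \<Psi> B) (Inr E) (map (hm \<Psi>) (map k a))"
      by (simp only: eq)
    then show ?thesis
      unfolding fni_eqst_Inr[OF A tuplesD(2)[OF a]] fni_eqst_Inr[OF B tuplesD(2)[OF ka]]
      using tuplesD[OF a] E by simp
  qed
  then show thesis using that k by blast
qed

text \<open>Both namings have the same fibres, namely the classes of each sort, so that matching the
  names is well defined and injective.\<close>

lemma eqst_map:
  assumes "good \<Phi> A" "good \<Psi> A"
  obtains h where "inj_on h (car (eqst \<Phi> A))"
    "\<forall>E\<in>\<E>. \<forall>a\<in>tuples (ar E) (car A). h (\<Phi> E a) = \<Psi> E a"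
proof -
  define h where "h x = (THE y. \<exists>E a. E \<in> \<E> \<and> a \<in> tuples (ar E) (car A) \<and> x = \<Phi> E a \<and> y = \<Psi> E a)" for x
  have h: "h (\<Phi> E a) = \<Psi> E a" if "E \<in> \<E>" "a \<in> tuples (ar E) (car A)" for E a unfolding h_def
  proof (rule the_equality)
    show "\<exists>E' a'. E' \<in> \<E> \<and> a' \<in> tuples (ar E') (car A) \<and> \<Phi> E a = \<Phi> E' a' \<and> \<Psi> E a = \<Psi> E' a'"
      using that by blast
    fix y assume "\<exists>E' a'. E' \<in> \<E> \<and> a' \<in> tuples (ar E') (car A) \<and> \<Phi> E a = \<Phi> E' a' \<and> y = \<Psi> E' a'"
    then obtain E' a' where "E' \<in> \<E>" "a' \<in> tuples (ar E') (car A)" "\<Phi> E a = \<Phi> E' a'" "y = \<Psi> E' a'" by blast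
    then show "y = \<Psi> E a" using goodD[OF assms(1) that(1) _ that(2)] goodD[OF assms(2) that(1) _ that(2)] by metis
  qed
  have "inj_on h (car (eqst \<Phi> A))"
  proof (rule inj_onI)
    fix x y assume "x \<in> car (eqst \<Phi> A)" "y \<in> car (eqst \<Phi> A)" and e: "h x = h y"
    then obtain E a E' a' where *: "E \<in> \<E>" "a \<in> tuples (ar E) (car A)" "x = \<Phi> E a"
      "E' \<in> \<E>" "a' \<in> tuples (ar E') (car A)" "y = \<Phi> E' a'" by (auto simp: car_eqst)
    have "\<Psi> E a = \<Psi> E' a'" using e unfolding *(3,6) h[OF *(1,2)] h[OF *(4,5)] .
    then show "x = y"
      unfolding *(3,6) using goodD[OF assms(1) *(1,4,2,5)] goodD[OF assms(2) *(1,4,2,5)] by blast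
  qed
  then show thesis using that h by blast
qed

lemma good_imag:
  assumes A: "A \<in> mods \<K>"
  shows "good (imag \<K> M A) A"
  unfolding good_def
proof (intro ballI)
  fix E E' a b
  assume E: "E \<in> \<E>" "E' \<in> \<E>" and ab: "a \<in> tuples (ar E) (car A)" "b \<in> tuples (ar E') (car A)"
  show "imag \<K> M A E a = imag \<K> M A E' b \<longleftrightarrow> E = E' \<and> (a, b) \<in> eq_on \<K> M E A"
    using eq_equiv_class_iff[OF equiv_eq_on[OF E(1) A]] ab unfolding imag_def by auto
qed

section \<open>Members and strong submodels of the class of imaginaries\<close>

lemma voc_Keq [simp]: "voc Keq = LE" by (simp add: eq_class_def Let_def)

lemma mods_Keq: "X \<in> mods Keq \<longleftrightarrow> (\<exists>A\<in>mods \<K>. \<exists>\<Phi>. good \<Phi> A \<and> X = eqst \<Phi> A)"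
proof
  assume "X \<in> mods Keq"
  then obtain A h where A: "A \<in> mods \<K>" and h: "inj_on h (car (eqst (imag \<K> M A) A))"
    "X = copy h (eqst (imag \<K> M A) A)"
    by (auto simp: eq_class_def Let_def eq_struct_eqst iso_iff_copy)
  show "\<exists>A\<in>mods \<K>. \<exists>\<Phi>. good \<Phi> A \<and> X = eqst \<Phi> A" unfolding h(2) copy_eqst[OF A good_imag[OF A] h(1)]
    using A good_comp[OF good_imag[OF A] h(1)] by blast
next
  assume "\<exists>A\<in>mods \<K>. \<exists>\<Phi>. good \<Phi> A \<and> X = eqst \<Phi> A"
  then obtain A \<Phi> where A: "A \<in> mods \<K>" "good \<Phi> A" "X = eqst \<Phi> A" by blast
  from eqst_map[OF good_imag[OF A(1)] A(2)] obtain h where h: "inj_on h (car (eqst (imag \<K> M A) A))"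
    "\<forall>E\<in>\<E>. \<forall>a\<in>tuples (ar E) (car A). h (imag \<K> M A E a) = \<Phi> E a" .
  have "copy h (eqst (imag \<K> M A) A) = X"
    using copy_eqst_copy[OF A(1) good_imag[OF A(1)], of "\<lambda>x. x" \<Phi> h] A h
      copy_ident[OF mods_struct[OF A(1)], of "\<lambda>x. x"] by simp
  then have "iso LE h (eq_struct \<K> M \<E> A) X" unfolding iso_iff_copy eq_struct_eqst
    using eqst_struct[OF A(1) good_imag[OF A(1)]] h(1) by simp
  then show "X \<in> mods Keq" using A(1) by (auto simp: eq_class_def Let_def)
qed

lemma hm_mem:
  assumes "strong \<K> A B" "good \<Phi> B" "x \<in> car B" "hm \<Phi> x \<in> car (eqst \<Phi> A)"
  shows "x \<in> car A"
proof -
  obtain E a where E: "E \<in> \<E>" "a \<in> tuples (ar E) (car A)" "hm \<Phi> x = \<Phi> E a"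
    using eqst_cases[OF assms(4)] .
  have aB: "a \<in> tuples (ar E) (car B)" using E(2) strongD(4)[OF assms(1)] by (auto simp: tuples_def)
  from goodD[OF assms(2) id_in_E E(1) singleton_in_tuples[OF assms(3)] aB] E(3)
  have *: "E = \<iota>" "([x], a) \<in> eq_on \<K> M \<iota> B" by auto
  obtain y where "y \<in> car A" "a = [y]" using E(2) unfolding *(1) tuples_id by blast
  then show ?thesis using *(2) eq_on_id[OF strongD(2)[OF assms(1)] assms(3)] strongD(4)[OF assms(1)] by auto
qed

lemma tuples_mono: "X \<subseteq> Y \<Longrightarrow> tuples n X \<subseteq> tuples n Y" by (auto simp: tuples_def)

lemma eqst_subset:
  assumes "car A \<subseteq> car B"
  shows "car (eqst \<Phi> A) \<subseteq> car (eqst \<Phi> B)"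
proof
  fix x assume "x \<in> car (eqst \<Phi> A)"
  then obtain E a where "E \<in> \<E>" "a \<in> tuples (ar E) (car A)" "x = \<Phi> E a" by (rule eqst_cases)
  then show "x \<in> car (eqst \<Phi> B)" using in_eqst[of E a B \<Phi>] tuples_mono[OF assms, of "ar E"] by blast
qed

text \<open>A representative taken in \<open>B\<close> of an imaginary of \<open>A\<close> need not
  lie in \<open>A\<close>. Disjointness of sorts ensures that the representative found in
  \<open>A\<close> belongs to the same sort \<open>E\<close>.\<close>

lemma eqst_mem:
  assumes "strong \<K> A B" "good \<Phi> B" "E \<in> \<E>" "a \<in> tuples (ar E) (car B)" "\<Phi> E a \<in> car (eqst \<Phi> A)"
  shows "\<exists>b\<in>tuples (ar E) (car A). \<Phi> E a = \<Phi> E b"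
proof -
  obtain E' b where E': "E' \<in> \<E>" "b \<in> tuples (ar E') (car A)" "\<Phi> E a = \<Phi> E' b"
    using eqst_cases[OF assms(5)] .
  have "b \<in> tuples (ar E') (car B)" using E'(2) tuples_mono[OF strongD(4)[OF assms(1)]] by blast
  from goodD[OF assms(2,3) E'(1) assms(4) this] E' show ?thesis by auto
qed

lemma substructure_eqst:
  assumes AB: "strong \<K> A B" and g: "good \<Phi> B"
  shows "substructure LE (eqst \<Phi> A) (eqst \<Phi> B)"
proof -
  note A = strongD(1)[OF AB] good_strong[OF AB g] and B = strongD(2)[OF AB] g
  note sub = substructureD[OF strongD(3)[OF AB]]
  have rl: "rli (eqst \<Phi> A) r = {xs \<in> rli (eqst \<Phi> B) r. set xs \<subseteq> car (eqst \<Phi> A)}" for r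
  proof (cases r)
    case (Inl s)
    have "map (hm \<Phi>) xs \<in> map (hm \<Phi>) ` rli A s \<longleftrightarrow> set (map (hm \<Phi>) xs) \<subseteq> car (eqst \<Phi> A)"
      if xs: "xs \<in> rli B s" for xs
    proof
      assume "set (map (hm \<Phi>) xs) \<subseteq> car (eqst \<Phi> A)"
      moreover have "set xs \<subseteq> car B" using is_struct_rliD[OF sub(2) xs] by (simp add: tuples_def)
      ultimately have "set xs \<subseteq> car A" using hm_mem[OF AB g] by auto
      then show "map (hm \<Phi>) xs \<in> map (hm \<Phi>) ` rli A s" using sub(4) xs by blast
    next
      assume "map (hm \<Phi>) xs \<in> map (hm \<Phi>) ` rli A s"
      then obtain ys where ys: "ys \<in> rli A s" "map (hm \<Phi>) xs = map (hm \<Phi>) ys" by blast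
      have "set ys \<subseteq> car A" using is_struct_rliD[OF sub(1) ys(1)] by (simp add: tuples_def)
      then show "set (map (hm \<Phi>) xs) \<subseteq> car (eqst \<Phi> A)" unfolding ys(2) using hm_in by auto
    qed
    moreover have "rli A s \<subseteq> rli B s" using sub(4) by auto
    ultimately show ?thesis unfolding Inl rli_eqst_Inl by blast
  next
    case (Inr E)
    show ?thesis
    proof (cases "E \<in> \<E>")
      case True
      have "[\<Phi> E a] \<in> {[\<Phi> E a] | a. a \<in> tuples (ar E) (car A)} \<longleftrightarrow> \<Phi> E a \<in> car (eqst \<Phi> A)"
        if "a \<in> tuples (ar E) (car B)" for a
        using eqst_mem[OF AB g True that] in_eqst[OF True, of _ A \<Phi>] by auto
      moreover have "tuples (ar E) (car A) \<subseteq> tuples (ar E) (car B)" by (rule tuples_mono[OF sub(3)])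
      ultimately show ?thesis unfolding Inr rli_eqst_Inr using True in_eqst[OF True, of _ A \<Phi>] by auto
    next
      case False then show ?thesis unfolding Inr rli_eqst_Inr by simp
    qed
  qed
  have fn: "fni (eqst \<Phi> A) f ys = fni (eqst \<Phi> B) f ys" if ys: "set ys \<subseteq> car (eqst \<Phi> A)" for f ys
  proof (cases "set ys \<subseteq> hm \<Phi> ` car B")
    case True
    then obtain xs where xs: "set xs \<subseteq> car B" "ys = map (hm \<Phi>) xs" using lists_image_subset by blast
    have xA: "set xs \<subseteq> car A" using hm_mem[OF AB g] ys xs by auto
    show ?thesis unfolding xs(2) by (cases f) (simp_all only: fni_eqst_Inl[OF A xA] fni_eqst_Inl[OF B xs(1)]
          fni_eqst_Inr[OF A xA] fni_eqst_Inr[OF B xs(1)] sub(5)[OF xA])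
  next
    case False
    then have "\<not> set ys \<subseteq> hm \<Phi> ` car A" using sub(3) by blast
    then show ?thesis using False fni_eqst_None by metis
  qed
  show ?thesis unfolding substructure_def
    using eqst_struct[OF A] eqst_struct[OF B] eqst_subset[OF sub(3), of \<Phi>] rl fn by auto
qed

text \<open>The point is that a strong submodel can be written with the naming of the larger
  structure. Its home sort is moved into \<open>B\<close>, and since the F_E of a substructure are
  restrictions, its own names are those given by \<open>\<Phi>\<close>.\<close>

lemma strong_Keq:
  assumes B: "B \<in> mods \<K>" "good \<Phi> B"
  shows "strong Keq X (eqst \<Phi> B) \<longleftrightarrow> (\<exists>A. strong \<K> A B \<and> X = eqst \<Phi> A)"
proof
  assume "\<exists>A. strong \<K> A B \<and> X = eqst \<Phi> A"
  then obtain A where AB: "strong \<K> A B" and X: "X = eqst \<Phi> A" by blast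
  note A = strongD(1)[OF AB] good_strong[OF AB B(2)]
  have "X \<in> mods Keq" "eqst \<Phi> B \<in> mods Keq" using mods_Keq A B X by blast+
  moreover have "substructure LE X (eqst \<Phi> B)" unfolding X by (rule substructure_eqst[OF AB B(2)])
  moreover have "strong_copy \<K> (home_sort M X) (home_sort M (eqst \<Phi> B))"
    unfolding X home_sort_eqst[OF A] home_sort_eqst[OF B] strong_copy_iff using AB hm_inj[OF B] by blast
  ultimately show "strong Keq X (eqst \<Phi> B)" by (simp add: eq_class_def Let_def)
next
  assume "strong Keq X (eqst \<Phi> B)"
  then have "X \<in> mods Keq" and s: "substructure LE X (eqst \<Phi> B)"
    and c: "strong_copy \<K> (home_sort M X) (home_sort M (eqst \<Phi> B))"
    by (simp_all add: eq_class_def Let_def)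
  then obtain A \<Psi> where A: "A \<in> mods \<K>" "good \<Psi> A" and X: "X = eqst \<Psi> A" using mods_Keq by blast
  \<comment> \<open>\<open>j\<close> reads the home elements of the larger structure as elements of
    \<open>B\<close>.\<close>
  define j where "j = inv_into (car B) (hm \<Phi>)"
  note hB = hm_inj[OF B] and hA = hm_inj[OF A]
  have jB: "inj_on j (car (copy (hm \<Phi>) B))" unfolding j_def by (simp add: inj_on_inv_into)
  from strong_copy_transfer[OF c[unfolded X home_sort_eqst[OF A] home_sort_eqst[OF B]] jB]
  have AB: "strong \<K> (copy j (copy (hm \<Psi>) A)) B"
    unfolding j_def copy_inv_into[OF mods_struct[OF B(1)] hB] .
  \<comment> \<open>The predicate of the home sort is part of the substructure, so home elements of
    \<open>X\<close> are home elements of the larger structure, and \<open>j\<close> inverts the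
    naming on them.\<close>
  have sub: "hm \<Psi> ` car A \<subseteq> hm \<Phi> ` car B"
  proof
    fix y assume y: "y \<in> hm \<Psi> ` car A"
    then have "[y] \<in> rli X (Inr \<iota>)" unfolding X rli_eqst_Inr using id_in_E by (auto simp: tuples_id)
    then have "[y] \<in> rli (eqst \<Phi> B) (Inr \<iota>)" using substructureD(4)[OF s] by blast
    then show "y \<in> hm \<Phi> ` car B" unfolding rli_eqst_Inr using id_in_E by (auto simp: tuples_id)
  qed
  define k where "k = j \<circ> hm \<Psi>"
  have jA: "inj_on j (hm \<Psi> ` car A)" using inj_on_subset[OF jB] sub by simp
  have kA: "inj_on k (car A)" unfolding k_def by (rule comp_inj_on[OF hA jA])
  have e: "copy j (copy (hm \<Psi>) A) = copy k A"
    unfolding k_def by (rule copy_copy[OF mods_struct[OF A(1)] hA jA])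
  have kx: "hm \<Phi> (k x) = hm \<Psi> x" if "x \<in> car A" for x
    using sub that unfolding k_def j_def comp_apply by (meson f_inv_into_f image_eqI subsetD)
  note AB = AB[unfolded e]
  have "\<Psi> E a = \<Phi> E (map k a)" if E: "E \<in> \<E>" and a: "a \<in> tuples (ar E) (car A)" for E a
  proof -
    have ka: "set (map k a) \<subseteq> car B" using strongD(4)[OF AB] tuplesD(2)[OF a] by auto
    have m: "map (hm \<Psi>) a = map (hm \<Phi>) (map k a)" using kx tuplesD(2)[OF a] by auto
    have "set (map (hm \<Psi>) a) \<subseteq> car X" unfolding X using hm_in[of _ A \<Psi>] tuplesD(2)[OF a] by auto
    from substructureD(5)[OF s this, of "Inr E"]
    have "fni (eqst \<Psi> A) (Inr E) (map (hm \<Psi>) a) = fni (eqst \<Phi> B) (Inr E) (map (hm \<Phi>) (map k a))"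
      unfolding X m .
    then show ?thesis unfolding fni_eqst_Inr[OF A tuplesD(2)[OF a]] fni_eqst_Inr[OF B ka]
      using E tuplesD(1)[OF a] by simp
  qed
  then have "X = eqst \<Phi> (copy k A)" unfolding X by (rule eqst_copy[OF A kA good_strong[OF AB B(2)]])
  then show "\<exists>A. strong \<K> A B \<and> X = eqst \<Phi> A" using AB by blast
qed

end

section \<open>The class of imaginaries is an abstract elementary class\<close>

lemma card_tuples:
  assumes "infinite X"
  shows "|tuples n X| \<le>o |X|"
proof (induction n)
  case 0
  have "tuples 0 X = {[]}" by (auto simp: tuples_def)
  then show ?case using card_of_singl_ordLeq[of X "[]"] assms by auto
next
  case (Suc n)
  have "tuples (Suc n) X = (\<lambda>(x, xs). x # xs) ` (X \<times> tuples n X)"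
    by (auto simp: tuples_def length_Suc_conv image_iff)
  then have "|tuples (Suc n) X| \<le>o |X \<times> tuples n X|" using card_of_image by metis
  also have "|X \<times> tuples n X| \<le>o |X|"
    by (rule card_of_Times_ordLeq_infinite_Field) (use assms Suc in \<open>simp_all add: Field_card_of card_of_card_order_on card_of_mono1\<close>)
  finally show ?case .
qed

lemma union_chain_fni:
  assumes ch: "\<And>X Y. X \<in> \<C> \<Longrightarrow> Y \<in> \<C> \<Longrightarrow> substructure L X Y \<or> substructure L Y X"
    and X: "X \<in> \<C>" and ys: "set ys \<subseteq> car X"
  shows "fni (union_struct \<C>) g ys = fni X g ys"
proof -
  have *: "fni X g ys = Some y" if Y: "Y \<in> \<C>" and y: "fni Y g ys = Some y" for Y y using ch[OF X Y]
  proof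
    assume "substructure L X Y"
    then show ?thesis using substructureD(5)[of L X Y ys g] ys y by simp
  next
    assume s: "substructure L Y X"
    have "set ys \<subseteq> car Y" using is_struct_fniD[OF substructureD(1)[OF s] y] by (simp add: tuples_def)
    then show ?thesis using substructureD(5)[OF s] y by simp
  qed
  show ?thesis
  proof (cases "fni X g ys")
    case None
    have "fni A g ys = None" if "A \<in> \<C>" for A using *[OF that] None by (cases "fni A g ys") auto
    then show ?thesis using None unfolding union_struct_def by simp
  next
    case (Some y)
    have "(THE y. \<exists>A\<in>\<C>. fni A g ys = Some y) = y"
    proof (rule the_equality)
      show "\<exists>A\<in>\<C>. fni A g ys = Some y" using Some X by blast
      fix z assume "\<exists>A\<in>\<C>. fni A g ys = Some z"
      then obtain A where "A \<in> \<C>" "fni A g ys = Some z" by blast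
      from *[OF this] show "z = y" using Some by simp
    qed
    then show ?thesis using Some X unfolding union_struct_def by auto
  qed
qed

text \<open>A value of a function or an instance of a relation involves finitely many elements,
  hence it is already present in one member.\<close>

lemma union_substructures:
  assumes sub: "\<And>A. A \<in> \<C> \<Longrightarrow> substructure L A N" and N: "is_struct L N"
    and dir: "\<And>F. finite F \<Longrightarrow> F \<subseteq> car N \<Longrightarrow> \<exists>A\<in>\<C>. F \<subseteq> car A"
  shows "union_struct \<C> = N"
proof (rule struct_eqI)
  have "\<exists>A\<in>\<C>. x \<in> car A" if "x \<in> car N" for x using dir[of "{x}"] that by simp
  then show "car (union_struct \<C>) = car N" using substructureD(3)[OF sub]
    unfolding union_struct_def by auto
  show "fni (union_struct \<C>) g ys = fni N g ys" for g ys
  proof (cases "fni N g ys")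
    case None
    have "fni A g ys = None" if A: "A \<in> \<C>" for A
      using is_struct_fni_None[OF substructureD(1)[OF sub[OF A]], of g ys]
        substructureD(5)[OF sub[OF A], of ys g] None by (cases "set ys \<subseteq> car A") auto
    then show ?thesis using None unfolding union_struct_def by simp
  next
    case (Some y)
    have "set ys \<subseteq> car N" using is_struct_fniD[OF N Some] by (simp add: tuples_def)
    then obtain A where A: "A \<in> \<C>" "set ys \<subseteq> car A" using dir[of "set ys"] by auto
    have e: "fni A g ys = Some y" using substructureD(5)[OF sub[OF A(1)] A(2)] Some by simp
    have u: "z = y" if B: "B \<in> \<C>" "fni B g ys = Some z" for B z
    proof -
      have "set ys \<subseteq> car B"
        using is_struct_fniD[OF substructureD(1)[OF sub[OF B(1)]] B(2)] by (simp add: tuples_def)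
      from substructureD(5)[OF sub[OF B(1)] this, of g] show ?thesis using B(2) Some by simp
    qed
    have "(THE y. \<exists>A\<in>\<C>. fni A g ys = Some y) = y" by (rule the_equality) (use A e u in blast)+
    then show ?thesis using Some A(1) e unfolding union_struct_def by auto
  qed
  show "rli (union_struct \<C>) r = rli N r" for r
  proof
    show "rli (union_struct \<C>) r \<subseteq> rli N r" using substructureD(4)[OF sub] unfolding union_struct_def by auto
    show "rli N r \<subseteq> rli (union_struct \<C>) r"
    proof
      fix xs assume xs: "xs \<in> rli N r"
      then have "set xs \<subseteq> car N" using is_struct_rliD[OF N xs] by (simp add: tuples_def)
      then obtain A where A: "A \<in> \<C>" "set xs \<subseteq> car A" using dir[of "set xs"] by auto
      then have "xs \<in> rli A r" using substructureD(4)[OF sub[OF A(1)], of r] xs by blast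
      then show "xs \<in> rli (union_struct \<C>) r" using A(1) unfolding union_struct_def by auto
    qed
  qed
qed

lemma chain_linear:
  assumes "\<And>\<S>. \<S> \<subseteq> \<C> \<Longrightarrow> \<S> \<noteq> {} \<Longrightarrow> \<exists>A\<in>\<S>. \<forall>B\<in>\<S>. R A B" "A \<in> \<C>" "B \<in> \<C>"
  shows "R A B \<or> R B A"
  using assms(1)[of "{A, B}"] assms(2,3) by auto

lemma chain_finite_subset:
  assumes ne: "\<C> \<noteq> {}" and ch: "\<And>A B. A \<in> \<C> \<Longrightarrow> B \<in> \<C> \<Longrightarrow> car A \<subseteq> car B \<or> car B \<subseteq> car A"
    and F: "finite F" "F \<subseteq> (\<Union>A\<in>\<C>. car A)"
  shows "\<exists>A\<in>\<C>. F \<subseteq> car A"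
proof -
  have "subset.chain UNIV (car ` \<C>)" using ch by (auto simp: subset_chain_def)
  from finite_subset_Union_chain[OF F(1) F(2) _ this] ne show ?thesis by blast
qed

context fur_eq
begin

text \<open>There are countably many sorts, each the image of the set of tuples of one length, and
  the models are infinite.\<close>

lemma card_eqst_le:
  assumes A: "A \<in> mods \<K>"
  shows "|car (eqst \<Phi> A)| \<le>o |car A|"
proof -
  have inf: "infinite (car A)" using mods_infinite[OF A] .
  have "|\<E>| \<le>o |car A|" using countable_E inf countable_iff_ordLeq[of \<E>]
    infinite_iff_natLeq_ordLeq[of "car A"] ordLeq_transitive by blast
  moreover have "|\<Phi> E ` tuples (ar E) (car A)| \<le>o |car A|" for E
    using card_of_image card_tuples[OF inf] ordLeq_transitive by blast
  ultimately show ?thesis unfolding car_eqst_UN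
    by (intro card_of_UNION_ordLeq_infinite_Field) (use inf in \<open>simp_all add: Field_card_of card_of_card_order_on\<close>)
qed

lemma card_eqst_ge:
  assumes A: "A \<in> mods \<K>" "good \<Phi> A"
  shows "|car A| \<le>o |car (eqst \<Phi> A)|"
  unfolding card_of_ordLeq[symmetric] using hm_inj[OF A] hm_in[of _ A \<Phi>] by blast

lemma card_eqst_less:
  assumes A: "A \<in> mods \<K>" "good \<Phi> A"
  shows "|car (eqst \<Phi> A)| <o r \<longleftrightarrow> |car A| <o r"
  using ordLeq_ordLess_trans[OF card_eqst_le[OF A(1), of \<Phi>], of r] ordLeq_ordLess_trans[OF card_eqst_ge[OF A], of r]
  by (rule iffI[rotated])

lemma countable_eqst:
  assumes A: "A \<in> mods \<K>" "good \<Phi> A"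
  shows "countable (car (eqst \<Phi> A)) \<longleftrightarrow> countable (car A)"
  unfolding countable_iff_ordLeq
  using ordLeq_transitive[OF card_eqst_le[OF A(1), of \<Phi>], of natLeq] ordLeq_transitive[OF card_eqst_ge[OF A], of natLeq]
  by (rule iffI[rotated])

lemma mods_Keq_eqst: "A \<in> mods \<K> \<Longrightarrow> good \<Phi> A \<Longrightarrow> eqst \<Phi> A \<in> mods Keq" using mods_Keq by blast

lemma mods_Keq_struct: "X \<in> mods Keq \<Longrightarrow> is_struct LE X" using mods_Keq eqst_struct by metis

lemma strong_Keq_D:
  assumes "strong Keq X Y"
  shows "X \<in> mods Keq" "Y \<in> mods Keq" "substructure LE X Y" "strong_copy \<K> (home_sort M X) (home_sort M Y)"
  using assms by (simp_all add: eq_class_def Let_def)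

lemma strong_Keq_obtain:
  assumes "strong Keq X Y"
  obtains A B \<Phi> where "strong \<K> A B" "good \<Phi> B" "X = eqst \<Phi> A" "Y = eqst \<Phi> B"
proof -
  obtain B \<Phi> where B: "B \<in> mods \<K>" "good \<Phi> B" "Y = eqst \<Phi> B"
    using strong_Keq_D(2)[OF assms] mods_Keq by blast
  then show thesis using strong_Keq[OF B(1,2), of X] assms that by blast
qed

lemma strong_Keq_eqst: "strong \<K> A B \<Longrightarrow> good \<Phi> B \<Longrightarrow> strong Keq (eqst \<Phi> A) (eqst \<Phi> B)"
  using strong_Keq[OF strongD(2)] by blast

lemma iso_eqst:
  assumes A: "A \<in> mods \<K>" "good \<Phi> A" and h: "iso LE h (eqst \<Phi> A) Y"
  shows "good (\<lambda>E a. h (\<Phi> E a)) A" "Y = eqst (\<lambda>E a. h (\<Phi> E a)) A"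
proof -
  have "inj_on h (car (eqst \<Phi> A))" "Y = copy h (eqst \<Phi> A)" using h unfolding iso_iff_copy by auto
  then show "good (\<lambda>E a. h (\<Phi> E a)) A" "Y = eqst (\<lambda>E a. h (\<Phi> E a)) A"
    using good_comp[OF A(2)] copy_eqst[OF A] by auto
qed

lemma embedding_Keq_iff: "embedding Keq h X Y \<longleftrightarrow>
    X \<in> mods Keq \<and> inj_on h (car X) \<and> strong Keq (copy h X) Y"
  unfolding embedding_def iso_iff_copy voc_Keq using mods_Keq_struct by auto

lemma embedding_lift:
  assumes k: "embedding \<K> k A B" and A: "good \<Phi> A" and B: "good \<Psi> B"
  obtains h where "embedding Keq h (eqst \<Phi> A) (eqst \<Psi> B)"
    "\<forall>E\<in>\<E>. \<forall>a\<in>tuples (ar E) (car A). h (\<Phi> E a) = \<Psi> E (map k a)"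
proof -
  have Am: "A \<in> mods \<K>" and ki: "inj_on k (car A)" and ks: "strong \<K> (copy k A) B"
    using k by (auto simp: embedding_iff)
  note g = good_embedding[OF k B]
  from eqst_map[OF A g] obtain h where h: "inj_on h (car (eqst \<Phi> A))"
    "\<forall>E\<in>\<E>. \<forall>a\<in>tuples (ar E) (car A). h (\<Phi> E a) = \<Psi> E (map k a)" .
  have "copy h (eqst \<Phi> A) = eqst \<Psi> (copy k A)"
    by (rule copy_eqst_copy[OF Am A ki good_strong[OF ks B] h(1)]) (use h(2) in blast)
  then have "strong Keq (copy h (eqst \<Phi> A)) (eqst \<Psi> B)" using strong_Keq_eqst[OF ks B] by simp
  then have "embedding Keq h (eqst \<Phi> A) (eqst \<Psi> B)"
    unfolding embedding_Keq_iff using mods_Keq_eqst[OF Am A] h(1) by blast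
  then show thesis using h(2) that by blast
qed

lemma embedding_home:
  assumes h: "embedding Keq h (eqst \<Phi> A) (eqst \<Psi> B)" and A: "A \<in> mods \<K>" "good \<Phi> A"
    and B: "B \<in> mods \<K>" "good \<Psi> B"
  obtains k where "embedding \<K> k A B" "\<forall>x\<in>car A. hm \<Psi> (k x) = h (hm \<Phi> x)"
    "\<forall>E\<in>\<E>. \<forall>a\<in>tuples (ar E) (car A). h (\<Phi> E a) = \<Psi> E (map k a)"
proof -
  have i: "inj_on h (car (eqst \<Phi> A))" "strong Keq (copy h (eqst \<Phi> A)) (eqst \<Psi> B)"
    using h by (auto simp: embedding_Keq_iff)
  then obtain C where C: "strong \<K> C B" "copy h (eqst \<Phi> A) = eqst \<Psi> C"
    using strong_Keq[OF B] by blast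
  have "eqst (\<lambda>E a. h (\<Phi> E a)) A = eqst \<Psi> C" using copy_eqst[OF A i(1)] C(2) by simp
  from eqst_unique[OF A(1) good_comp[OF A(2) i(1)] strongD(1)[OF C(1)] good_strong[OF C(1) B(2)] this]
  obtain k where k: "inj_on k (car A)" "C = copy k A" "\<forall>x\<in>car A. hm \<Psi> (k x) = h (hm \<Phi> x)"
    "\<forall>E\<in>\<E>. \<forall>a\<in>tuples (ar E) (car A). h (\<Phi> E a) = \<Psi> E (map k a)" .
  have "embedding \<K> k A B" unfolding embedding_iff using A(1) k(1,2) C(1) by simp
  then show thesis using k(3,4) that by blast
qed

lemma car_home_sort:
  assumes "A \<in> mods \<K>" "good \<Phi> A" shows "car (home_sort M (eqst \<Phi> A)) = hm \<Phi> ` car A"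
  unfolding home_sort_eqst[OF assms] by simp

lemma home_sort_subset: "X \<in> mods Keq \<Longrightarrow> car (home_sort M X) \<subseteq> car X"
proof -
  assume "X \<in> mods Keq"
  then obtain A \<Phi> where A: "A \<in> mods \<K>" "good \<Phi> A" "X = eqst \<Phi> A" using mods_Keq by blast
  show ?thesis unfolding A(3) car_home_sort[OF A(1,2)] using hm_in[of _ A \<Phi>] by blast
qed

lemma good_copy:
  assumes k: "embedding \<K> k A (copy k A)" and g: "good (\<lambda>E a. \<Phi> E (map k a)) A"
  shows "good \<Phi> (copy k A)"
  unfolding good_def car_copy tuples_image
proof (intro ballI; elim imageE; clarify)
  fix E E' a b
  assume E: "E \<in> \<E>" "E' \<in> \<E>" and a: "a \<in> tuples (ar E) (car A)" and b: "b \<in> tuples (ar E') (car A)"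
  show "\<Phi> E (map k a) = \<Phi> E' (map k b) \<longleftrightarrow> E = E' \<and> (map k a, map k b) \<in> eq_on \<K> M E (copy k A)"
    using goodD[OF g E a b] eq_on_embedding[OF k tuplesD(2)[OF a] tuplesD(2)[OF b]] by simp
qed

text \<open>The naming is read off from the structure: the class of \<open>a\<close> is named by the
  value of F_E at the home elements that \<open>a\<close> stands for. The same formula can therefore
  serve all members of a chain.\<close>

lemma eqst_home_copy:
  fixes j :: "'a imag \<Rightarrow> 'a"
  assumes X: "X \<in> mods Keq" and j: "inj_on j (car (home_sort M X))"
    and i: "\<And>y. y \<in> car (home_sort M X) \<Longrightarrow> i (j y) = y"
    and \<Phi>: "\<And>E a. set a \<subseteq> j ` car (home_sort M X) \<Longrightarrow> \<Phi> E a = the (fni X (Inr E) (map i a))"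
  shows "copy j (home_sort M X) \<in> mods \<K>" "good \<Phi> (copy j (home_sort M X))"
    "X = eqst \<Phi> (copy j (home_sort M X))"
proof -
  obtain B \<Psi> where B: "B \<in> mods \<K>" "good \<Psi> B" and Xe: "X = eqst \<Psi> B" using X mods_Keq by blast
  note ch = car_home_sort[OF B, folded Xe] and hs = home_sort_eqst[OF B, folded Xe]
  define k where "k = j \<circ> hm \<Psi>"
  have jh: "inj_on j (hm \<Psi> ` car B)" using j ch by simp
  have c: "copy j (home_sort M X) = copy k B"
    unfolding hs k_def by (rule copy_copy[OF mods_struct[OF B(1)] hm_inj[OF B] jh])
  have k: "inj_on k (car B)" unfolding k_def by (rule comp_inj_on[OF hm_inj[OF B] jh])
  show "copy j (home_sort M X) \<in> mods \<K>" unfolding c by (rule mods_copy[OF B(1) k])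
  have eq: "\<Phi> E (map k a) = \<Psi> E a" if E: "E \<in> \<E>" and a: "a \<in> tuples (ar E) (car B)" for E a
  proof -
    have "set (map k a) \<subseteq> j ` car (home_sort M X)" unfolding ch k_def using tuplesD(2)[OF a] by auto
    moreover have "map i (map k a) = map (hm \<Psi>) a"
    proof -
      have "i (k x) = hm \<Psi> x" if "x \<in> set a" for x
      proof -
        have "hm \<Psi> x \<in> car (home_sort M X)" unfolding ch using that tuplesD(2)[OF a] by blast
        from i[OF this] show ?thesis by (simp add: k_def)
      qed
      then show ?thesis by simp
    qed
    ultimately have "\<Phi> E (map k a) = the (fni X (Inr E) (map (hm \<Psi>) a))" using \<Phi> by metis
    then show ?thesis unfolding Xe fni_eqst_Inr[OF B tuplesD(2)[OF a]] using E tuplesD(1)[OF a] by simp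
  qed
  have g: "good (\<lambda>E a. \<Phi> E (map k a)) B" by (rule good_cong[OF B(2) eq])
  show g': "good \<Phi> (copy j (home_sort M X))" unfolding c by (rule good_copy[OF embedding_copy[OF B(1) k] g])
  have "X = eqst \<Phi> (copy k B)" unfolding Xe by (rule eqst_copy[OF B k g'[unfolded c] eq[symmetric]])
  then show "X = eqst \<Phi> (copy j (home_sort M X))" unfolding c .
qed

text \<open>An imaginary of the union is named by a finite tuple, which lies in one member of the
  chain.\<close>

lemma union_eqst:
  assumes ne: "\<A> \<noteq> {}" and U: "\<And>A. A \<in> \<A> \<Longrightarrow> strong \<K> A U" "U \<in> mods \<K>" "car U = (\<Union>A\<in>\<A>. car A)"
    and ch: "\<And>A B. A \<in> \<A> \<Longrightarrow> B \<in> \<A> \<Longrightarrow> strong \<K> A B \<or> strong \<K> B A" and g: "good \<Phi> U"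
  shows "union_struct (eqst \<Phi> ` \<A>) = eqst \<Phi> U"
proof (rule union_substructures)
  show "is_struct LE (eqst \<Phi> U)" by (rule eqst_struct[OF U(2) g])
  show "substructure LE X (eqst \<Phi> U)" if "X \<in> eqst \<Phi> ` \<A>" for X
    using that substructure_eqst[OF U(1) g] by blast
  fix F assume F: "finite F" "F \<subseteq> car (eqst \<Phi> U)"
  have c: "car (eqst \<Phi> U) \<subseteq> (\<Union>X\<in>eqst \<Phi> ` \<A>. car X)"
  proof
    fix x assume "x \<in> car (eqst \<Phi> U)"
    then obtain E a where E: "E \<in> \<E>" and a: "a \<in> tuples (ar E) (car U)" and x: "x = \<Phi> E a" by (rule eqst_cases)
    have "\<exists>A\<in>\<A>. set a \<subseteq> car A"
    proof (rule chain_finite_subset[OF ne])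
      show "car A \<subseteq> car B \<or> car B \<subseteq> car A" if "A \<in> \<A>" "B \<in> \<A>" for A B
        using ch[OF that] strongD(4)[of A B] strongD(4)[of B A] by blast
      show "set a \<subseteq> (\<Union>A\<in>\<A>. car A)" using tuplesD(2)[OF a] U(3) by simp
    qed simp
    then obtain A where A: "A \<in> \<A>" "set a \<subseteq> car A" by blast
    then have "a \<in> tuples (ar E) (car A)" using a by (simp add: tuples_def)
    then have "x \<in> car (eqst \<Phi> A)" unfolding x by (rule in_eqst[OF E])
    then show "x \<in> (\<Union>X\<in>eqst \<Phi> ` \<A>. car X)" using A(1) by blast
  qed
  show "\<exists>X\<in>eqst \<Phi> ` \<A>. F \<subseteq> car X"
  proof (rule chain_finite_subset)
    show "eqst \<Phi> ` \<A> \<noteq> {}" using ne by simp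
    show "F \<subseteq> (\<Union>X\<in>eqst \<Phi> ` \<A>. car X)" using F(2) c by blast
    show "finite F" by fact
    fix X Y assume "X \<in> eqst \<Phi> ` \<A>" "Y \<in> eqst \<Phi> ` \<A>"
    then obtain A B where "A \<in> \<A>" "B \<in> \<A>" and XY: "X = eqst \<Phi> A" "Y = eqst \<Phi> B" by blast
    then have "car A \<subseteq> car B \<or> car B \<subseteq> car A"
      using ch[of A B] strongD(4)[of A B] strongD(4)[of B A] by blast
    then show "car X \<subseteq> car Y \<or> car Y \<subseteq> car X" unfolding XY using eqst_subset by metis
  qed
qed

lemma eqst_car_subset:
  assumes "strong \<K> A C" "strong \<K> B C" "good \<Phi> C" "car (eqst \<Phi> A) \<subseteq> car (eqst \<Phi> B)"
  shows "strong \<K> A B"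
proof (rule strong_subset[OF assms(1,2)])
  show "car A \<subseteq> car B"
  proof
    fix x assume x: "x \<in> car A"
    then have "x \<in> car C" using strongD(4)[OF assms(1)] by blast
    moreover have "hm \<Phi> x \<in> car (eqst \<Phi> B)" using hm_in[OF x, of \<Phi>] assms(4) by blast
    ultimately show "x \<in> car B" using hm_mem[OF assms(2,3)] by blast
  qed
qed

text \<open>The members come with unrelated home structures. Regularity of \<open>\<kappa>\<close>
  keeps the union of their home sorts small enough to be injected into \<open>'a\<close>, which
  gives compatible home structures and one naming for the whole chain.\<close>

lemma chain_union_Keq:
  assumes ne: "\<C> \<noteq> {}" and mods: "\<C> \<subseteq> mods Keq" and card: "|\<C>| <o \<kappa>"
    and wo: "\<And>\<S>. \<S> \<subseteq> \<C> \<Longrightarrow> \<S> \<noteq> {} \<Longrightarrow> \<exists>A\<in>\<S>. \<forall>B\<in>\<S>. strong Keq A B"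
  shows "union_struct \<C> \<in> mods Keq" "\<And>X. X \<in> \<C> \<Longrightarrow> strong Keq X (union_struct \<C>)"
    "\<And>N. (\<And>X. X \<in> \<C> \<Longrightarrow> strong Keq X N) \<Longrightarrow> strong Keq (union_struct \<C>) N"
proof -
  let ?H = "\<lambda>X. car (home_sort M X)"
  have lin: "strong Keq X Y \<or> strong Keq Y X" if "X \<in> \<C>" "Y \<in> \<C>" for X Y
    by (rule chain_linear[OF wo that])
  have "|?H X| <o \<kappa>" if X: "X \<in> \<C>" for X
  proof -
    obtain A \<Phi> where A: "A \<in> mods \<K>" "good \<Phi> A" and Xe: "X = eqst \<Phi> A" using X mods mods_Keq by blast
    show ?thesis unfolding Xe car_home_sort[OF A] by (rule image_less_kappa[OF mods_card[OF A(1)]])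
  qed
  then have "|\<Union>X\<in>\<C>. ?H X| <o \<kappa>" by (rule UN_less_kappa[OF card])
  from room[OF this] obtain j :: "'a imag \<Rightarrow> 'a" where j: "inj_on j (\<Union>X\<in>\<C>. ?H X)" .
  define i where "i = inv_into (\<Union>X\<in>\<C>. ?H X) j"
  \<comment> \<open>F_E of the union, read through \<open>i\<close>. Along a chain of substructures
    it agrees with F_E of every member.\<close>
  define \<Phi> where "\<Phi> E a = the (fni (union_struct \<C>) (Inr E) (map i a))" for E a
  define \<alpha> where "\<alpha> X = copy j (home_sort M X)" for X
  have jX: "inj_on j (?H X)" if "X \<in> \<C>" for X by (rule inj_on_subset[OF j]) (use that in blast)
  have ij: "i (j y) = y" if "X \<in> \<C>" "y \<in> ?H X" for X y
    unfolding i_def by (rule inv_into_f_f[OF j]) (use that in blast)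
  have sub: "substructure LE X Y \<or> substructure LE Y X" if "X \<in> \<C>" "Y \<in> \<C>" for X Y
    using lin[OF that] strong_Keq_D(3) by blast
  have \<Phi>X: "\<Phi> E a = the (fni X (Inr E) (map i a))" if X: "X \<in> \<C>" and a: "set a \<subseteq> j ` ?H X" for X E a
  proof -
    have "set (map i a) \<subseteq> ?H X" using a ij[OF X] by auto
    then have "set (map i a) \<subseteq> car X" using home_sort_subset X mods by blast
    from union_chain_fni[of \<C> LE, OF sub X this] show ?thesis unfolding \<Phi>_def by simp
  qed
  have \<alpha>: "\<alpha> X \<in> mods \<K>" "good \<Phi> (\<alpha> X)" "X = eqst \<Phi> (\<alpha> X)" if X: "X \<in> \<C>" for X unfolding \<alpha>_def
    by (rule eqst_home_copy[OF subsetD[OF mods X] jX[OF X] ij[OF X] \<Phi>X[OF X]], assumption+)+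
  have \<alpha>s: "strong \<K> (\<alpha> X) (\<alpha> Y)" if "X \<in> \<C>" "Y \<in> \<C>" "strong Keq X Y" for X Y
    unfolding \<alpha>_def by (rule strong_copy_transfer[OF strong_Keq_D(4)[OF that(3)] jX[OF that(2)]])
  let ?\<A> = "\<alpha> ` \<C>"
  have wo\<A>: "\<exists>A\<in>\<S>. \<forall>B\<in>\<S>. strong \<K> A B" if \<S>: "\<S> \<subseteq> ?\<A>" "\<S> \<noteq> {}" for \<S>
  proof -
    let ?T = "{X \<in> \<C>. \<alpha> X \<in> \<S>}"
    have "?T \<noteq> {}" "?T \<subseteq> \<C>" using \<S> by blast+
    then obtain X where X: "X \<in> ?T" "\<forall>Y\<in>?T. strong Keq X Y" using wo by blast
    have "\<forall>B\<in>\<S>. strong \<K> (\<alpha> X) B"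
    proof
      fix B assume B: "B \<in> \<S>"
      then obtain Y where Y: "Y \<in> ?T" "B = \<alpha> Y" using \<S>(1) by blast
      then show "strong \<K> (\<alpha> X) B" using X \<alpha>s[of X Y] by blast
    qed
    then show ?thesis using X(1) by blast
  qed
  have ne\<A>: "?\<A> \<noteq> {}" "?\<A> \<subseteq> mods \<K>" "|?\<A>| <o \<kappa>" using ne \<alpha>(1) image_less_kappa[OF card] by auto
  note un = chain_union[OF ne\<A> wo\<A>]
  let ?U = "union_struct ?\<A>"
  have carU: "car ?U = (\<Union>A\<in>?\<A>. car A)" by (simp add: union_struct_def)
  have lin\<A>: "strong \<K> A B \<or> strong \<K> B A" if "A \<in> ?\<A>" "B \<in> ?\<A>" for A B
    by (rule chain_linear[OF wo\<A> that])
  have gU: "good \<Phi> ?U" unfolding good_def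
  proof (intro ballI)
    fix E E' a b
    assume E: "E \<in> \<E>" "E' \<in> \<E>" and a: "a \<in> tuples (ar E) (car ?U)" and b: "b \<in> tuples (ar E') (car ?U)"
    have "\<exists>A\<in>?\<A>. set a \<union> set b \<subseteq> car A"
    proof (rule chain_finite_subset[OF ne\<A>(1)])
      show "car A \<subseteq> car B \<or> car B \<subseteq> car A" if "A \<in> ?\<A>" "B \<in> ?\<A>" for A B
        using lin\<A>[OF that] strongD(4)[of A B] strongD(4)[of B A] by blast
      show "set a \<union> set b \<subseteq> (\<Union>A\<in>?\<A>. car A)" using tuplesD(2)[OF a] tuplesD(2)[OF b] unfolding carU by blast
    qed simp
    then obtain X where X: "X \<in> \<C>" "set a \<subseteq> car (\<alpha> X)" "set b \<subseteq> car (\<alpha> X)" by auto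
    have "a \<in> tuples (ar E) (car (\<alpha> X))" "b \<in> tuples (ar E') (car (\<alpha> X))"
      using X a b by (auto simp: tuples_def)
    note g = goodD[OF \<alpha>(2)[OF X(1)] E this]
    have "strong \<K> (\<alpha> X) ?U" using un(2) X(1) by blast
    from eq_on_embedding[OF embedding_incl[OF this] X(2,3)] g
    show "\<Phi> E a = \<Phi> E' b \<longleftrightarrow> E = E' \<and> (a, b) \<in> eq_on \<K> M E ?U" by simp
  qed
  have C: "\<C> = eqst \<Phi> ` ?\<A>" using \<alpha>(3) by (auto simp: image_image)
  have uC: "union_struct \<C> = eqst \<Phi> ?U"
    using union_eqst[OF ne\<A>(1) un(2) un(1) carU lin\<A> gU] C by simp
  show "union_struct \<C> \<in> mods Keq" unfolding uC by (rule mods_Keq_eqst[OF un(1) gU])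
  show "strong Keq X (union_struct \<C>)" if X: "X \<in> \<C>" for X
    unfolding uC using strong_Keq_eqst[OF un(2) gU, of "\<alpha> X"] \<alpha>(3)[OF X] X by auto
  \<comment> \<open>For an upper bound the chain is presented a second time, now with the naming
    \<open>\<Psi>\<close> of \<open>N\<close>, so that the members come from strong submodels of
    \<open>D\<close>.\<close>
  fix N assume N: "\<And>X. X \<in> \<C> \<Longrightarrow> strong Keq X N"
  obtain X0 where "X0 \<in> \<C>" using ne by blast
  then obtain D \<Psi> where D: "D \<in> mods \<K>" "good \<Psi> D" "N = eqst \<Psi> D"
    using strong_Keq_D(2)[OF N] mods_Keq by blast
  let ?B = "{A. strong \<K> A D \<and> eqst \<Psi> A \<in> \<C>}"
  have "X \<in> eqst \<Psi> ` ?B" if X: "X \<in> \<C>" for X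
  proof -
    obtain A where "strong \<K> A D" "X = eqst \<Psi> A"
      using N[OF X] strong_Keq[OF D(1,2), of X] unfolding D(3) by blast
    then show ?thesis using X by blast
  qed
  then have CB: "\<C> = eqst \<Psi> ` ?B" by blast
  have Bs: "strong \<K> A B" if "A \<in> ?B" "B \<in> ?B" "strong Keq (eqst \<Psi> A) (eqst \<Psi> B)" for A B
    using eqst_car_subset[OF _ _ D(2) substructureD(3)[OF strong_Keq_D(3)[OF that(3)]]] that(1,2) by blast
  \<comment> \<open>Injectivity bounds the number of home models by the size of the given chain, as
    the chain axiom of \<open>\<K>\<close> requires.\<close>
  have injB: "inj_on (eqst \<Psi>) ?B"
  proof (rule inj_onI)
    fix A B assume AB: "A \<in> ?B" "B \<in> ?B" "eqst \<Psi> A = eqst \<Psi> B"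
    then have "strong Keq (eqst \<Psi> A) (eqst \<Psi> B)" "strong Keq (eqst \<Psi> B) (eqst \<Psi> A)"
      using lin[of "eqst \<Psi> A" "eqst \<Psi> B"] by auto
    then have "car A = car B" using Bs[OF AB(1,2)] Bs[OF AB(2,1)] strongD(4) by blast
    then show "A = B" using strong_eq[of A D B] AB(1,2) by blast
  qed
  have woB: "\<exists>A\<in>\<S>. \<forall>B\<in>\<S>. strong \<K> A B" if \<S>: "\<S> \<subseteq> ?B" "\<S> \<noteq> {}" for \<S>
  proof -
    have "eqst \<Psi> ` \<S> \<subseteq> \<C>" "eqst \<Psi> ` \<S> \<noteq> {}" using \<S> by blast+
    from wo[OF this] obtain A where A: "A \<in> \<S>" "\<forall>Y\<in>eqst \<Psi> ` \<S>. strong Keq (eqst \<Psi> A) Y" by blast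
    have "\<forall>B\<in>\<S>. strong \<K> A B" using A \<S>(1) Bs by blast
    then show ?thesis using A(1) by blast
  qed
  have "|?B| \<le>o |\<C>|" unfolding card_of_ordLeq[symmetric] using injB by blast
  then have cB: "|?B| <o \<kappa>" using card ordLeq_ordLess_trans by blast
  have neB: "?B \<noteq> {}" using ne CB by blast
  have mB: "?B \<subseteq> mods \<K>" using strongD(1) by blast
  note unB = chain_union[OF neB mB cB woB]
  have UD: "strong \<K> (union_struct ?B) D" by (rule unB(3)) auto
  have "union_struct (eqst \<Psi> ` ?B) = eqst \<Psi> (union_struct ?B)"
  proof (rule union_eqst[OF neB unB(2) unB(1) _ _ good_strong[OF UD D(2)]])
    show "car (union_struct ?B) = (\<Union>A\<in>?B. car A)" by (simp add: union_struct_def)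
    show "strong \<K> A B \<or> strong \<K> B A" if "A \<in> ?B" "B \<in> ?B" for A B
      by (rule chain_linear[OF woB that])
  qed
  then show "strong Keq (union_struct \<C>) N" using strong_Keq_eqst[OF UD D(2)] CB D(3) by simp
qed

section \<open>Loewenheim-Skolem numbers\<close>

lemma LS_Keq:
  assumes X: "X \<in> mods Keq" and Z: "Z \<subseteq> car X"
  shows "\<exists>Y. strong Keq Y X \<and> Z \<subseteq> car Y \<and> |car Y| \<le>o |Z| +c natLeq"
proof -
  obtain A \<Phi> where A: "A \<in> mods \<K>" "good \<Phi> A" and Xe: "X = eqst \<Phi> A" using X mods_Keq by blast
  have "\<forall>z\<in>Z. \<exists>a. set a \<subseteq> car A \<and> (\<exists>E\<in>\<E>. length a = ar E \<and> z = \<Phi> E a)"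
  proof
    fix z assume "z \<in> Z"
    then have "z \<in> car (eqst \<Phi> A)" using Z Xe by blast
    then obtain E a where "E \<in> \<E>" "a \<in> tuples (ar E) (car A)" "z = \<Phi> E a" by (rule eqst_cases)
    then show "\<exists>a. set a \<subseteq> car A \<and> (\<exists>E\<in>\<E>. length a = ar E \<and> z = \<Phi> E a)" by (auto simp: tuples_def)
  qed
  then obtain l where l: "\<And>z. z \<in> Z \<Longrightarrow> set (l z) \<subseteq> car A"
    "\<And>z. z \<in> Z \<Longrightarrow> \<exists>E\<in>\<E>. length (l z) = ar E \<and> z = \<Phi> E (l z)" by metis
  \<comment> \<open>\<open>l z\<close> is a chosen finite lift of \<open>z\<close>, so the home
    elements needed for \<open>Z\<close> are at most |Z| + \<omega> in number.\<close>
  let ?W = "\<Union>z\<in>Z. set (l z)" and ?r = "|Z| +c natLeq"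
  have r: "Cinfinite ?r" using Cinfinite_csum natLeq_Cinfinite by blast
  have nr: "natLeq \<le>o ?r" by (rule ordLeq_csum2[OF natLeq_Card_order])
  have "|?W| \<le>o ?r"
  proof (rule UNION_Cinfinite_bound[OF _ _ r])
    show "|Z| \<le>o ?r" by (rule ordLeq_csum1[OF card_of_Card_order])
    show "\<forall>z\<in>Z. |set (l z)| \<le>o ?r"
    proof
      fix z assume "z \<in> Z"
      have "|set (l z)| \<le>o natLeq" using countable_iff_ordLeq countable_finite by blast
      then show "|set (l z)| \<le>o ?r" using nr ordLeq_transitive by blast
    qed
  qed
  moreover have "?W \<subseteq> car A" using l(1) by blast
  then obtain B where B: "strong \<K> B A" "?W \<subseteq> car B" "|car B| \<le>o |?W| +c natLeq" using LS[OF A(1)] by blast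
  ultimately have "|car B| \<le>o ?r"
    using csum_cinfinite_bound[OF _ nr card_of_Card_order natLeq_Card_order r] ordLeq_transitive by blast
  then have "|car (eqst \<Phi> B)| \<le>o ?r" using card_eqst_le[OF strongD(1)[OF B(1)], of \<Phi>] ordLeq_transitive by blast
  moreover have "Z \<subseteq> car (eqst \<Phi> B)"
  proof
    fix z assume z: "z \<in> Z"
    then obtain E where E: "E \<in> \<E>" "length (l z) = ar E" "z = \<Phi> E (l z)" using l(2) by blast
    have "l z \<in> tuples (ar E) (car B)" using E(2) B(2) z by (auto simp: tuples_def)
    then show "z \<in> car (eqst \<Phi> B)" using in_eqst[OF E(1), of "l z" B \<Phi>] E(3) by simp
  qed
  moreover have "strong Keq (eqst \<Phi> B) X" unfolding Xe by (rule strong_Keq_eqst[OF B(1) A(2)])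
  ultimately show ?thesis by blast
qed

lemma LS_bound_Keq: "LS_bound Keq natLeq"
proof -
  have "countable (funs L)" "countable (rels L)" using LSb unfolding LS_bound_def countable_iff_ordLeq by auto
  then have "countable (funs LE)" "countable (rels LE)" using countable_E by (auto simp: eq_voc_def)
  then show ?thesis unfolding LS_bound_def voc_Keq
    using natLeq_Cinfinite LS_Keq by (auto simp: countable_iff_ordLeq)
qed

text \<open>\<open>aec\<close> asks for a bound of the type of \<open>\<kappa>\<close>, while
  \<open>natLeq\<close> is a relation on the natural numbers. The cardinal \<open>\<delta>\<close>
  lies above it, is below \<open>\<kappa>\<close> and has the right type.\<close>

lemma LS_bound_delta: "LS_bound Keq \<delta>"
proof -
  have n: "natLeq \<le>o \<delta>" using ordLess_imp_ordLeq[OF delta(2)] .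
  have c: "cinfinite \<delta>" using cinfinite_mono[OF n natLeq_cinfinite] .
  have "|funs LE| \<le>o \<delta>" "|rels LE| \<le>o \<delta>"
    using LS_bound_Keq n ordLeq_transitive unfolding LS_bound_def voc_Keq by blast+
  moreover have "\<exists>Y. strong Keq Y X \<and> Z \<subseteq> car Y \<and> |car Y| \<le>o |Z| +c \<delta>"
    if "X \<in> mods Keq" "Z \<subseteq> car X" for X Z
    using LS_Keq[OF that] csum_mono2[OF n, of "|Z|"] ordLeq_transitive by blast
  ultimately show ?thesis unfolding LS_bound_def voc_Keq using delta(1) c by blast
qed

lemma strong_Keq_trans:
  assumes "strong Keq X Y" "strong Keq Y Z" shows "strong Keq X Z"
proof -
  obtain B C \<Phi> where B: "strong \<K> B C" "good \<Phi> C" "Y = eqst \<Phi> B" "Z = eqst \<Phi> C"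
    using strong_Keq_obtain[OF assms(2)] .
  obtain A where A: "strong \<K> A B" "X = eqst \<Phi> A"
    using strong_Keq[OF strongD(1)[OF B(1)] good_strong[OF B(1,2)]] assms(1) B(3) by blast
  show ?thesis unfolding A(2) B(4) by (rule strong_Keq_eqst[OF strong_trans[OF A(1) B(1)] B(2)])
qed

lemma strong_Keq_subset:
  assumes "strong Keq X Z" "strong Keq Y Z" "car X \<subseteq> car Y" shows "strong Keq X Y"
proof -
  obtain B C \<Phi> where B: "strong \<K> B C" "good \<Phi> C" "Y = eqst \<Phi> B" "Z = eqst \<Phi> C"
    using strong_Keq_obtain[OF assms(2)] .
  obtain A where A: "strong \<K> A C" "X = eqst \<Phi> A"
    using strong_Keq[OF strongD(2)[OF B(1)] B(2)] assms(1) B(4) by blast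
  show ?thesis using assms(3) unfolding A(2) B(3)
    using eqst_car_subset[OF A(1) B(1,2)] strong_Keq_eqst good_strong[OF B(1,2)] by blast
qed

lemma strong_Keq_iso:
  assumes "strong Keq X Y" "iso LE h Y Y'" "iso LE h X X'" shows "strong Keq X' Y'"
proof -
  obtain A B \<Phi> where B: "strong \<K> A B" "good \<Phi> B" "X = eqst \<Phi> A" "Y = eqst \<Phi> B"
    using strong_Keq_obtain[OF assms(1)] .
  note Y' = iso_eqst[OF strongD(2)[OF B(1)] B(2) assms(2)[unfolded B(4)]]
  note X' = iso_eqst[OF strongD(1)[OF B(1)] good_strong[OF B(1,2)] assms(3)[unfolded B(3)]]
  show ?thesis unfolding X'(2) Y'(2) by (rule strong_Keq_eqst[OF B(1) Y'(1)])
qed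

lemma mods_Keq_iso:
  assumes "X \<in> mods Keq" "iso LE h X Y" shows "Y \<in> mods Keq"
proof -
  obtain A \<Phi> where A: "A \<in> mods \<K>" "good \<Phi> A" and Xe: "X = eqst \<Phi> A" using assms(1) mods_Keq by blast
  note Y = iso_eqst[OF A assms(2)[unfolded Xe]]
  show ?thesis unfolding Y(2) by (rule mods_Keq_eqst[OF A(1) Y(1)])
qed

lemma mods_Keq_card: "X \<in> mods Keq \<Longrightarrow> |car X| <o \<kappa>" using mods_Keq card_eqst_less mods_card by metis

lemma strong_Keq_refl: "X \<in> mods Keq \<Longrightarrow> strong Keq X X"
  using mods_Keq strong_Keq_eqst strong_refl by metis

lemma aec_Keq: "aec \<kappa> Keq" unfolding aec_def voc_Keq
proof (intro conjI allI impI ballI, goal_cases)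
  case (1 A) then show ?case by (rule mods_Keq_struct)
next
  case (2 A) then show ?case by (rule mods_Keq_card)
next
  case (3 A B) then show ?case by (rule strong_Keq_D)
next
  case (4 A B) then show ?case by (rule strong_Keq_D)
next
  case (5 A B) then show ?case by (rule strong_Keq_D)
next
  case (6 A) then show ?case by (rule strong_Keq_refl)
next
  case (7 A B C) then show ?case by (rule strong_Keq_trans)
next
  case (8 A B h) then show ?case by (rule mods_Keq_iso)
next
  case (9 A B A' B' h) then show ?case by (rule strong_Keq_iso)
next
  case (10 A B C) then show ?case by (rule strong_Keq_subset)
next
  case (11 \<C>) show ?case by (rule chain_union_Keq(1)[OF 11(1-3)]) (use 11(4) in blast)
next
  case (12 \<C> A) show ?case by (rule chain_union_Keq(2)[OF 12(1-3) _ 12(5)]) (use 12(4) in blast)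
next
  case (13 \<C> N) show ?case by (rule chain_union_Keq(3)[OF 13(1-3)]) (use 13(4,5) in blast)+
next
  case 14 show ?case using LS_bound_delta delta(3) by blast
qed

section \<open>Amalgamation, joint embedding and large members\<close>

lemma amalgamation_Keq: "amalgamation Keq" unfolding amalgamation_def
proof (intro allI impI)
  fix X Y Z assume XY: "strong Keq X Y" and XZ: "strong Keq X Z"
  obtain A B \<Psi> where B: "strong \<K> A B" "good \<Psi> B" "X = eqst \<Psi> A" "Y = eqst \<Psi> B"
    using strong_Keq_obtain[OF XY] .
  obtain A' C \<Theta> where C: "strong \<K> A' C" "good \<Theta> C" "X = eqst \<Theta> A'" "Z = eqst \<Theta> C"
    using strong_Keq_obtain[OF XZ] .
  note gA = good_strong[OF B(1,2)]
  have "eqst \<Psi> A = eqst \<Theta> A'" using B(3) C(3) by simp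
  \<comment> \<open>\<open>X\<close> is presented once inside \<open>Y\<close> and once inside
    \<open>Z\<close>. The bijection \<open>k\<close> of its two home structures turns the problem
    into amalgamation over \<open>A\<close> with \<open>k\<close> as one of the embeddings.\<close>
  from eqst_unique[OF strongD(1)[OF B(1)] gA strongD(1)[OF C(1)] good_strong[OF C(1,2)] this]
  obtain k where k: "inj_on k (car A)" "A' = copy k A" "\<forall>x\<in>car A. hm \<Theta> (k x) = hm \<Psi> x"
    "\<forall>E\<in>\<E>. \<forall>a\<in>tuples (ar E) (car A). \<Psi> E a = \<Theta> E (map k a)" .
  have kC: "embedding \<K> k A C" unfolding embedding_iff using strongD(1)[OF B(1)] k(1,2) C(1) by simp
  from amalgamation_embeddings[OF embedding_incl[OF B(1)] kC]
  obtain D p q where D: "embedding \<K> p B D" "embedding \<K> q C D" "\<forall>x\<in>car A. p x = q (k x)" .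
  have Dm: "D \<in> mods \<K>" using D(1) strongD(2) by (auto simp: embedding_iff)
  note gD = good_imag[OF Dm]
  from embedding_lift[OF D(1) B(2) gD] obtain f where f: "embedding Keq f (eqst \<Psi> B) (eqst (imag \<K> M D) D)"
    "\<forall>E\<in>\<E>. \<forall>a\<in>tuples (ar E) (car B). f (\<Psi> E a) = imag \<K> M D E (map p a)" .
  from embedding_lift[OF D(2) C(2) gD] obtain g where g: "embedding Keq g (eqst \<Theta> C) (eqst (imag \<K> M D) D)"
    "\<forall>E\<in>\<E>. \<forall>a\<in>tuples (ar E) (car C). g (\<Theta> E a) = imag \<K> M D E (map q a)" .
  have "f x = g x" if xX: "x \<in> car X" for x
  proof -
    obtain E a where E: "E \<in> \<E>" and a: "a \<in> tuples (ar E) (car A)" and x: "x = \<Psi> E a"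
      using eqst_cases[OF xX[unfolded B(3)]] .
    have aB: "a \<in> tuples (ar E) (car B)" using a tuples_mono[OF strongD(4)[OF B(1)]] by blast
    have aC: "map k a \<in> tuples (ar E) (car C)" by (rule map_in_tuples[OF a embedding_image[OF kC]])
    have "f x = imag \<K> M D E (map p a)" unfolding x using f(2) E aB by blast
    also have "map p a = map q (map k a)" using D(3) tuplesD(2)[OF a] by auto
    also have "imag \<K> M D E (map q (map k a)) = g (\<Theta> E (map k a))" using g(2) E aC by simp
    also have "\<Theta> E (map k a) = x" unfolding x using k(4) E a by simp
    finally show ?thesis .
  qed
  then show "\<exists>D\<in>mods Keq. \<exists>f g. embedding Keq f Y D \<and> embedding Keq g Z D \<and> (\<forall>x\<in>car X. f x = g x)"
    using mods_Keq_eqst[OF Dm gD] f(1) g(1) unfolding B(4) C(4) by blast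
qed

lemma joint_embedding_Keq: "joint_embedding Keq" unfolding joint_embedding_def
proof (intro ballI)
  fix X Y assume "X \<in> mods Keq" "Y \<in> mods Keq"
  then obtain A \<Phi> B \<Psi> where A: "A \<in> mods \<K>" "good \<Phi> A" "X = eqst \<Phi> A"
    and B: "B \<in> mods \<K>" "good \<Psi> B" "Y = eqst \<Psi> B" using mods_Keq by metis
  obtain D f g where D: "D \<in> mods \<K>" "embedding \<K> f A D" "embedding \<K> g B D"
    using joint A(1) B(1) unfolding joint_embedding_def by blast
  note gD = good_imag[OF D(1)]
  from embedding_lift[OF D(2) A(2) gD] embedding_lift[OF D(3) B(2) gD]
  show "\<exists>D\<in>mods Keq. \<exists>f g. embedding Keq f X D \<and> embedding Keq g Y D"
    using mods_Keq_eqst[OF D(1) gD] unfolding A(3) B(3) by metis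
qed

lemma arbitrarily_large_Keq: "arbitrarily_large \<kappa> Keq" unfolding arbitrarily_large_def
proof (intro allI impI)
  fix X :: "'k set" assume "|X| <o \<kappa>"
  then obtain A where A: "A \<in> mods \<K>" "|X| \<le>o |car A|" using arb unfolding arbitrarily_large_def by blast
  have "|X| \<le>o |car (eqst (imag \<K> M A) A)|"
    by (rule ordLeq_transitive[OF A(2) card_eqst_ge[OF A(1) good_imag[OF A(1)]]])
  then show "\<exists>A\<in>mods Keq. |X| \<le>o |car A|" using mods_Keq_eqst[OF A(1) good_imag[OF A(1)]] by blast
qed

lemma infinite_Keq: "X \<in> mods Keq \<Longrightarrow> infinite (car X)"
  using mods_Keq mods_infinite card_eqst_ge card_of_ordLeq_infinite by metis

section \<open>The monster model of imaginaries\<close>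

abbreviation "Im \<equiv> imag \<K> M M"
abbreviation "N \<equiv> eqst Im M"
abbreviation "\<eta> \<equiv> hm Im"

lemma good_Im: "good Im M" by (rule good_imag[OF M_mods])

lemma N_struct: "is_struct LE N" by (rule eqst_struct[OF M_mods good_Im])

text \<open>The imaginaries with a representative in \<open>X\<close>. For a model this is the
  carrier of its structure of imaginaries, but \<open>X\<close> may be any set; finite sets serve as
  parameters.\<close>

definition up :: "'a set \<Rightarrow> 'a imag set" where
  "up X = {Im E a | E a. E \<in> \<E> \<and> a \<in> tuples (ar E) X}"

definition lifts_on :: "'a set \<Rightarrow> ('a \<Rightarrow> 'a) \<Rightarrow> ('a imag \<Rightarrow> 'a imag) \<Rightarrow> bool" where
  "lifts_on X k h \<longleftrightarrow> (\<forall>E\<in>\<E>. \<forall>a\<in>tuples (ar E) X. h (Im E a) = Im E (map k a))"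

abbreviation "lifts \<equiv> lifts_on (car M)"

lemma car_up: "car (eqst Im A) = up (car A)" by (simp add: car_eqst up_def)

lemma up_mono: "X \<subseteq> Y \<Longrightarrow> up X \<subseteq> up Y" unfolding up_def using tuples_mono[of X Y] by blast

lemma in_up: "E \<in> \<E> \<Longrightarrow> a \<in> tuples (ar E) X \<Longrightarrow> Im E a \<in> up X" unfolding up_def by blast

lemma eta_in_up: "x \<in> X \<Longrightarrow> \<eta> x \<in> up X" by (rule in_up[OF id_in_E singleton_in_tuples])

lemma eta_subset_up: "\<eta> ` X \<subseteq> up X" using eta_in_up by blast

lemma map_eta_in_up: "set a \<subseteq> X \<Longrightarrow> set (map \<eta> a) \<subseteq> up X" using eta_in_up[of _ X] by auto

lemma eta_inj: "inj_on \<eta> (car M)" by (rule hm_inj[OF M_mods good_Im])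

text \<open>Representatives are finite tuples. Because of this, weak types over \<open>up X\<close>,
  which are tested on finite sets, are controlled by finite subsets of \<open>X\<close>.\<close>

lemma up_finite:
  assumes "finite Y" "Y \<subseteq> up X"
  shows "\<exists>Z\<subseteq>X. finite Z \<and> Y \<subseteq> up Z"
  using assms
proof (induction Y)
  case empty show ?case by blast
next
  case (insert y Y)
  then obtain Z where Z: "Z \<subseteq> X" "finite Z" "Y \<subseteq> up Z" by auto
  obtain E a where E: "E \<in> \<E>" "a \<in> tuples (ar E) X" "y = Im E a" using insert.prems unfolding up_def by blast
  have "y \<in> up (Z \<union> set a)" unfolding E(3) by (rule in_up[OF E(1)]) (use E(2) in \<open>simp add: tuples_def\<close>)
  moreover have "Y \<subseteq> up (Z \<union> set a)" using Z(3) up_mono[of Z "Z \<union> set a"] by blast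
  ultimately show ?case using Z(1,2) tuplesD(2)[OF E(2)] by (intro exI[of _ "Z \<union> set a"]) simp
qed

lemma lifts_eta: "lifts_on X k h \<Longrightarrow> x \<in> X \<Longrightarrow> h (\<eta> x) = \<eta> (k x)"
  unfolding lifts_on_def using id_in_E singleton_in_tuples[of x X] by fastforce

lemma lifts_map_eta: "lifts_on X k h \<Longrightarrow> set a \<subseteq> X \<Longrightarrow> map h (map \<eta> a) = map \<eta> (map k a)"
  using lifts_eta[of X k h] by auto

lemma lifts_on_mono: "lifts_on X k h \<Longrightarrow> Y \<subseteq> X \<Longrightarrow> lifts_on Y k h"
  unfolding lifts_on_def using tuples_mono[of Y X] by blast

lemma lifts_on_up:
  assumes "lifts_on X k h"
  shows "h ` up X = up (k ` X)"
proof
  show "h ` up X \<subseteq> up (k ` X)"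
  proof (rule image_subsetI)
    fix x assume "x \<in> up X"
    then obtain E a where E: "E \<in> \<E>" "a \<in> tuples (ar E) X" "x = Im E a" unfolding up_def by blast
    then have "h x = Im E (map k a)" using assms unfolding lifts_on_def by blast
    then show "h x \<in> up (k ` X)" using in_up[OF E(1) map_in_tuples[OF E(2) order_refl]] by simp
  qed
  show "up (k ` X) \<subseteq> h ` up X"
  proof
    fix y assume "y \<in> up (k ` X)"
    then obtain E b where E: "E \<in> \<E>" "b \<in> tuples (ar E) (k ` X)" "y = Im E b" unfolding up_def by blast
    then obtain a where a: "a \<in> tuples (ar E) X" "b = map k a" unfolding tuples_image by blast
    then have "y = h (Im E a)" using assms E(1,3) unfolding lifts_on_def by simp
    then show "y \<in> h ` up X" using in_up[OF E(1) a(1)] by blast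
  qed
qed

lemma Aut_lift:
  assumes k: "k \<in> Aut L M B" and B: "B \<subseteq> car M"
  obtains h where "h \<in> Aut LE N (up B)" "lifts k h"
proof -
  have ki: "inj_on k (car M)" "copy k M = M" "\<forall>x\<in>B. k x = x" using k Aut_iff[OF M_struct] by blast+
  have kM: "embedding \<K> k M M" using embedding_copy[OF M_mods ki(1)] ki(2) by simp
  note g = good_embedding[OF kM good_Im]
  from eqst_map[OF good_Im g] obtain h where h: "inj_on h (car N)"
    "\<forall>E\<in>\<E>. \<forall>a\<in>tuples (ar E) (car M). h (Im E a) = Im E (map k a)" .
  have "copy h N = N"
    using copy_eqst_copy[OF M_mods good_Im ki(1) _ h(1), of Im] h(2) good_Im unfolding ki(2) by blast
  moreover have "h x = x" if xB: "x \<in> up B" for x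
  proof -
    obtain E a where E: "E \<in> \<E>" and a: "a \<in> tuples (ar E) B" and x: "x = Im E a"
      using xB unfolding up_def by blast
    have "map k a = a" by (rule Aut_map_fix[OF k tuplesD(2)[OF a]])
    moreover have "a \<in> tuples (ar E) (car M)" using a tuples_mono[OF B] by blast
    ultimately show ?thesis using h(2) E unfolding x by simp
  qed
  ultimately have "h \<in> Aut LE N (up B)" unfolding Aut_iff[OF N_struct] using h(1) by blast
  then show thesis using that h(2) unfolding lifts_on_def by blast
qed

text \<open>Only home elements whose copies lie in \<open>X\<close> are certain to stay fixed, since
  fixing an imaginary does not fix its representatives. \<open>Aut_lift\<close> has no such
  loss.\<close>

lemma Aut_home:
  assumes h: "h \<in> Aut LE N X"
  obtains k where "k \<in> Aut L M {x \<in> car M. \<eta> x \<in> X}" "lifts k h"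
proof -
  have hi: "inj_on h (car N)" "copy h N = N" "\<forall>x\<in>X. h x = x" using h Aut_iff[OF N_struct] by blast+
  have "eqst (\<lambda>E a. h (Im E a)) M = N" using copy_eqst[OF M_mods good_Im hi(1)] hi(2) by simp
  from eqst_unique[OF M_mods good_comp[OF good_Im hi(1)] M_mods good_Im this]
  obtain k where k: "inj_on k (car M)" "M = copy k M" "\<forall>x\<in>car M. \<eta> (k x) = h (\<eta> x)"
    "\<forall>E\<in>\<E>. \<forall>a\<in>tuples (ar E) (car M). h (Im E a) = Im E (map k a)" .
  have kM: "k ` car M = car M" using k(2) car_copy by metis
  have "k x = x" if x: "x \<in> car M" "\<eta> x \<in> X" for x
  proof -
    have "\<eta> (k x) = \<eta> x" using k(3) hi(3) x by simp
    moreover have "k x \<in> car M" using kM x(1) by blast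
    ultimately show ?thesis using inj_onD[OF eta_inj] x(1) by blast
  qed
  then have "k \<in> Aut L M {x \<in> car M. \<eta> x \<in> X}" unfolding Aut_iff[OF M_struct] using k(1,2) by simp
  then show thesis using that k(4) unfolding lifts_on_def by blast
qed

lemma strong_N: "strong Keq X N \<longleftrightarrow> (\<exists>A. strong \<K> A M \<and> X = eqst Im A)"
  by (rule strong_Keq[OF M_mods good_Im])

lemma strong_N_iff:
  assumes "strong \<K> A M" shows "strong Keq (eqst Im A) N"
  by (rule strong_Keq_eqst[OF assms good_Im])

lemma monster_Keq: "monster \<delta> Keq N" unfolding monster_def voc_Keq
proof (intro conjI allI impI ballI)
  show "N \<in> mods Keq" by (rule mods_Keq_eqst[OF M_mods good_Im])
next
  fix X Y h
  assume X: "strong Keq X N" and Y: "strong Keq Y N" and c: "|car X| <o \<delta>" and h: "iso LE h X Y"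
  obtain A where A: "strong \<K> A M" "X = eqst Im A" using X strong_N by blast
  note Am = strongD(1)[OF A(1)] good_strong[OF A(1) good_Im]
  have "embedding Keq h X N" using h Y strong_Keq_D(1)[OF X]
    unfolding embedding_Keq_iff iso_iff_copy by blast
  from embedding_home[OF this[unfolded A(2)] Am M_mods good_Im]
  obtain k where k: "embedding \<K> k A M" "\<forall>E\<in>\<E>. \<forall>a\<in>tuples (ar E) (car A). h (Im E a) = Im E (map k a)" .
  have "|car A| <o \<delta>" using c card_eqst_less[OF Am] unfolding A(2) by blast
  from homogeneous[OF k(1) A(1) this] obtain l where l: "l \<in> Aut L M {}" "\<forall>x\<in>car A. l x = k x" by blast
  obtain g where g: "g \<in> Aut LE N (up {})" "lifts l g" using Aut_lift[OF l(1)] by blast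
  have "g x = h x" if xX: "x \<in> car X" for x
  proof -
    obtain E a where E: "E \<in> \<E>" and a: "a \<in> tuples (ar E) (car A)" and x: "x = Im E a"
      using eqst_cases[OF xX[unfolded A(2)]] .
    have "a \<in> tuples (ar E) (car M)" using a tuples_mono[OF strongD(4)[OF A(1)]] by blast
    then have "g x = Im E (map l a)" using g(2) E x unfolding lifts_on_def by blast
    also have "map l a = map k a" using l(2) tuplesD(2)[OF a] by auto
    also have "Im E (map k a) = h x" using k(2) E a x by simp
    finally show ?thesis .
  qed
  then show "\<exists>g\<in>Aut LE N {}. \<forall>x\<in>car X. g x = h x" using Aut_mono[OF g(1), of "{}"] by blast
next
  fix X assume X: "X \<in> mods Keq" and c: "|car X| <o \<delta>"
  obtain A \<Phi> where A: "A \<in> mods \<K>" "good \<Phi> A" and Xe: "X = eqst \<Phi> A" using X mods_Keq by blast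
  obtain k where k: "embedding \<K> k A M" using universal[OF A(1)] c card_eqst_less[OF A] unfolding Xe by blast
  show "\<exists>h. embedding Keq h X N" unfolding Xe using embedding_lift[OF k A(2) good_Im] by metis
qed

lemma model_Keq: "model \<delta> Keq N X \<longleftrightarrow> (\<exists>A. model \<delta> \<K> M A \<and> X = eqst Im A)"
proof
  assume "model \<delta> Keq N X"
  then have X: "strong Keq X N" "|car X| <o \<delta>" by (auto simp: model_def)
  obtain A where A: "strong \<K> A M" "X = eqst Im A" using X strong_N by blast
  note Am = strongD(1)[OF A(1)] good_strong[OF A(1) good_Im]
  then show "\<exists>A. model \<delta> \<K> M A \<and> X = eqst Im A" using A X(2) card_eqst_less[OF Am, of \<delta>]
    unfolding model_def by blast
next
  assume "\<exists>A. model \<delta> \<K> M A \<and> X = eqst Im A"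
  then obtain A where A: "strong \<K> A M" "|car A| <o \<delta>" "X = eqst Im A" by (auto simp: model_def)
  note Am = strongD(1)[OF A(1)] good_strong[OF A(1) good_Im]
  show "model \<delta> Keq N X" unfolding model_def A(3)
    using strong_N_iff[OF A(1)] mods_Keq_eqst[OF Am] card_eqst_less[OF Am, of \<delta>] A(2) by blast
qed

lemma modelD:
  assumes "model \<delta> \<K> M A"
  shows "strong \<K> A M" "A \<in> mods \<K>" "car A \<subseteq> car M" "good Im A"
  using assms strongD(4) good_strong[OF _ good_Im] by (auto simp: model_def)

lemma countable_model: "model \<delta> \<K> M A \<Longrightarrow> countable (car (eqst Im A)) \<longleftrightarrow> countable (car A)"
  by (rule countable_eqst[OF modelD(2,4)])

lemma strong_model: "strong \<K> A M \<Longrightarrow> countable (car A) \<Longrightarrow> model \<delta> \<K> M A"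
  unfolding model_def using strongD(1) countable_less_delta by blast

section \<open>Definable functions from the home sort\<close>

text \<open>Every tuple of imaginaries is the value \<open>ev \<tau> a\<close> of a tuple \<open>\<tau>\<close> of terms \<open>F\<^sub>E(x\<^sub>i, x\<^sub>j, \<dots>)\<close> at a
  tuple \<open>a\<close> from the home sort; a term is given by \<open>E\<close> and the list of its indices.\<close>

definition ev :: "('a list rel \<times> nat list) list \<Rightarrow> 'a list \<Rightarrow> 'a imag list" where
  "ev \<tau> a = map (\<lambda>(E, is). Im E (map ((!) a) is)) \<tau>"

definition terms :: "nat \<Rightarrow> ('a list rel \<times> nat list) list \<Rightarrow> bool" where
  "terms n \<tau> \<longleftrightarrow> (\<forall>(E, is)\<in>set \<tau>. E \<in> \<E> \<and> length is = ar E \<and> (\<forall>i\<in>set is. i < n))"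

lemma terms_tuples:
  assumes "terms (length a) \<tau>" "(E, is) \<in> set \<tau>"
  shows "E \<in> \<E>" "map ((!) a) is \<in> tuples (ar E) (set a)"
  using assms unfolding terms_def tuples_def by auto

lemma ev_in_up: "terms (length a) \<tau> \<Longrightarrow> set a \<subseteq> X \<Longrightarrow> set (ev \<tau> a) \<subseteq> up X"
  unfolding ev_def using terms_tuples[of a \<tau>] in_up tuples_mono[of "set a" X] by fastforce

lemma ev_lifts:
  assumes "lifts_on X k h" "set a \<subseteq> X" "terms (length a) \<tau>"
  shows "map h (ev \<tau> a) = ev \<tau> (map k a)"
proof -
  have "h (Im E (map ((!) a) is)) = Im E (map ((!) (map k a)) is)" if "(E, is) \<in> set \<tau>" for E "is"
  proof -
    note t = terms_tuples[OF assms(3) that]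
    have "map ((!) a) is \<in> tuples (ar E) X" using t(2) tuples_mono[OF assms(2)] by blast
    then have "h (Im E (map ((!) a) is)) = Im E (map k (map ((!) a) is))"
      using assms(1) t(1) unfolding lifts_on_def by blast
    also have "map k (map ((!) a) is) = map ((!) (map k a)) is"
      using assms(3) that unfolding terms_def by (fastforce simp: nth_map)
    finally show ?thesis .
  qed
  then show ?thesis unfolding ev_def by auto
qed

lemma ev_exists: "set x \<subseteq> up X \<Longrightarrow> \<exists>a \<tau>. set a \<subseteq> X \<and> terms (length a) \<tau> \<and> x = ev \<tau> a"
proof (induction x)
  case Nil
  show ?case by (rule exI[of _ "[]"], rule exI[of _ "[]"]) (simp add: terms_def ev_def)
next
  case (Cons y x)
  then obtain a \<tau> where a: "set a \<subseteq> X" "terms (length a) \<tau>" "x = ev \<tau> a" by auto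
  obtain E b where E: "E \<in> \<E>" "b \<in> tuples (ar E) X" "y = Im E b" using Cons.prems unfolding up_def by auto
  \<comment> \<open>The representative of \<open>y\<close> is appended after \<open>a\<close>, so
    its indices start at \<open>length a\<close> and the old terms keep their meaning.\<close>
  let ?\<tau> = "(E, map (\<lambda>i. length a + i) [0..<length b]) # \<tau>"
  have "terms (length (a @ b)) ?\<tau>" using a(2) E tuplesD(1)[OF E(2)] unfolding terms_def by fastforce
  moreover have "ev ?\<tau> (a @ b) = y # x"
  proof -
    have "map ((!) (a @ b)) (map (\<lambda>i. length a + i) [0..<length b]) = b"
      by (rule nth_equalityI) (auto simp: nth_append)
    moreover have "ev \<tau> (a @ b) = ev \<tau> a" unfolding ev_def
    proof (intro map_cong refl, clarify)
      fix E "is" assume "(E, is) \<in> set \<tau>"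
      then have "map ((!) (a @ b)) is = map ((!) a) is"
        using a(2) unfolding terms_def by (fastforce simp: nth_append)
      then show "Im E (map ((!) (a @ b)) is) = Im E (map ((!) a) is)" by (simp only:)
    qed
    ultimately show ?thesis unfolding E(3) a(3) by (simp add: ev_def del: map_map)
  qed
  moreover have "set (a @ b) \<subseteq> X" using a(1) tuplesD(2)[OF E(2)] by simp
  ultimately show ?case by metis
qed

lemma up_subset_N: "X \<subseteq> car M \<Longrightarrow> up X \<subseteq> car N" unfolding car_up by (rule up_mono)

text \<open>A finite part of \<open>up A\<close> lies in \<open>up Z\<close> for a finite
  \<open>Z\<close> in \<open>A\<close>. An automorphism over \<open>Z\<close> lifts to one that
  fixes \<open>up Z\<close> and commutes with the terms.\<close>

lemma same_type_ev:
  assumes st: "same_type L M A a b" and a: "set a \<subseteq> car M" and A: "A \<subseteq> car M" and t: "terms (length a) \<tau>"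
  shows "same_type LE N (up A) (ev \<tau> a) (ev \<tau> b)"
proof (rule same_typeI[OF N_struct])
  show "set (ev \<tau> a) \<subseteq> car N" using ev_in_up[OF t a] unfolding car_up .
  show "up A \<subseteq> car N" by (rule up_subset_N[OF A])
  fix B assume B: "B \<subseteq> up A" "finite B"
  obtain Z where Z: "Z \<subseteq> A" "finite Z" "B \<subseteq> up Z" using up_finite[OF B(2,1)] by blast
  obtain k where k: "k \<in> Aut L M Z" "map k a = b" using same_typeE[OF st M_struct a A Z(1,2)] .
  obtain h where h: "h \<in> Aut LE N (up Z)" "lifts k h" using Aut_lift[OF k(1)] Z(1) A by blast
  show "\<exists>h\<in>Aut LE N B. map h (ev \<tau> a) = ev \<tau> b"
    using Aut_mono[OF h(1) Z(3)] ev_lifts[OF h(2) a t] k(2) by blast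
qed

lemma map_eta_eq: "set a \<subseteq> car M \<Longrightarrow> set b \<subseteq> car M \<Longrightarrow> map \<eta> a = map \<eta> b \<longleftrightarrow> a = b"
  by (rule map_eq_iff_inj_on[OF eta_inj])

lemma map_eta_N: "set a \<subseteq> car M \<Longrightarrow> set (map \<eta> a) \<subseteq> car N"
  using map_eta_in_up[of a "car M"] unfolding car_up .

lemma same_type_home:
  assumes st: "same_type LE N X (map \<eta> a) (map \<eta> b)" and X: "X \<subseteq> car N"
    and a: "set a \<subseteq> car M" and b: "set b \<subseteq> car M"
  shows "same_type L M {x \<in> car M. \<eta> x \<in> X} a b"
proof (rule same_typeI[OF M_struct a])
  show "{x \<in> car M. \<eta> x \<in> X} \<subseteq> car M" by blast
  fix B assume B: "B \<subseteq> {x \<in> car M. \<eta> x \<in> X}" "finite B"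
  have "\<eta> ` B \<subseteq> X" "finite (\<eta> ` B)" using B by auto
  then obtain h where h: "h \<in> Aut LE N (\<eta> ` B)" "map h (map \<eta> a) = map \<eta> b"
    using same_typeE[OF st N_struct map_eta_N[OF a] X] by blast
  obtain k where k: "k \<in> Aut L M {x \<in> car M. \<eta> x \<in> \<eta> ` B}" "lifts k h" using Aut_home[OF h(1)] .
  have "map \<eta> (map k a) = map \<eta> b" by (rule trans[OF lifts_map_eta[OF k(2) a, symmetric] h(2)])
  then have "map k a = b" using map_eta_eq[OF Aut_map_closed[OF k(1) a] b] by blast
  moreover have "B \<subseteq> {x \<in> car M. \<eta> x \<in> \<eta> ` B}" using B(1) by blast
  ultimately show "\<exists>k\<in>Aut L M B. map k a = b" using Aut_mono[OF k(1)] by blast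
qed

lemma map_eta_ev:
  assumes "length a = n"
  shows "map \<eta> a = ev (map (\<lambda>i. (\<iota>, [i])) [0..<n]) a" "terms n (map (\<lambda>i. (\<iota>, [i])) [0..<n])"
  using assms id_in_E by (auto simp: ev_def terms_def arity_id intro!: nth_equalityI)

lemma same_type_eta:
  assumes st: "same_type L M A a b" and a: "set a \<subseteq> car M" and A: "A \<subseteq> car M"
  shows "same_type LE N (up A) (map \<eta> a) (map \<eta> b)"
proof -
  obtain k where "map k a = b" using same_typeE[OF st M_struct a A, of "{}"] by blast
  then show ?thesis using same_type_ev[OF st a A map_eta_ev(2)[OF refl]] map_eta_ev(1)[of a] map_eta_ev(1)[of b]
    by auto
qed

text \<open>s-saturation is applied to a lift of \<open>b\<close> over representatives of
  \<open>A\<close>; the terms are then evaluated at the tuple found.\<close>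

lemma AI_Keq: "AI \<delta> Keq N" unfolding AI_def voc_Keq
proof (intro allI impI)
  fix X b A
  assume X: "model \<delta> Keq N X" "countable (car X)" and b: "set b \<subseteq> car N" and A: "A \<subseteq> car X" "finite A"
  obtain C where C: "model \<delta> \<K> M C" "X = eqst Im C" using X model_Keq by blast
  have cC: "countable (car C)" using X(2) countable_model[OF C(1)] C(2) by blast
  obtain b' \<tau> where b': "set b' \<subseteq> car M" "terms (length b') \<tau>" "b = ev \<tau> b'"
    using ev_exists[of b "car M"] b unfolding car_up by blast
  have "A \<subseteq> up (car C)" using A(1) unfolding C(2) car_up .
  from up_finite[OF A(2) this] obtain A' where A': "A' \<subseteq> car C" "finite A'" "A \<subseteq> up A'" by blast
  obtain a' where a': "set a' \<subseteq> car C" "same_type L M A' a' b'"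
    using AI C(1) cC b'(1) A'(1,2) unfolding AI_def by metis
  have a'M: "set a' \<subseteq> car M" and A'M: "A' \<subseteq> car M" using a'(1) A'(1) modelD(3)[OF C(1)] by blast+
  obtain k where "map k a' = b'" using same_typeE[OF a'(2) M_struct a'M A'M, of "{}"] by blast
  then have t: "terms (length a') \<tau>" using b'(2) by auto
  have "same_type LE N A (ev \<tau> a') b"
    unfolding b'(3) by (rule same_type_mono[OF same_type_ev[OF a'(2) a'M A'M t] A'(3)])
  moreover have "set (ev \<tau> a') \<subseteq> car X" unfolding C(2) car_up by (rule ev_in_up[OF t a'(1)])
  ultimately show "\<exists>a. set a \<subseteq> car X \<and> same_type LE N A a b" by blast
qed

section \<open>Independence of imaginaries\<close>

lemma not_splits_ev:
  assumes D: "strong \<K> D M" and c: "set c \<subseteq> car M" and A: "A \<subseteq> car D" "finite A"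
    and ns: "\<not> splits L M c (car D) A" and t: "terms (length c) \<tau>"
  shows "\<not> splits LE N (ev \<tau> c) (up (car D)) (\<eta> ` A)"
proof
  assume "splits LE N (ev \<tau> c) (up (car D)) (\<eta> ` A)"
  then obtain b d where b: "set b \<subseteq> up (car D)" and d: "set d \<subseteq> up (car D)"
    and bd: "same_type LE N (\<eta> ` A) b d"
    and nst: "\<not> same_type LE N (\<eta> ` A) (ev \<tau> c @ b) (ev \<tau> c @ d)" unfolding splits_def by blast
  have DM: "car D \<subseteq> car M" by (rule strongD(4)[OF D])
  have AM: "A \<subseteq> car M" using A(1) DM by blast
  have AN: "\<eta> ` A \<subseteq> car N" using eta_subset_up[of A] up_subset_N[OF AM] by blast
  obtain b' \<sigma> where b': "set b' \<subseteq> car D" "terms (length b') \<sigma>" "b = ev \<sigma> b'" using ev_exists[OF b] by blast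
  obtain d' \<rho> where d': "set d' \<subseteq> car D" "terms (length d') \<rho>" "d = ev \<rho> d'" using ev_exists[OF d] by blast
  have b'M: "set b' \<subseteq> car M" and d'M: "set d' \<subseteq> car M" using b'(1) d'(1) DM by blast+
  have bN: "set b \<subseteq> car N" using b up_subset_N[OF DM] by blast
  obtain h where h: "h \<in> Aut LE N (\<eta> ` A)" "map h b = d"
    using same_typeE[OF bd N_struct bN AN] A(2) by blast
  obtain k where k: "k \<in> Aut L M {x \<in> car M. \<eta> x \<in> \<eta> ` A}" "lifts k h" using Aut_home[OF h(1)] .
  have kA: "k \<in> Aut L M A" by (rule Aut_mono[OF k(1)]) (use AM in blast)
  \<comment> \<open>A second lift of \<open>d\<close>, with the type of \<open>b'\<close> over
    \<open>A\<close>. It may lie outside \<open>D\<close>, where the assumption on \<open>c\<close>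
    says nothing.\<close>
  let ?e = "map k b'"
  have eM: "set ?e \<subseteq> car M" by (rule Aut_map_closed[OF kA b'M])
  have de: "d = ev \<sigma> ?e" using ev_lifts[OF k(2) b'M b'(2)] h(2) b'(3) by simp
  \<comment> \<open>(AI) is about countable models and \<open>D\<close> may be uncountable, so a
    countable submodel with all parameters is used.\<close>
  have "A \<union> set b' \<union> set d' \<subseteq> car D" "countable (A \<union> set b' \<union> set d')"
    using A b'(1) d'(1) by (auto intro: countable_finite)
  from countable_submodel[OF strongD(1)[OF D] this]
  obtain C where C: "strong \<K> C D" "A \<union> set b' \<union> set d' \<subseteq> car C" "countable (car C)" .
  have Cm: "model \<delta> \<K> M C" by (rule strong_model[OF strong_trans[OF C(1) D] C(3)])
  have "A \<union> set d' \<subseteq> car C" "finite (A \<union> set d')" using C(2) A(2) by auto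
  \<comment> \<open>The parameters include \<open>d'\<close>, so that \<open>g\<close> is again a
    lift of \<open>d\<close>: the lifted automorphism taking \<open>g\<close> to \<open>?e\<close>
    sends its value to \<open>d\<close> and also fixes \<open>d\<close>.\<close>
  then obtain g where g: "set g \<subseteq> car C" "same_type L M (A \<union> set d') g ?e"
    using AI Cm C(3) eM unfolding AI_def by metis
  have gM: "set g \<subseteq> car M" and gD: "set g \<subseteq> car D" using g(1) strongD(4)[OF C(1)] DM by blast+
  have AdM: "A \<union> set d' \<subseteq> car M" using AM d'M by blast
  obtain l where l: "l \<in> Aut L M (A \<union> set d')" "map l g = ?e"
    using same_typeE[OF g(2) M_struct gM AdM] A(2) by blast
  have len: "length g = length b'" using l(2) by (metis length_map)
  then have tg: "terms (length g) \<sigma>" using b'(2) by simp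
  obtain l' where l': "l' \<in> Aut LE N (up (A \<union> set d'))" "lifts l l'" using Aut_lift[OF l(1) AdM] .
  have "map l' (ev \<sigma> g) = d" using ev_lifts[OF l'(2) gM tg] l(2) de by simp
  moreover have "map l' d = d"
  proof -
    have "map l d' = d'" by (rule Aut_map_fix[OF l(1)]) blast
    then show ?thesis using ev_lifts[OF l'(2) d'M d'(2)] d'(3) by simp
  qed
  moreover have "set (ev \<sigma> g) \<subseteq> car N" "set d \<subseteq> car N"
    using ev_in_up[OF tg gM] d up_subset_N[OF DM] unfolding car_up by auto
  ultimately have gd: "ev \<sigma> g = d" using map_eq_iff_inj_on[OF Aut_inj[OF l'(1)]] by metis
  have "same_type L M A b' g"
  proof -
    have "same_type L M A b' ?e" using same_type_finite[OF M_struct b'M AM A(2)] kA by blast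
    moreover have "same_type L M A g ?e" by (rule same_type_mono[OF g(2)]) blast
    ultimately show ?thesis using same_type_sym same_type_trans by blast
  qed
  then have "same_type L M A (c @ b') (c @ g)" using ns b'(1) gD unfolding splits_def by blast
  then obtain m where m: "m \<in> Aut L M A" "map m (c @ b') = c @ g"
    using same_type_finite[OF M_struct _ AM A(2), of "c @ b'"] c b'M by auto
  have mc: "map m c = c" "map m b' = g" using m(2) len by auto
  obtain m' where m': "m' \<in> Aut LE N (up A)" "lifts m m'" using Aut_lift[OF m(1) AM] .
  have "map m' (ev \<tau> c @ b) = ev \<tau> c @ d"
    using ev_lifts[OF m'(2) c t] ev_lifts[OF m'(2) b'M b'(2)] mc b'(3) gd by simp
  moreover have "m' \<in> Aut LE N (\<eta> ` A)" by (rule Aut_mono[OF m'(1) eta_subset_up])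
  moreover have "set (ev \<tau> c @ b) \<subseteq> car N" using ev_in_up[OF t c] bN unfolding car_up by simp
  ultimately show False using nst same_type_finite[OF N_struct _ AN] A(2) by blast
qed

text \<open>The base \<open>A\<close> consists of imaginaries. It is enlarged to \<open>?G\<close>,
  which lies between the copy of \<open>B\<close> and \<open>up B\<close>: equality of types over
  \<open>B\<close> goes up to \<open>?G\<close>, and equality over \<open>?G\<close> comes down to
  \<open>B\<close>.\<close>

lemma not_splits_home:
  assumes c: "set c \<subseteq> car M" and D: "D \<subseteq> car M" and ns: "\<not> splits LE N (map \<eta> c) (up D) A"
    and A: "A \<subseteq> up B" "finite A" and B: "B \<subseteq> D" "finite B"
  shows "\<not> splits L M c D B"
proof
  let ?G = "A \<union> \<eta> ` B"
  assume "splits L M c D B"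
  then obtain b d where b: "set b \<subseteq> D" and d: "set d \<subseteq> D" and bd: "same_type L M B b d"
    and nst: "\<not> same_type L M B (c @ b) (c @ d)" unfolding splits_def by blast
  have BM: "B \<subseteq> car M" and bM: "set b \<subseteq> car M" and dM: "set d \<subseteq> car M" using B b d D by blast+
  have GB: "?G \<subseteq> up B" using A(1) eta_subset_up by blast
  have GD: "?G \<subseteq> up D" using GB up_mono[OF B(1)] by blast
  have DN: "up D \<subseteq> car N" by (rule up_subset_N[OF D])
  have ns': "\<not> splits LE N (map \<eta> c) (up D) ?G"
    by (rule not_splits_base[OF N_struct DN map_eta_N[OF c] ns _ GD]) (use A(2) B(2) in auto)
  have "same_type LE N ?G (map \<eta> b) (map \<eta> d)" by (rule same_type_mono[OF same_type_eta[OF bd bM BM] GB])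
  then have "same_type LE N ?G (map \<eta> (c @ b)) (map \<eta> (c @ d))"
    using ns' map_eta_in_up[OF b] map_eta_in_up[OF d] unfolding splits_def map_append by blast
  then have "same_type L M {x \<in> car M. \<eta> x \<in> ?G} (c @ b) (c @ d)"
    by (rule same_type_home) (use GD DN c bM dM in auto)
  then have "same_type L M B (c @ b) (c @ d)" by (rule same_type_mono) (use BM in blast)
  then show False using nst by blast
qed

lemma indep_set_up:
  assumes i: "indep_set L M A B (car D)" and D: "strong \<K> D M" and B: "B \<subseteq> car D" and A: "A \<subseteq> car M"
  shows "indep_set LE N (up A) (up B) (up (car D))"
  unfolding indep_set_def
proof (intro allI impI)
  fix a assume "set a \<subseteq> up A"
  then obtain a' \<tau> where a': "set a' \<subseteq> A" "terms (length a') \<tau>" "a = ev \<tau> a'" using ev_exists by blast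
  obtain F where F: "F \<subseteq> B" "finite F" "\<not> splits L M a' (B \<union> car D) F"
    using i a'(1) unfolding indep_set_def indep_def by blast
  have e: "B \<union> car D = car D" "up B \<union> up (car D) = up (car D)" using B up_mono[OF B] by blast+
  have "\<not> splits LE N a (up (car D)) (\<eta> ` F)" unfolding a'(3)
    by (rule not_splits_ev[OF D _ _ F(2) _ a'(2)]) (use a'(1) A F B e in auto)
  moreover have "\<eta> ` F \<subseteq> up B" using eta_subset_up[of F] up_mono[OF F(1)] by blast
  ultimately show "indep LE N a (up B) (up (car D))" unfolding indep_def e using F(2) by blast
qed

lemma indep_set_home:
  assumes i: "indep_set LE N (up A) (up B) (up D)" and D: "D \<subseteq> car M" and B: "B \<subseteq> D" and A: "A \<subseteq> car M"
  shows "indep_set L M A B D"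
  unfolding indep_set_def
proof (intro allI impI)
  fix a assume a: "set a \<subseteq> A"
  have "set (map \<eta> a) \<subseteq> up A" by (rule map_eta_in_up[OF a])
  then obtain F where F: "F \<subseteq> up B" "finite F" "\<not> splits LE N (map \<eta> a) (up B \<union> up D) F"
    using i unfolding indep_set_def indep_def by blast
  have e: "B \<union> D = D" "up B \<union> up D = up D" using B up_mono[OF B] by blast+
  obtain Z where Z: "Z \<subseteq> B" "finite Z" "F \<subseteq> up Z" using up_finite[OF F(2,1)] by blast
  have "\<not> splits L M a D Z"
    by (rule not_splits_home[OF _ D _ Z(3) F(2) _ Z(2)]) (use a A F(3) e Z(1) B in auto)
  then show "indep L M a B D" unfolding indep_def e using Z(1,2) by blast
qed

section \<open>Free amalgams and extensions\<close>

lemma eta_up: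
  assumes X: "X \<subseteq> car M" and x: "x \<in> car M" "\<eta> x \<in> up X"
  shows "x \<in> X"
proof -
  obtain E a where E: "E \<in> \<E>" and a: "a \<in> tuples (ar E) X" and e: "\<eta> x = Im E a"
    using x(2) unfolding up_def by blast
  have aM: "a \<in> tuples (ar E) (car M)" using a tuples_mono[OF X] by blast
  from goodD[OF good_Im id_in_E E singleton_in_tuples[OF x(1)] aM] e
  have *: "E = \<iota>" "([x], a) \<in> eq_on \<K> M \<iota> M" by auto
  obtain y where "y \<in> X" "a = [y]" using a unfolding *(1) tuples_id by blast
  then show ?thesis using *(2) eq_on_id[OF M_mods x(1)] X by auto
qed

lemma eta_up_iff: "X \<subseteq> car M \<Longrightarrow> x \<in> car M \<Longrightarrow> \<eta> x \<in> up X \<longleftrightarrow> x \<in> X"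
  using eta_up eta_in_up[of x X] by blast

lemma up_subset_iff: "X \<subseteq> car M \<Longrightarrow> Y \<subseteq> car M \<Longrightarrow> up X \<subseteq> up Y \<longleftrightarrow> X \<subseteq> Y"
proof
  assume X: "X \<subseteq> car M" and Y: "Y \<subseteq> car M" and s: "up X \<subseteq> up Y"
  show "X \<subseteq> Y"
  proof
    fix x assume x: "x \<in> X"
    have "\<eta> x \<in> up Y" using eta_in_up[OF x] s by blast
    then show "x \<in> Y" using eta_up[OF Y] x X by blast
  qed
qed (rule up_mono)

lemma up_eq_iff: "X \<subseteq> car M \<Longrightarrow> Y \<subseteq> car M \<Longrightarrow> up X = up Y \<longleftrightarrow> X = Y"
  using up_subset_iff[of X Y] up_subset_iff[of Y X] by blast

text \<open>\<open>c\<close> acts on home elements only. Its action \<open>h\<close> on imaginaries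
  is taken from one automorphism \<open>k\<close>; the automorphisms belonging to other finite sets
  induce the same map on \<open>up B\<close> because they agree with \<open>k\<close> on
  \<open>B\<close>.\<close>

lemma same_type_fam_lift:
  assumes f: "same_type_fam L M A B (\<lambda>b. b) c" and A: "A \<subseteq> car M" and B: "B \<subseteq> car M"
  obtains k h where "k \<in> Aut L M {}" "lifts k h" "\<forall>b\<in>B. k b = c b" "h ` up B = up (c ` B)"
    "same_type_fam LE N (up A) (up B) (\<lambda>b. b) h"
proof -
  obtain k where k: "k \<in> Aut L M {}" "\<forall>b\<in>B. k b = c b" using f unfolding same_type_fam_def by blast
  obtain h where h: "h \<in> Aut LE N (up {})" "lifts k h" using Aut_lift[OF k(1)] by blast
  have im: "k ` B = c ` B" using k(2) by auto
  have "h ` up B = up (c ` B)" using lifts_on_up[OF lifts_on_mono[OF h(2) B]] im by simp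
  moreover have "same_type_fam LE N (up A) (up B) (\<lambda>b. b) h" unfolding same_type_fam_def
  proof (intro allI impI)
    fix F assume F: "F \<subseteq> up A" "finite F"
    obtain Z where Z: "Z \<subseteq> A" "finite Z" "F \<subseteq> up Z" using up_finite[OF F(2,1)] by blast
    obtain l where l: "l \<in> Aut L M Z" "\<forall>b\<in>B. l b = c b" using f Z(1,2) unfolding same_type_fam_def by blast
    obtain g where g: "g \<in> Aut LE N (up Z)" "lifts l g" using Aut_lift[OF l(1)] Z(1) A by blast
    have "g x = h x" if xB: "x \<in> up B" for x
    proof -
      obtain E a where E: "E \<in> \<E>" and a: "a \<in> tuples (ar E) B" and x: "x = Im E a"
        using xB unfolding up_def by blast
      have aM: "a \<in> tuples (ar E) (car M)" using a tuples_mono[OF B] by blast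
      have lk: "map l a = map k a" using l(2) k(2) tuplesD(2)[OF a] by auto
      have "g x = Im E (map l a)" "h x = Im E (map k a)"
        using g(2) h(2) E aM unfolding x lifts_on_def by blast+
      then show ?thesis using lk by (simp only:)
    qed
    then show "\<exists>g\<in>Aut LE N F. \<forall>x\<in>up B. g x = h x" using Aut_mono[OF g(1) Z(3)] by blast
  qed
  ultimately show thesis using that k h(2) by blast
qed

lemma AVI_Keq: "AVI \<delta> Keq N" unfolding AVI_def voc_Keq
proof (intro allI impI)
  fix X Y Z
  assume "model \<delta> Keq N X" "model \<delta> Keq N Y" "model \<delta> Keq N Z" and s: "car X \<subseteq> car Y \<inter> car Z"
  then obtain A B D where A: "model \<delta> \<K> M A" "X = eqst Im A" and B: "model \<delta> \<K> M B" "Y = eqst Im B"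
    and D: "model \<delta> \<K> M D" "Z = eqst Im D" using model_Keq by metis
  note m = modelD(3)[OF A(1)] modelD(3)[OF B(1)] modelD(3)[OF D(1)]
  have AB: "car A \<subseteq> car B" and AD: "car A \<subseteq> car D" using s m up_subset_iff
    unfolding A(2) B(2) D(2) car_up by auto
  then obtain C c where C: "model \<delta> \<K> M C" "c ` car B = car C"
    "same_type_fam L M (car A) (car B) (\<lambda>b. b) c" "indep_set L M (car C) (car A) (car D)"
    using AVI A(1) B(1) D(1) unfolding AVI_def by (metis le_inf_iff)
  obtain h where h: "h ` up (car B) = up (car C)"
    "same_type_fam LE N (up (car A)) (up (car B)) (\<lambda>b. b) h"
    using same_type_fam_lift[OF C(3) m(1,2)] C(2) by metis
  have "indep_set LE N (up (car C)) (up (car A)) (up (car D))"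
    by (rule indep_set_up[OF C(4) modelD(1)[OF D(1)] AD modelD(3)[OF C(1)]])
  then show "\<exists>W c. model \<delta> Keq N W \<and> c ` car Y = car W \<and>
      same_type_fam LE N (car X) (car Y) (\<lambda>b. b) c \<and> indep_set LE N (car W) (car X) (car Z)"
    unfolding A(2) B(2) D(2) car_up using h C(1) model_Keq car_up by metis
qed

text \<open>A finite tuple has the type of some tuple of the s-saturated model over a finite set over which
  neither type splits, and on the model the two types agree.\<close>

lemma stationarity:
  assumes X: "model \<delta> Keq N X" "countable (car X)" and w: "set w \<subseteq> car N" and w': "set w' \<subseteq> car N"
    and st: "same_type LE N (car X) w w'" and i: "indep LE N w (car X) S" and i': "indep LE N w' (car X) S"
    and S: "S \<subseteq> car N"
  shows "same_type LE N (car X \<union> S) w w'"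
proof -
  have XN: "car X \<subseteq> car N" using X strong_Keq_D(3) substructureD(3) unfolding model_def by blast
  have XS: "car X \<union> S \<subseteq> car N" using XN S by blast
  obtain F where F: "F \<subseteq> car X" "finite F" "\<not> splits LE N w (car X \<union> S) F"
    using i unfolding indep_def by blast
  obtain F' where F': "F' \<subseteq> car X" "finite F'" "\<not> splits LE N w' (car X \<union> S) F'"
    using i' unfolding indep_def by blast
  define G where "G = F \<union> F'"
  have G: "G \<subseteq> car X" "finite G" "F \<subseteq> G" "F' \<subseteq> G" "G \<subseteq> car X \<union> S" "G \<subseteq> car N"
    using F(1,2) F'(1,2) XN unfolding G_def by auto
  have ns: "\<not> splits LE N w (car X \<union> S) G" "\<not> splits LE N w' (car X \<union> S) G"
    by (rule not_splits_base[OF N_struct XS w F(3) G(3,5,2)],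
        rule not_splits_base[OF N_struct XS w' F'(3) G(4,5,2)])
  show ?thesis
  proof (rule same_typeI[OF N_struct w XS])
    fix P assume P: "P \<subseteq> car X \<union> S" "finite P"
    obtain p where p: "set p = P" using finite_list[OF P(2)] by blast
    have pN: "set p \<subseteq> car N" using P(1) p XS by blast
    obtain q where q: "set q \<subseteq> car X" "same_type LE N G q p"
      using AI_Keq X pN G(1,2) unfolding AI_def voc_Keq by metis
    have pq: "set q \<subseteq> car X \<union> S" "set p \<subseteq> car X \<union> S" using q(1) p P(1) by auto
    have 1: "same_type LE N G (w @ q) (w @ p)" "same_type LE N G (w' @ q) (w' @ p)"
      using ns pq q(2) unfolding splits_def by blast+
    have "G \<union> set q \<subseteq> car X" "finite (G \<union> set q)" using G(1,2) q(1) by auto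
    then obtain k where k: "k \<in> Aut LE N (G \<union> set q)" "map k w = w'"
      using same_typeE[OF st N_struct w XN] by blast
    have "map k (w @ q) = w' @ q" using k(2) Aut_map_fix[OF k(1), of q] by simp
    moreover have wq: "set (w @ q) \<subseteq> car N" using w q(1) XN by auto
    ultimately have 2: "same_type LE N G (w @ q) (w' @ q)"
      using same_type_finite[OF N_struct wq G(6,2)] Aut_mono[OF k(1), of G] by blast
    have 3: "same_type LE N G (w @ p) (w' @ p)"
      using same_type_trans[OF same_type_sym[OF 1(1)] same_type_trans[OF 2 1(2)]] .
    have wp: "set (w @ p) \<subseteq> car N" using w pN by simp
    obtain l where l: "l \<in> Aut LE N G" "map l (w @ p) = w' @ p"
      using same_typeE[OF 3 N_struct wp G(6) order_refl G(2)] .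
    obtain k where "map k w = w'" using same_typeE[OF st N_struct w XN, of "{}"] by blast
    then have "length w = length w'" by auto
    then have lw: "map l w = w'" "map l p = p" using l(2) by auto
    have "\<forall>x\<in>P. l x = x" using map_id_fix[OF lw(2)] p by blast
    then have "l \<in> Aut LE N P" using l(1) unfolding Aut_def by blast
    then show "\<exists>l\<in>Aut LE N P. map l w = w'" using lw(1) by blast
  qed
qed

text \<open>Independence of \<open>Y\<close> from \<open>a\<close> need not give independence from a
  lift \<open>a'\<close> of \<open>a\<close>, so (AV) of the home sort cannot be applied to
  \<open>B\<close> directly. The copy \<open>C\<close> is independent from \<open>a'\<close> by its
  choice.\<close>

lemma AV_Keq: "AV \<delta> Keq N" unfolding AV_def voc_Keq
proof (intro allI impI)
  fix X Y a
  assume X: "model \<delta> Keq N X" and Y: "model \<delta> Keq N Y" and cX: "countable (car X)" and cY: "countable (car Y)"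
    and XY: "car X \<subseteq> car Y" and a: "set a \<subseteq> car N" and i: "indep_set LE N (car Y) (car X) (set a)"
  obtain A where A: "model \<delta> \<K> M A" "X = eqst Im A" using X model_Keq by blast
  obtain B where B: "model \<delta> \<K> M B" "Y = eqst Im B" using Y model_Keq by blast
  note Xe = A(2) and Ye = B(2)
  have cA: "countable (car A)" "countable (car B)"
    using cX cY countable_model[OF A(1)] countable_model[OF B(1)] Xe Ye by auto
  have X_up: "car X = up (car A)" and Y_up: "car Y = up (car B)" using Xe Ye car_up by auto
  note AM = modelD(3)[OF A(1)] and BM = modelD(3)[OF B(1)]
  have AB: "car A \<subseteq> car B" using XY up_subset_iff[OF AM BM] unfolding X_up Y_up by blast
  obtain a' \<tau> where a': "set a' \<subseteq> car M" "terms (length a') \<tau>" "a = ev \<tau> a'"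
    using ev_exists[of a "car M"] a unfolding car_up by blast
  \<comment> \<open>(AVI) makes a model independent from a model, so the lift \<open>a'\<close> is
    first enclosed in a countable model \<open>D\<close> over \<open>A\<close>.\<close>
  have "car A \<union> set a' \<subseteq> car M" "countable (car A \<union> set a')" using AM a'(1) cA(1) by (auto intro: countable_finite)
  from countable_submodel[OF M_mods this]
  obtain D where D: "strong \<K> D M" "car A \<union> set a' \<subseteq> car D" "countable (car D)" .
  note Dm = strong_model[OF D(1,3)]
  have AD: "car A \<subseteq> car D" "set a' \<subseteq> car D" using D(2) by auto
  obtain C c where C: "model \<delta> \<K> M C" "c ` car B = car C"
    "same_type_fam L M (car A) (car B) (\<lambda>b. b) c" "indep_set L M (car C) (car A) (car D)"
    using AVI A(1) B(1) Dm AB AD(1) unfolding AVI_def by (metis le_inf_iff)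
  note CM = modelD(3)[OF C(1)]
  have cC: "countable (car C)" using cA(2) C(2) countable_image by metis
  \<comment> \<open>Equality of types over the singleton of \<open>x\<close> forces \<open>c\<close>
    to fix \<open>x\<close>, so the copy \<open>C\<close> contains \<open>A\<close>.\<close>
  have "x \<in> car C" if x: "x \<in> car A" for x
  proof -
    have "{x} \<subseteq> car A" "finite {x}" using x by auto
    then obtain k where "k \<in> Aut L M {x}" "\<forall>b\<in>car B. k b = c b" using C(3) unfolding same_type_fam_def by blast
    then have "c x = x" using x AB Aut_fix[of k L M "{x}" x] by force
    then show ?thesis using x AB C(2) by force
  qed
  then have AC: "car A \<subseteq> car C" by blast
  have "indep_set L M (car C) (car A) (set a')"
    using C(4) indep_subset[OF _ AD(2)] unfolding indep_set_def by blast
  then have "indep L M a' (car A) (car C)"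
    using AV A(1) C(1) cA(1) cC AC a'(1) unfolding AV_def by metis
  then obtain F where F: "F \<subseteq> car A" "finite F" "\<not> splits L M a' (car C) F"
    unfolding indep_def using AC by (metis sup.absorb2)
  define G where "G = \<eta> ` F"
  have nsC: "\<not> splits LE N a (up (car C)) G"
    unfolding a'(3) G_def using F(1) AC by (intro not_splits_ev[OF modelD(1)[OF C(1)] a'(1) _ F(2,3) a'(2)]) blast
  have G: "G \<subseteq> car X" "finite G" unfolding G_def X_up
    using eta_subset_up[of F] up_mono[OF F(1)] F(2) by auto
  have XN: "car X \<subseteq> car N" and YN: "car Y \<subseteq> car N"
    unfolding X_up Y_up using up_subset_N[OF AM] up_subset_N[OF BM] by auto
  have GN: "G \<subseteq> car N" using G(1) XN by blast
  obtain k h where h: "k \<in> Aut L M {}" "lifts k h" "h ` up (car B) = up (car C)"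
    "same_type_fam LE N (up (car A)) (up (car B)) (\<lambda>b. b) h"
    using same_type_fam_lift[OF C(3) AM BM] C(2) by metis
  have iC: "indep_set LE N (up (car C)) (up (car A)) (up (car D))"
    by (rule indep_set_up[OF C(4) D(1) AD(1) CM])
  have aD: "set a \<subseteq> up (car D)" unfolding a'(3) by (rule ev_in_up[OF a'(2) AD(2)])
  have st: "same_type LE N (car X \<union> set a) w (map h w)" if w: "set w \<subseteq> car Y" for w
  proof (rule stationarity[OF X cX _ _ _ _ _ a])
    show wN: "set w \<subseteq> car N" using w YN by blast
    have hw: "set (map h w) \<subseteq> up (car C)" using w h(3) unfolding Y_up by auto
    then show "set (map h w) \<subseteq> car N" using up_subset_N[OF CM] by blast
    show "indep LE N w (car X) (set a)" using i w unfolding indep_set_def by blast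
    show "indep LE N (map h w) (car X) (set a)"
      using iC hw indep_subset[OF _ aD] unfolding indep_set_def X_up by blast
    show "same_type LE N (car X) w (map h w)"
    proof (rule same_typeI[OF N_struct wN XN])
      fix Q assume "Q \<subseteq> car X" "finite Q"
      then obtain g where g: "g \<in> Aut LE N Q" "\<forall>x\<in>up (car B). g x = h x"
        using h(4) unfolding same_type_fam_def X_up by blast
      have "map g w = map h w" using g(2) w unfolding Y_up by auto
      then show "\<exists>g\<in>Aut LE N Q. map g w = map h w" using g(1) by blast
    qed
  qed
  have "\<not> splits LE N a (car Y) G"
  proof
    assume "splits LE N a (car Y) G"
    then obtain b d where b: "set b \<subseteq> car Y" and d: "set d \<subseteq> car Y" and bd: "same_type LE N G b d"
      and n: "\<not> same_type LE N G (a @ b) (a @ d)" unfolding splits_def by blast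
    have XaN: "car X \<union> set a \<subseteq> car N" using XN a by blast
    \<comment> \<open>\<open>a\<close> is among the parameters in \<open>st\<close>, so replacing a
      tuple of \<open>Y\<close> by its image under \<open>h\<close> keeps its type together with
      \<open>a\<close>. A splitting inside \<open>Y\<close> would thus move into
      \<open>up (car C)\<close>, where \<open>nsC\<close> excludes it.\<close>
    have ext: "same_type LE N G w (map h w) \<and> same_type LE N G (a @ w) (a @ map h w)"
      if w: "set w \<subseteq> car Y" for w
    proof
      have wN: "set w \<subseteq> car N" using w YN by blast
      show "same_type LE N G w (map h w)" by (rule same_type_mono[OF st[OF w]]) (use G in blast)
      have "G \<union> set a \<subseteq> car X \<union> set a" "finite (G \<union> set a)" using G by auto
      then obtain g where g: "g \<in> Aut LE N (G \<union> set a)" "map g w = map h w"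
        using same_typeE[OF st[OF w] N_struct wN XaN] by blast
      have "map g (a @ w) = a @ map h w" using g(2) Aut_map_fix[OF g(1), of a] by simp
      moreover have "set (a @ w) \<subseteq> car N" using a wN by simp
      ultimately show "same_type LE N G (a @ w) (a @ map h w)"
        using same_type_finite[OF N_struct _ GN G(2)] Aut_mono[OF g(1), of G] by blast
    qed
    have "same_type LE N G (map h b) (map h d)"
      by (rule same_type_trans[OF same_type_sym[OF ext[OF b, THEN conjunct1]]
            same_type_trans[OF bd ext[OF d, THEN conjunct1]]])
    moreover have "set (map h b) \<subseteq> up (car C)" "set (map h d) \<subseteq> up (car C)"
      using b d h(3) unfolding Y_up by auto
    ultimately have "same_type LE N G (a @ map h b) (a @ map h d)" using nsC unfolding splits_def by blast
    from same_type_trans[OF ext[OF b, THEN conjunct2]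
        same_type_trans[OF this same_type_sym[OF ext[OF d, THEN conjunct2]]]]
    show False using n by blast
  qed
  then show "indep LE N a (car X) (car Y)" unfolding indep_def using G XY by (metis sup.absorb2)
qed

section \<open>Weakly elementary maps and s-prime models\<close>

lemma strong_restr_up:
  assumes Y: "Y \<subseteq> car M"
  shows "strong Keq (restr N (up Y)) N \<longleftrightarrow> strong \<K> (restr M Y) M"
proof
  assume "strong Keq (restr N (up Y)) N"
  then obtain A where A: "strong \<K> A M" "restr N (up Y) = eqst Im A" using strong_N by blast
  have "up Y = car (restr N (up Y))" by (simp add: restr_def)
  then have "up Y = up (car A)" using A(2) car_up by metis
  then have "Y = car A" using up_eq_iff[OF Y strongD(4)[OF A(1)]] by blast
  then show "strong \<K> (restr M Y) M" using strong_restr[OF A(1)] A(1) by simp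
next
  assume s: "strong \<K> (restr M Y) M"
  have c: "car (restr M Y) = Y" by (simp add: restr_def)
  have "eqst Im (restr M Y) = restr N (up Y)"
    using substructure_restr[OF substructure_eqst[OF s good_Im]] unfolding car_up c .
  then show "strong Keq (restr N (up Y)) N" using strong_N_iff[OF s] by simp
qed

text \<open>\<open>f\<close> need not agree with one automorphism on all of \<open>S\<close>.
  Well-definedness of the induced map concerns two representatives at a time, and on their
  concatenation \<open>f\<close> does agree with an automorphism.\<close>

lemma type_map_lift:
  assumes S: "S \<subseteq> car M" and st: "\<And>a. set a \<subseteq> S \<Longrightarrow> same_type L M {} a (map f a)"
  obtains h where "lifts_on S f h"
proof -
  define h where "h x = (THE y. \<exists>E a. E \<in> \<E> \<and> a \<in> tuples (ar E) S \<and> x = Im E a \<and> y = Im E (map f a))" for x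
  have "h (Im E a) = Im E (map f a)" if E: "E \<in> \<E>" and a: "a \<in> tuples (ar E) S" for E a
    unfolding h_def
  proof (rule the_equality)
    show "\<exists>E' a'. E' \<in> \<E> \<and> a' \<in> tuples (ar E') S \<and> Im E a = Im E' a' \<and> Im E (map f a) = Im E' (map f a')"
      using E a by blast
    fix y assume "\<exists>E' a'. E' \<in> \<E> \<and> a' \<in> tuples (ar E') S \<and> Im E a = Im E' a' \<and> y = Im E' (map f a')"
    then obtain E' a' where E': "E' \<in> \<E>" "a' \<in> tuples (ar E') S" "Im E a = Im E' a'" "y = Im E' (map f a')" by blast
    have aM: "a \<in> tuples (ar E) (car M)" "a' \<in> tuples (ar E') (car M)"
      using a E'(2) tuples_mono[OF S] by blast+
    have aa: "set (a @ a') \<subseteq> S" using tuplesD(2)[OF a] tuplesD(2)[OF E'(2)] by simp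
    then have "set (a @ a') \<subseteq> car M" using S by blast
    from same_typeE[OF st[OF aa] M_struct this, of "{}"]
    obtain k where k: "k \<in> Aut L M {}" "map k (a @ a') = map f (a @ a')" by blast
    then have k2: "map k a = map f a" "map k a' = map f a'" by auto
    obtain g where g: "g \<in> Aut LE N (up {})" "lifts k g" using Aut_lift[OF k(1)] by blast
    have "g (Im E a) = Im E (map k a)" "g (Im E' a') = Im E' (map k a')"
      using g(2) aM E E'(1) unfolding lifts_on_def by blast+
    then show "y = Im E (map f a)" using E'(3,4) k2 by simp
  qed
  then have "lifts_on S f h" unfolding lifts_on_def by blast
  then show thesis by (rule that)
qed

text \<open>The domain is a union of sets \<open>up X\<close>, not \<open>up\<close> of the union.
  Each imaginary in it therefore has its representatives in the domain as well, and \<open>h\<close>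
  is computed on both by one automorphism.\<close>

lemma type_map_home:
  assumes S: "S = (\<Union>X\<in>\<S>. up X)" "\<And>X. X \<in> \<S> \<Longrightarrow> X \<subseteq> car M"
    and st: "\<And>a. set a \<subseteq> S \<Longrightarrow> same_type LE N {} a (map h a)" and X: "X \<in> \<S>"
  shows "lifts_on X (\<lambda>x. inv_into (car M) \<eta> (h (\<eta> x))) h"
    "x \<in> X \<Longrightarrow> inv_into (car M) \<eta> (h (\<eta> x)) \<in> car M \<and> \<eta> (inv_into (car M) \<eta> (h (\<eta> x))) = h (\<eta> x)"
proof -
  let ?f = "\<lambda>x. inv_into (car M) \<eta> (h (\<eta> x))"
  note XM = S(2)[OF X]
  have upS: "up X \<subseteq> S" unfolding S(1) using X by blast
  have upN: "up X \<subseteq> car N" by (rule up_subset_N[OF XM])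
  have k: "\<exists>g k. k \<in> Aut L M {} \<and> lifts k g \<and> map g w = map h w" if w: "set w \<subseteq> up X" for w
  proof -
    have "set w \<subseteq> S" "set w \<subseteq> car N" using w upS upN by blast+
    from same_typeE[OF st[OF this(1)] N_struct this(2), of "{}"]
    obtain g where g: "g \<in> Aut LE N {}" "map g w = map h w" by blast
    obtain k where "k \<in> Aut L M {x \<in> car M. \<eta> x \<in> {}}" "lifts k g" using Aut_home[OF g(1)] .
    then show ?thesis using g(2) Aut_mono[of k L M _ "{}"] by blast
  qed
  show f: "?f x \<in> car M \<and> \<eta> (?f x) = h (\<eta> x)" if x: "x \<in> X" for x
  proof -
    obtain g k where g: "k \<in> Aut L M {}" "lifts k g" "map g [\<eta> x] = map h [\<eta> x]"
      using k[of "[\<eta> x]"] eta_in_up[OF x] by auto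
    have xM: "x \<in> car M" using x XM by blast
    have "h (\<eta> x) = \<eta> (k x)" using g(3) lifts_eta[OF g(2) xM] by simp
    moreover have "k x \<in> car M" using Aut_image[OF g(1)] xM by blast
    ultimately have im: "h (\<eta> x) \<in> \<eta> ` car M" by blast
    show ?thesis using f_inv_into_f[OF im] inv_into_into[OF im] by blast
  qed
  show "lifts_on X ?f h" unfolding lifts_on_def
  proof (intro ballI)
    fix E a assume E: "E \<in> \<E>" and a: "a \<in> tuples (ar E) X"
    note aX = tuplesD(2)[OF a]
    \<comment> \<open>The imaginary and its representative are put into one tuple, so that a single
      \<open>g\<close> agrees with \<open>h\<close> on all of them.\<close>
    have "set (Im E a # map \<eta> a) \<subseteq> up X" using map_eta_in_up[OF aX] in_up[OF E a] by simp
    from k[OF this] obtain g k where g: "k \<in> Aut L M {}" "lifts k g" "g (Im E a) = h (Im E a)"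
      "map g (map \<eta> a) = map h (map \<eta> a)" by auto
    have "\<eta> (k x) = \<eta> (?f x)" if x: "x \<in> set a" for x
    proof -
      have "x \<in> X" "x \<in> car M" using x aX XM by auto
      then have "\<eta> (k x) = g (\<eta> x)" "\<eta> (?f x) = h (\<eta> x)" using lifts_eta[OF g(2)] f by auto
      moreover have "g (\<eta> x) = h (\<eta> x)" using g(4) x by simp
      ultimately show ?thesis by simp
    qed
    moreover have "k x \<in> car M" "?f x \<in> car M" if "x \<in> set a" for x
      using that aX XM Aut_image[OF g(1)] f by blast+
    ultimately have e: "map k a = map ?f a" using inj_onD[OF eta_inj] by simp
    have "a \<in> tuples (ar E) (car M)" using a tuples_mono[OF XM] by blast
    then have "g (Im E a) = Im E (map k a)" using g(2) E unfolding lifts_on_def by blast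
    then show "h (Im E a) = Im E (map ?f a)" unfolding g(3) e .
  qed
qed

lemma s_prime_up:
  assumes A: "model \<delta> \<K> M A" and C: "model \<delta> \<K> M C" and D: "s_prime \<delta> \<K> M {A, C} D"
  shows "s_prime \<delta> Keq N {eqst Im A, eqst Im C} (eqst Im D)"
proof -
  have Dm: "model \<delta> \<K> M D" and sub: "car A \<subseteq> car D" "car C \<subseteq> car D" using D unfolding s_prime_def by auto
  note AM = modelD(3)[OF A] and CM = modelD(3)[OF C]
  have U: "(\<Union>X\<in>{eqst Im A, eqst Im C}. car X) = up (car A) \<union> up (car C)" by (simp add: car_up)
  have U': "(\<Union>X\<in>{A, C}. car X) = car A \<union> car C" by simp
  show ?thesis unfolding s_prime_def U
  proof (intro conjI allI impI)
    show "model \<delta> Keq N (eqst Im D)" using Dm model_Keq by blast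
    show "up (car A) \<union> up (car C) \<subseteq> car (eqst Im D)"
      unfolding car_up using up_mono[OF sub(1)] up_mono[OF sub(2)] by blast
    fix Y h
    assume Y: "model \<delta> Keq N Y" and hY: "h ` (up (car A) \<union> up (car C)) \<subseteq> car Y"
      and we: "weakly_elementary Keq N {eqst Im A, eqst Im C} h"
    obtain B where B: "model \<delta> \<K> M B" "Y = eqst Im B" using Y model_Keq by blast
    note BM = modelD(3)[OF B(1)]
    have st: "same_type LE N {} a (map h a)" if "set a \<subseteq> (\<Union>X\<in>{car A, car C}. up X)" for a
      using we that unfolding weakly_elementary_def U by simp
    have SM: "X \<subseteq> car M" if "X \<in> {car A, car C}" for X using that AM CM by blast
    \<comment> \<open>The map \<open>h\<close> read on the home sort; this makes sense because
      type-preserving maps send home elements to home elements.\<close>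
    define f where "f = (\<lambda>x. inv_into (car M) \<eta> (h (\<eta> x)))"
    have tm: "lifts_on X f h" if X: "X \<in> {car A, car C}" for X
      unfolding f_def by (rule type_map_home(1)[where \<S> = "{car A, car C}", OF refl]) (fact SM st X)+
    have tm2: "f x \<in> car M \<and> \<eta> (f x) = h (\<eta> x)" if X: "X \<in> {car A, car C}" and x: "x \<in> X" for X x
      unfolding f_def by (rule type_map_home(2)[where \<S> = "{car A, car C}", OF refl]) (fact SM st X x)+
    have fM: "f x \<in> car M" "\<eta> (f x) = h (\<eta> x)" if "x \<in> car A \<union> car C" for x
      using that tm2[of "car A" x] tm2[of "car C" x] by auto
    have hf: "lifts_on (car A) f h" "lifts_on (car C) f h" using tm[of "car A"] tm[of "car C"] by auto
    have fB: "f ` (car A \<union> car C) \<subseteq> car B"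
    proof (rule image_subsetI)
      fix x assume x: "x \<in> car A \<union> car C"
      then have "\<eta> x \<in> up (car A) \<union> up (car C)" using eta_in_up[of x "car A"] eta_in_up[of x "car C"] by blast
      then have "\<eta> (f x) \<in> up (car B)" using hY fM(2)[OF x] unfolding B(2) car_up by auto
      then show "f x \<in> car B" using eta_up[OF BM fM(1)[OF x]] by blast
    qed
    have "weakly_elementary \<K> M {A, C} f" unfolding weakly_elementary_def U'
    proof (intro conjI allI impI ballI)
      show "f ` (car A \<union> car C) \<subseteq> car M" using fB BM by blast
      fix a assume a: "set a \<subseteq> car A \<union> car C"
      then have aM: "set a \<subseteq> car M" using AM CM by blast
      have "set (map \<eta> a) \<subseteq> up (car A) \<union> up (car C)"
        using a eta_in_up[of _ "car A"] eta_in_up[of _ "car C"] by auto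
      then have "same_type LE N {} (map \<eta> a) (map h (map \<eta> a))" by (intro st) simp
      moreover have "map h (map \<eta> a) = map \<eta> (map f a)" using fM(2) a by auto
      ultimately have "same_type LE N {} (map \<eta> a) (map \<eta> (map f a))" by (simp only:)
      moreover have "set (map f a) \<subseteq> car M" using fM(1) a by auto
      ultimately have "same_type L M {x \<in> car M. \<eta> x \<in> {}} a (map f a)"
        by (intro same_type_home[OF _ _ aM]) auto
      then show "same_type L M {} a (map f a)" by (rule same_type_mono) blast
    next
      fix X assume "X \<in> {A, C}"
      then have X: "lifts_on (car X) f h" "strong Keq (restr N (h ` up (car X))) N" "f ` car X \<subseteq> car M"
        using hf we fM(1) unfolding weakly_elementary_def by (auto simp: car_up)
      have "strong Keq (restr N (up (f ` car X))) N" using X(2) unfolding lifts_on_up[OF X(1)] .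
      then show "strong \<K> (restr M (f ` car X)) M" using strong_restr_up[OF X(3)] by blast
    qed
    then obtain g where g: "embedding \<K> g D B" "\<forall>x\<in>car A \<union> car C. g x = f x"
      using D B(1) fB unfolding s_prime_def U' by blast
    from embedding_lift[OF g(1) modelD(4)[OF Dm] modelD(4)[OF B(1)]]
    obtain G where G: "embedding Keq G (eqst Im D) (eqst Im B)"
      "\<forall>E\<in>\<E>. \<forall>a\<in>tuples (ar E) (car D). G (Im E a) = Im E (map g a)" .
    have "G x = h x" if X: "X \<in> {car A, car C}" and x: "x \<in> up X" for X x
    proof -
      have XD: "X \<subseteq> car D" and hX: "lifts_on X f h" using X sub hf by auto
      obtain E a where E: "E \<in> \<E>" and a: "a \<in> tuples (ar E) X" and xe: "x = Im E a"
        using x unfolding up_def by blast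
      have "a \<in> tuples (ar E) (car D)" using a tuples_mono[OF XD] by blast
      then have "G x = Im E (map g a)" unfolding xe using G(2) E by blast
      also have "map g a = map f a" using g(2) tuplesD(2)[OF a] X by auto
      also have "Im E (map f a) = h x" using hX E a unfolding xe lifts_on_def by simp
      finally show ?thesis .
    qed
    then have "\<forall>x\<in>up (car A) \<union> up (car C). G x = h x" by blast
    then show "\<exists>g. embedding Keq g (eqst Im D) Y \<and> (\<forall>x\<in>up (car A) \<union> up (car C). g x = h x)"
      using G(1) B(2) by blast
  qed
qed

text \<open>This direction is for uniqueness in (AIII): a competing s-prime model of imaginaries
  descends to a competitor of \<open>D\<close> in the home sort.\<close>

lemma s_prime_home:
  assumes A: "model \<delta> \<K> M A" and C: "model \<delta> \<K> M C" and Dm: "model \<delta> \<K> M D"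
    and D: "s_prime \<delta> Keq N {eqst Im A, eqst Im C} (eqst Im D)"
  shows "s_prime \<delta> \<K> M {A, C} D"
proof -
  note AM = modelD(3)[OF A] and CM = modelD(3)[OF C] and DM = modelD(3)[OF Dm]
  have U: "(\<Union>X\<in>{eqst Im A, eqst Im C}. car X) = up (car A) \<union> up (car C)" by (simp add: car_up)
  have U': "(\<Union>X\<in>{A, C}. car X) = car A \<union> car C" by simp
  have "up (car A) \<subseteq> up (car D)" "up (car C) \<subseteq> up (car D)" using D unfolding s_prime_def U car_up by blast+
  then have sub: "car A \<subseteq> car D" "car C \<subseteq> car D" using up_subset_iff[OF AM DM] up_subset_iff[OF CM DM] by blast+
  show ?thesis unfolding s_prime_def U'
  proof (intro conjI allI impI)
    show "model \<delta> \<K> M D" by fact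
    show "car A \<union> car C \<subseteq> car D" using sub by blast
    fix B f
    assume B: "model \<delta> \<K> M B" and fB: "f ` (car A \<union> car C) \<subseteq> car B" and we: "weakly_elementary \<K> M {A, C} f"
    note BM = modelD(3)[OF B]
    let ?S = "car A \<union> car C"
    have SM: "?S \<subseteq> car M" using AM CM by blast
    have st: "same_type L M {} a (map f a)" if "set a \<subseteq> ?S" for a
      using we that unfolding weakly_elementary_def U' by blast
    \<comment> \<open>Working over \<open>?S\<close> allows a tuple of imaginaries taken from both
      models to be lifted to a single home tuple.\<close>
    obtain h where h: "lifts_on ?S f h" using type_map_lift[OF SM st] by blast
    have hA: "lifts_on (car A) f h" "lifts_on (car C) f h" using lifts_on_mono[OF h] by blast+
    have im: "h ` up (car A) = up (f ` car A)" "h ` up (car C) = up (f ` car C)"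
      by (rule lifts_on_up[OF hA(1)], rule lifts_on_up[OF hA(2)])
    have fA: "f ` car A \<subseteq> car B" "f ` car C \<subseteq> car B" using fB by auto
    have hB: "h ` (up (car A) \<union> up (car C)) \<subseteq> up (car B)"
      unfolding image_Un im using up_mono[OF fA(1)] up_mono[OF fA(2)] by blast
    have "weakly_elementary Keq N {eqst Im A, eqst Im C} h"
      unfolding weakly_elementary_def U voc_Keq
    proof (intro conjI allI impI ballI)
      show "h ` (up (car A) \<union> up (car C)) \<subseteq> car N" using hB up_subset_N[OF BM] by blast
      fix x assume "set x \<subseteq> up (car A) \<union> up (car C)"
      then have "set x \<subseteq> up ?S" using up_mono[of "car A" ?S] up_mono[of "car C" ?S] by blast
      then obtain a \<tau> where a: "set a \<subseteq> ?S" "terms (length a) \<tau>" "x = ev \<tau> a" using ev_exists by blast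
      have aM: "set a \<subseteq> car M" using a(1) SM by blast
      have "same_type LE N (up {}) (ev \<tau> a) (ev \<tau> (map f a))"
        by (rule same_type_ev[OF st[OF a(1)] aM _ a(2)]) blast
      then have "same_type LE N {} (ev \<tau> a) (ev \<tau> (map f a))" by (rule same_type_mono) blast
      then show "same_type LE N {} x (map h x)" unfolding a(3) ev_lifts[OF h a(1,2)] .
    next
      fix X assume "X \<in> {eqst Im A, eqst Im C}"
      then have "\<exists>Y\<in>{A, C}. X = eqst Im Y" by blast
      then obtain Y where YAC: "Y \<in> {A, C}" and Xe: "X = eqst Im Y" by blast
      have Y: "X = eqst Im Y" "h ` up (car Y) = up (f ` car Y)" "f ` car Y \<subseteq> car M"
        "strong \<K> (restr M (f ` car Y)) M"
        using Xe YAC im fA BM we unfolding weakly_elementary_def by auto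
      show "strong Keq (restr N (h ` car X)) N"
        unfolding Y(1) car_up Y(2) using strong_restr_up[OF Y(3)] Y(4) by blast
    qed
    moreover have "model \<delta> Keq N (eqst Im B)" using B model_Keq by blast
    ultimately obtain G where G: "embedding Keq G (eqst Im D) (eqst Im B)"
      "\<forall>x\<in>up (car A) \<union> up (car C). G x = h x" using D hB unfolding s_prime_def U by (metis car_up)
    from embedding_home[OF G(1) modelD(2)[OF Dm] modelD(4)[OF Dm] modelD(2)[OF B] modelD(4)[OF B]]
    obtain g where g: "embedding \<K> g D B" "\<forall>x\<in>car D. \<eta> (g x) = G (\<eta> x)" .
    have "g x = f x" if x: "x \<in> ?S" for x
    proof -
      have xD: "x \<in> car D" using x sub by blast
      have "\<eta> x \<in> up (car A) \<union> up (car C)" using x eta_in_up[of x "car A"] eta_in_up[of x "car C"] by blast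
      then have "\<eta> (g x) = h (\<eta> x)" using g(2) G(2) xD by simp
      also have "\<dots> = \<eta> (f x)" by (rule lifts_eta[OF h x])
      finally have "\<eta> (g x) = \<eta> (f x)" .
      moreover have "g x \<in> car M" using embedding_image[OF g(1)] xD BM by blast
      moreover have "f x \<in> car M" using fB x BM by blast
      ultimately show ?thesis using inj_onD[OF eta_inj] by blast
    qed
    then show "\<exists>g. embedding \<K> g D B \<and> (\<forall>x\<in>car A \<union> car C. g x = f x)" using g(1) by blast
  qed
qed

lemma AIII_Keq: "AIII \<delta> Keq N" unfolding AIII_def voc_Keq
proof (intro allI impI)
  fix X Y Z
  assume X: "model \<delta> Keq N X" and Y: "model \<delta> Keq N Y" and Z: "model \<delta> Keq N Z"
    and i: "indep_set LE N (car X) (car Y) (car Z)" and e: "car Y = car X \<inter> car Z"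
  obtain A where A: "model \<delta> \<K> M A" "X = eqst Im A" using X model_Keq by blast
  obtain B where B: "model \<delta> \<K> M B" "Y = eqst Im B" using Y model_Keq by blast
  obtain C where C: "model \<delta> \<K> M C" "Z = eqst Im C" using Z model_Keq by blast
  note AM = modelD(3)[OF A(1)] and BM = modelD(3)[OF B(1)] and CM = modelD(3)[OF C(1)]
  have BAC: "car B = car A \<inter> car C"
  proof (intro set_eqI)
    fix x
    have "x \<in> car B \<longleftrightarrow> x \<in> car M \<and> \<eta> x \<in> up (car B)" using eta_up_iff[OF BM, of x] BM by blast
    also have "\<dots> \<longleftrightarrow> x \<in> car M \<and> \<eta> x \<in> up (car A) \<and> \<eta> x \<in> up (car C)"
      using e unfolding A(2) B(2) C(2) car_up by simp
    also have "\<dots> \<longleftrightarrow> x \<in> car A \<inter> car C" using eta_up_iff[OF AM, of x] eta_up_iff[OF CM, of x] AM by blast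
    finally show "x \<in> car B \<longleftrightarrow> x \<in> car A \<inter> car C" .
  qed
  have BC: "car B \<subseteq> car C" using BAC by blast
  have "indep_set L M (car A) (car B) (car C)"
    by (rule indep_set_home[OF _ CM BC AM]) (use i in \<open>simp add: A(2) B(2) C(2) car_up\<close>)
  then obtain D where D: "s_prime \<delta> \<K> M {A, C} D" "\<forall>D'. s_prime \<delta> \<K> M {A, C} D' \<longrightarrow> D' = D"
    "\<forall>C'. model \<delta> \<K> M C' \<longrightarrow> car C \<subseteq> car C' \<longrightarrow> indep_set L M (car A) (car B) (car C') \<longrightarrow>
       indep_set L M (car D) (car C) (car C')"
    using AIII A(1) B(1) C(1) BAC unfolding AIII_def by metis
  have Dm: "model \<delta> \<K> M D" using D(1) unfolding s_prime_def by blast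
  show "\<exists>D. s_prime \<delta> Keq N {X, Z} D \<and> (\<forall>D'. s_prime \<delta> Keq N {X, Z} D' \<longrightarrow> D' = D) \<and>
      (\<forall>C'. model \<delta> Keq N C' \<longrightarrow> car Z \<subseteq> car C' \<longrightarrow> indep_set LE N (car X) (car Y) (car C') \<longrightarrow>
        indep_set LE N (car D) (car Z) (car C'))"
  proof (intro exI[of _ "eqst Im D"] conjI allI impI)
    show "s_prime \<delta> Keq N {X, Z} (eqst Im D)" unfolding A(2) C(2) by (rule s_prime_up[OF A(1) C(1) D(1)])
    fix W assume W: "s_prime \<delta> Keq N {X, Z} W"
    then have "model \<delta> Keq N W" unfolding s_prime_def by blast
    then obtain D' where D': "model \<delta> \<K> M D'" "W = eqst Im D'" using model_Keq by blast
    have "s_prime \<delta> \<K> M {A, C} D'"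
      by (rule s_prime_home[OF A(1) C(1) D'(1)]) (use W in \<open>simp add: A(2) C(2) D'(2)\<close>)
    then show "W = eqst Im D" using D(2) D'(2) by blast
  next
    fix W assume W: "model \<delta> Keq N W" "car Z \<subseteq> car W" "indep_set LE N (car X) (car Y) (car W)"
    obtain C' where C': "model \<delta> \<K> M C'" "W = eqst Im C'" using W(1) model_Keq by blast
    note C'M = modelD(3)[OF C'(1)]
    have CC': "car C \<subseteq> car C'" using W(2) up_subset_iff[OF CM C'M] unfolding C(2) C'(2) car_up by blast
    have "indep_set L M (car A) (car B) (car C')"
      by (rule indep_set_home[OF _ C'M _ AM]) (use W(3) BC CC' in \<open>auto simp: A(2) B(2) C'(2) car_up\<close>)
    then have "indep_set L M (car D) (car C) (car C')" using D(3) C'(1) CC' by blast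
    then show "indep_set LE N (car (eqst Im D)) (car Z) (car W)"
      unfolding C(2) C'(2) car_up by (rule indep_set_up[OF _ modelD(1)[OF C'(1)] CC' modelD(3)[OF Dm]])
  qed
qed

end

section \<open>The game and primary models\<close>

text \<open>The game by backward induction on positions. Strategies in \<open>II_wins\<close> depend
  on the whole history, which is awkward when plays of two games are matched move by move.\<close>

fun II_wins_within :: "('f, 'r) vocab \<Rightarrow> ('f, 'r, 'a) struct \<Rightarrow> 'a set \<Rightarrow> nat \<Rightarrow> 'a list \<times> 'a set \<Rightarrow> bool" where
  "II_wins_within L M X 0 p \<longleftrightarrow> (\<forall>m. \<not> gi_move L M X p m)"
| "II_wins_within L M X (Suc n) p \<longleftrightarrow> (\<forall>m. gi_move L M X p m \<longrightarrow>
     (\<exists>B. finite B \<and> snd m \<subseteq> B \<and> B \<subseteq> X \<and> II_wins_within L M X n (fst m, B)))"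

lemma II_wins_withinE:
  assumes "II_wins_within L M X (Suc n) p" "gi_move L M X p (x, H)"
  obtains B where "finite B" "H \<subseteq> B" "B \<subseteq> X" "II_wins_within L M X n (x, B)"
  using assms(1)[unfolded II_wins_within.simps, rule_format, OF assms(2)] by auto

lemma II_wins_iff: "II_wins L M X a A n \<longleftrightarrow> II_wins_within L M X n (a, A)"
proof
  assume "II_wins L M X a A n"
  then obtain \<sigma> where \<sigma>: "\<And>ms. gi_play L M X a A \<sigma> ms \<Longrightarrow> length ms \<le> n"
    "\<And>ms. gi_play L M X a A \<sigma> ms \<Longrightarrow> ms \<noteq> [] \<Longrightarrow> finite (\<sigma> ms) \<and> snd (last ms) \<subseteq> \<sigma> ms \<and> \<sigma> ms \<subseteq> X"
    unfolding II_wins_def by blast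
  have "II_wins_within L M X k (gi_pos a A \<sigma> ms)" if "gi_play L M X a A \<sigma> ms" "length ms + k = n" for k ms
    using that
  proof (induction k arbitrary: ms)
    case 0
    have "\<not> gi_move L M X (gi_pos a A \<sigma> ms) m" for m
    proof
      assume "gi_move L M X (gi_pos a A \<sigma> ms) m"
      from \<sigma>(1)[OF gi_step[OF 0(1) this]] 0(2) show False by simp
    qed
    then show ?case by simp
  next
    case (Suc k)
    have "\<exists>B. finite B \<and> snd m \<subseteq> B \<and> B \<subseteq> X \<and> II_wins_within L M X k (fst m, B)"
      if m: "gi_move L M X (gi_pos a A \<sigma> ms) m" for m
    proof -
      note p = gi_step[OF Suc.prems(1) m]
      have "II_wins_within L M X k (gi_pos a A \<sigma> (ms @ [m]))" by (rule Suc.IH[OF p]) (use Suc.prems(2) in simp)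
      then show ?thesis using \<sigma>(2)[OF p] by (intro exI[of _ "\<sigma> (ms @ [m])"]) (simp add: gi_pos_def)
    qed
    then show ?case by simp
  qed
  from this[OF gi_start, of n] show "II_wins_within L M X n (a, A)" by (simp add: gi_pos_def)
next
  assume w: "II_wins_within L M X n (a, A)"
  \<comment> \<open>The legal answers after which the position is won within the moves that remain;
    \<open>\<sigma>\<close> picks one of them.\<close>
  define P where "P ms B \<longleftrightarrow> finite B \<and> snd (last ms) \<subseteq> B \<and> B \<subseteq> X \<and>
    II_wins_within L M X (n - length ms) (fst (last ms), B)" for ms B
  define \<sigma> where "\<sigma> ms = (SOME B. P ms B)" for ms
  have "length ms \<le> n \<and> II_wins_within L M X (n - length ms) (gi_pos a A \<sigma> ms) \<and> (ms \<noteq> [] \<longrightarrow> P ms (\<sigma> ms))"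
    if "gi_play L M X a A \<sigma> ms" for ms using that
  proof induction
    case gi_start
    then show ?case using w by (simp add: gi_pos_def)
  next
    case (gi_step ms m)
    \<comment> \<open>A position won within zero moves admits no move of player I, but one has just
      been made. So the truncated subtraction has not reached zero.\<close>
    then have "n - length ms \<noteq> 0" by (metis II_wins_within.simps(1))
    then obtain k where k: "n - length ms = Suc k" using not0_implies_Suc by blast
    then have k': "n - length (ms @ [m]) = k" by simp
    have "\<exists>B. P (ms @ [m]) B" unfolding P_def k' using gi_step unfolding k by simp
    then have "P (ms @ [m]) (\<sigma> (ms @ [m]))" unfolding \<sigma>_def by (rule someI_ex)
    then show ?case using k unfolding P_def by (simp add: gi_pos_def)
  qed
  then show "II_wins L M X a A n" unfolding II_wins_def P_def by blast
qed

section \<open>Invariance of the game under automorphisms\<close>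

lemma same_type_Aut:
  assumes M: "is_struct L M" and k: "k \<in> Aut L M {}" and a: "set a \<subseteq> car M" and A: "A \<subseteq> car M"
    and st: "same_type L M A a b"
  shows "same_type L M (k ` A) (map k a) (map k b)"
proof -
  have kA: "k ` A \<subseteq> car M" using A Aut_image[OF k] by blast
  show ?thesis
  proof (rule same_typeI[OF M Aut_map_closed[OF k a] kA])
    fix B assume "B \<subseteq> k ` A" "finite B"
    then obtain C where C: "C \<subseteq> A" "finite C" "B = k ` C" using finite_subset_image by metis
    obtain g where g: "g \<in> Aut L M C" "map g a = b" using same_typeE[OF st M a A C(1,2)] .
    define l where "l = inv_into (car M) k"
    have l: "l \<in> Aut L M {}" unfolding l_def by (rule Aut_inv[OF M k]) simp
    have g0: "g \<in> Aut L M {}" by (rule Aut_mono[OF g(1)]) simp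
    have "k \<circ> (g \<circ> l) \<in> Aut L M {}" using Aut_comp[OF M Aut_comp[OF M l g0] k] .
    moreover have lk: "l (k x) = x" if "x \<in> car M" for x
      unfolding l_def using inv_into_f_f[OF Aut_inj[OF k] that] .
    moreover have "g x = x" if "x \<in> C" for x by (rule Aut_fix[OF g(1) that])
    ultimately have "k \<circ> (g \<circ> l) \<in> Aut L M B" using C(1,3) A unfolding Aut_def by auto
    moreover have "map (k \<circ> (g \<circ> l)) (map k a) = map k b" using lk a g(2) by (auto simp: subset_iff)
    ultimately show "\<exists>h\<in>Aut L M B. map h (map k a) = map k b" by blast
  qed
qed

text \<open>Every move in the image game is pulled back by the inverse \<open>l\<close>, answered
  there, and the answer is pushed forward by \<open>k\<close>.\<close>

lemma II_wins_within_Aut: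
  assumes M: "is_struct L M" and k: "k \<in> Aut L M {}" and X: "X \<subseteq> car M"
    and a: "set a \<subseteq> car M" and A: "A \<subseteq> X" and w: "II_wins_within L M X n (a, A)"
  shows "II_wins_within L M (k ` X) n (map k a, k ` A)"
proof -
  define l where "l = inv_into (car M) k"
  have l: "l \<in> Aut L M {}" unfolding l_def by (rule Aut_inv[OF M k]) simp
  have lk: "l (k x) = x" if "x \<in> car M" for x
    unfolding l_def using inv_into_f_f[OF Aut_inj[OF k] that] .
  have kl: "k (l x) = x" if "x \<in> car M" for x
    unfolding l_def using f_inv_into_f[of x k "car M"] Aut_image[OF k] that by simp
  have lks: "l ` k ` Y = Y" "k ` l ` Y = Y" if "Y \<subseteq> car M" for Y
    using that lk kl by (force simp: image_iff)+
  have kX: "k ` X \<subseteq> car M" using X Aut_image[OF k] by blast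
  have mv: "gi_move L M X (a, A) (map l (fst m), l ` snd m) \<and> m = (map k (map l (fst m)), k ` l ` snd m)"
    if a: "set a \<subseteq> car M" and A: "A \<subseteq> X" and m: "gi_move L M (k ` X) (map k a, k ` A) m" for a A m
  proof -
    have m1: "set (fst m) \<subseteq> car M" and m2: "finite (snd m)" "k ` A \<subseteq> snd m" "snd m \<subseteq> k ` X"
      and s: "same_type L M (k ` A) (fst m) (map k a)" "\<not> same_type L M (snd m) (fst m) (map k a)"
      using m unfolding gi_move_def by auto
    have AM: "A \<subseteq> car M" and kAM: "k ` A \<subseteq> car M" and m2M: "snd m \<subseteq> car M" using A X kX m2 by auto
    have la: "map l (map k a) = a" using lk a by (auto intro!: map_idI)
    have lm: "map k (map l (fst m)) = fst m" using kl m1 by (auto intro!: map_idI)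
    have "same_type L M (l ` k ` A) (map l (fst m)) (map l (map k a))"
      by (rule same_type_Aut[OF M l m1 kAM s(1)])
    then have 1: "same_type L M A (map l (fst m)) a" using lks(1)[OF AM] la by simp
    have 2: "\<not> same_type L M (l ` snd m) (map l (fst m)) a"
    proof
      assume st: "same_type L M (l ` snd m) (map l (fst m)) a"
      have "set (map l (fst m)) \<subseteq> car M" by (rule Aut_map_closed[OF l m1])
      moreover have "l ` snd m \<subseteq> car M" using m2M Aut_image[OF l] by blast
      ultimately have "same_type L M (k ` l ` snd m) (map k (map l (fst m))) (map k a)"
        using same_type_Aut[OF M k _ _ st] by blast
      then show False using s(2) lm lks(2)[OF m2M] by simp
    qed
    have "l ` snd m \<subseteq> X" using m2(3) lks(1)[OF X] by blast
    moreover have "A \<subseteq> l ` snd m" using m2(2) lks(1)[OF AM] by blast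
    ultimately show ?thesis unfolding gi_move_def using 1 2 Aut_map_closed[OF l m1] m2(1) lm lks(2)[OF m2M]
      by simp
  qed
  show ?thesis using a A w
  proof (induction n arbitrary: a A)
    case 0
    then show ?case using mv by simp blast
  next
    case (Suc n)
    have "\<exists>B. finite B \<and> snd m \<subseteq> B \<and> B \<subseteq> k ` X \<and> II_wins_within L M (k ` X) n (fst m, B)"
      if m: "gi_move L M (k ` X) (map k a, k ` A) m" for m
    proof -
      note mv = mv[OF Suc.prems(1,2) m]
      obtain B where B: "finite B" "l ` snd m \<subseteq> B" "B \<subseteq> X" "II_wins_within L M X n (map l (fst m), B)"
        using II_wins_withinE[OF Suc.prems(3) mv[THEN conjunct1]] .
      have "set (map l (fst m)) \<subseteq> car M" using mv unfolding gi_move_def by simp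
      from Suc.IH[OF this B(3,4)]
      have "II_wins_within L M (k ` X) n (fst m, k ` B)" using mv by (metis fst_conv)
      moreover have "snd m \<subseteq> k ` B" using mv B(2) by (metis image_mono snd_conv)
      ultimately show ?thesis using B(1,3) by blast
    qed
    then show ?case by simp
  qed
qed

context fur_eq
begin

lemma model_Aut:
  assumes A: "model \<delta> \<K> M A" and k: "k \<in> Aut L M {}"
  shows "model \<delta> \<K> M (copy k A)"
proof -
  have ki: "inj_on k (car M)" "copy k M = M" using k Aut_iff[OF M_struct] by blast+
  have s: "strong \<K> (copy k A) M" using copy_strong[OF modelD(1)[OF A] ki(1)] ki(2) by simp
  have "|car A| <o \<delta>" using A by (simp add: model_def)
  then have "|car (copy k A)| <o \<delta>" using ordLeq_ordLess_trans[OF card_of_image] by simp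
  then show ?thesis unfolding model_def using s strongD(1) by blast
qed

text \<open>The bound in (AIV) depends on the tuple, and player I replaces it by conjugates. The
  game for \<open>map k a\<close> in a model is the game for \<open>a\<close> in the conjugate
  model, so the bound for \<open>a\<close> serves all of them.\<close>

lemma AIV_Aut:
  assumes a: "set a \<subseteq> car M"
  shows "\<exists>n. \<forall>k\<in>Aut L M {}. \<forall>\<A> A. model \<delta> \<K> M \<A> \<longrightarrow> countable (car \<A>) \<longrightarrow> A \<subseteq> car \<A> \<longrightarrow> finite A \<longrightarrow>
    II_wins_within L M (car \<A>) n (map k a, A)"
proof -
  obtain n where n: "\<And>\<A> A. model \<delta> \<K> M \<A> \<Longrightarrow> countable (car \<A>) \<Longrightarrow> A \<subseteq> car \<A> \<Longrightarrow> finite A \<Longrightarrow>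
      II_wins_within L M (car \<A>) n (a, A)" using AIV a unfolding AIV_def II_wins_iff by blast
  have "II_wins_within L M (car \<A>) n (map k a, A)"
    if k: "k \<in> Aut L M {}" and \<A>: "model \<delta> \<K> M \<A>" "countable (car \<A>)" and A: "A \<subseteq> car \<A>" "finite A" for k \<A> A
  proof -
    define l where "l = inv_into (car M) k"
    have l: "l \<in> Aut L M {}" unfolding l_def by (rule Aut_inv[OF M_struct k]) simp
    have kl: "k ` l ` Y = Y" if "Y \<subseteq> car M" for Y
      unfolding l_def using that Aut_image[OF k] image_inv_into_cancel by metis
    have "II_wins_within L M (l ` car \<A>) n (a, l ` A)"
      using n[OF model_Aut[OF \<A>(1) l], of "l ` A"] \<A>(2) A by (simp add: image_mono)
    moreover have "l ` car \<A> \<subseteq> car M" using modelD(3)[OF \<A>(1)] Aut_image[OF l] by blast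
    ultimately have "II_wins_within L M (k ` l ` car \<A>) n (map k a, k ` l ` A)"
      by (intro II_wins_within_Aut[OF M_struct k _ a image_mono[OF A(1)]])
    then show ?thesis using kl modelD(3)[OF \<A>(1)] A(1) by auto
  qed
  then show ?thesis by blast
qed

text \<open>The new tuple \<open>x\<close> is the image of the old one under an automorphism over
  \<open>G\<close>, whose home part fixes \<open>A\<close>; its value at \<open>a\<close> is a lift
  of \<open>x\<close>. The lifts differ over any \<open>Z\<close> with \<open>H\<close> inside
  \<open>up Z\<close>, since equal types would go up.\<close>

lemma gi_move_home:
  assumes X: "X \<subseteq> car M" and a: "set a \<subseteq> car M" and t: "terms (length a) \<tau>"
    and A: "A \<subseteq> X" "finite A" and G: "\<eta> ` A \<subseteq> G" "finite G"
    and mv: "gi_move LE N (up X) (ev \<tau> a, G) (x, H)"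
  obtains a' Z k where "gi_move L M X (a, A) (a', Z)" "x = ev \<tau> a'" "H \<subseteq> up Z"
    "k \<in> Aut L M {}" "a' = map k a"
proof -
  have m: "set x \<subseteq> car N" "finite H" "G \<subseteq> H" "H \<subseteq> up X" "same_type LE N G x (ev \<tau> a)"
    "\<not> same_type LE N H x (ev \<tau> a)" using mv unfolding gi_move_def by auto
  have AM: "A \<subseteq> car M" using A(1) X by blast
  have GN: "G \<subseteq> car N" using m(3,4) up_subset_N[OF X] by blast
  have eN: "set (ev \<tau> a) \<subseteq> car N" using ev_in_up[OF t a] unfolding car_up .
  from same_typeE[OF same_type_sym[OF m(5)] N_struct eN GN order_refl G(2)]
  obtain h where h: "h \<in> Aut LE N G" "map h (ev \<tau> a) = x" .
  obtain k where k: "k \<in> Aut L M {x \<in> car M. \<eta> x \<in> G}" "lifts k h" using Aut_home[OF h(1)] .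
  have kA: "k \<in> Aut L M A" by (rule Aut_mono[OF k(1)]) (use AM G(1) in blast)
  let ?a = "map k a"
  have aM: "set ?a \<subseteq> car M" by (rule Aut_map_closed[OF kA a])
  have x: "x = ev \<tau> ?a" using ev_lifts[OF k(2) a t] h(2) by simp
  obtain Z0 where Z0: "Z0 \<subseteq> X" "finite Z0" "H \<subseteq> up Z0" using up_finite[OF m(2,4)] by blast
  let ?Z = "Z0 \<union> A"
  have HZ: "H \<subseteq> up ?Z" using Z0(3) up_mono[of Z0 ?Z] by blast
  have ZM: "?Z \<subseteq> car M" using Z0(1) A(1) X by blast
  have "same_type L M A a ?a" using same_type_finite[OF M_struct a AM A(2)] kA by blast
  moreover have "\<not> same_type L M ?Z ?a a"
  proof
    assume "same_type L M ?Z ?a a"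
    from same_type_ev[OF this aM ZM, of \<tau>] t have "same_type LE N (up ?Z) (ev \<tau> ?a) (ev \<tau> a)" by simp
    then show False using m(6) same_type_mono[OF _ HZ] unfolding x by blast
  qed
  ultimately have "gi_move L M X (a, A) (?a, ?Z)"
    unfolding gi_move_def using aM Z0(1,2) A same_type_sym[of L M A a ?a] by auto
  then show thesis using that x HZ Aut_mono[OF kA, of "{}"] by blast
qed

lemma II_wins_within_ev:
  assumes X: "X \<subseteq> car M" and a: "set a \<subseteq> car M" and t: "terms (length a) \<tau>"
    and A: "A \<subseteq> X" "finite A" and G: "\<eta> ` A \<subseteq> G" "finite G"
    and w: "II_wins_within L M X n (a, A)"
  shows "II_wins_within LE N (up X) n (ev \<tau> a, G)"
  using a t A G w
proof (induction n arbitrary: a A G)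
  case (0 a A G)
  have "\<not> gi_move LE N (up X) (ev \<tau> a, G) m" for m
  proof
    assume "gi_move LE N (up X) (ev \<tau> a, G) m"
    then have "gi_move LE N (up X) (ev \<tau> a, G) (fst m, snd m)" by simp
    from gi_move_home[OF X 0(1-6) this] show False using 0(7) by (metis II_wins_within.simps(1))
  qed
  then show ?case by simp
next
  case (Suc n a A G)
  have "\<exists>B. finite B \<and> snd m \<subseteq> B \<and> B \<subseteq> up X \<and> II_wins_within LE N (up X) n (fst m, B)"
    if "gi_move LE N (up X) (ev \<tau> a, G) m" for m
  proof -
    from that have mv: "gi_move LE N (up X) (ev \<tau> a, G) (fst m, snd m)" by simp
    from gi_move_home[OF X Suc.prems(1-6) mv]
    obtain a' Z k where Z: "gi_move L M X (a, A) (a', Z)" "fst m = ev \<tau> a'" "snd m \<subseteq> up Z"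
      "k \<in> Aut L M {}" "a' = map k a" .
    obtain B where B: "finite B" "Z \<subseteq> B" "B \<subseteq> X" "II_wins_within L M X n (a', B)"
      using II_wins_withinE[OF Suc.prems(7) Z(1)] .
    have a': "set a' \<subseteq> car M" "terms (length a') \<tau>"
      using Z(5) Aut_map_closed[OF Z(4) Suc.prems(1)] Suc.prems(2) by auto
    have H: "finite (snd m)" "snd m \<subseteq> up X" using mv unfolding gi_move_def by auto
    \<comment> \<open>The answer has to contain the set chosen by player I. The copy of the home
      answer is added to keep the induction hypothesis: the home parameters are named in the
      imaginary position.\<close>
    let ?B = "snd m \<union> \<eta> ` B"
    have "II_wins_within LE N (up X) n (fst m, ?B)" unfolding Z(2)
      by (rule Suc.IH[OF a' B(3,1) _ _ B(4)]) (use H(1) B(1) in auto)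
    moreover have "\<eta> ` B \<subseteq> up X" using eta_subset_up[of B] up_mono[OF B(3)] by blast
    ultimately show ?thesis using H B(1) by (intro exI[of _ ?B]) blast
  qed
  then show ?case by simp
qed

lemma AIV_Keq: "AIV \<delta> Keq N" unfolding AIV_def voc_Keq II_wins_iff
proof (intro allI impI)
  fix x assume "set x \<subseteq> car N"
  then obtain a \<tau> where a: "set a \<subseteq> car M" "terms (length a) \<tau>" "x = ev \<tau> a"
    using ev_exists[of x "car M"] unfolding car_up by blast
  from AIV_Aut[OF a(1)]
  obtain n where n: "\<forall>k\<in>Aut L M {}. \<forall>\<A> A. model \<delta> \<K> M \<A> \<longrightarrow> countable (car \<A>) \<longrightarrow> A \<subseteq> car \<A> \<longrightarrow>
      finite A \<longrightarrow> II_wins_within L M (car \<A>) n (map k a, A)" ..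
  show "\<exists>n. \<forall>\<A> A. model \<delta> Keq N \<A> \<longrightarrow> countable (car \<A>) \<longrightarrow> A \<subseteq> car \<A> \<longrightarrow> finite A \<longrightarrow>
      II_wins_within LE N (car \<A>) n (x, A)"
  \<comment> \<open>The additional move is the first one of player I. It yields a conjugate
    \<open>a'\<close> of \<open>a\<close> that lifts the new tuple, and from \<open>a'\<close> with
    no home parameters the uniform bound \<open>n\<close> applies.\<close>
  proof (intro exI[of _ "Suc n"] allI impI)
    fix Y F assume Y: "model \<delta> Keq N Y" "countable (car Y)" and F: "F \<subseteq> car Y" "finite F"
    obtain C where C: "model \<delta> \<K> M C" "Y = eqst Im C" using Y(1) model_Keq by blast
    have cC: "countable (car C)" using Y(2) countable_model[OF C(1)] C(2) by blast
    note CM = modelD(3)[OF C(1)]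
    have "\<exists>B. finite B \<and> snd m \<subseteq> B \<and> B \<subseteq> up (car C) \<and> II_wins_within LE N (up (car C)) n (fst m, B)"
      if "gi_move LE N (up (car C)) (x, F) m" for m
    proof -
      from that have mv: "gi_move LE N (up (car C)) (ev \<tau> a, F) (fst m, snd m)" using a(3) by simp
      have e: "{} \<subseteq> car C" "finite ({} :: 'a set)" "\<eta> ` {} \<subseteq> F" by auto
      from gi_move_home[OF CM a(1,2) e F(2) mv]
      obtain a' Z k where Z: "gi_move L M (car C) (a, {}) (a', Z)" "fst m = ev \<tau> a'" "snd m \<subseteq> up Z"
        "k \<in> Aut L M {}" "a' = map k a" .
      have a': "set a' \<subseteq> car M" "terms (length a') \<tau>"
        using Z(5) Aut_map_closed[OF Z(4) a(1)] a(2) by auto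
      have H: "finite (snd m)" "snd m \<subseteq> up (car C)" using mv unfolding gi_move_def by auto
      have "II_wins_within LE N (up (car C)) n (fst m, snd m)" unfolding Z(2)
        by (rule II_wins_within_ev[OF CM a' e(1,2) _ H(1)]) (use n[rule_format, OF Z(4) C(1) cC e(1,2)] Z(5) in auto)
      then show ?thesis using H by blast
    qed
    then show "II_wins_within LE N (car Y) (Suc n) (x, F)" unfolding C(2) car_up by simp
  qed
qed

text \<open>If no lift of \<open>x\<close> were isolated over \<open>C x\<close>, player I could always move to another lift of a
  tuple with the weak type of \<open>x\<close>, contradicting (AIV).\<close>

lemma isolated_lift:
  assumes C: "model \<delta> \<K> M C" "countable (car C)" and x: "set x \<subseteq> car N"
  obtains a \<tau> A where "set a \<subseteq> car M" "terms (length a) \<tau>" "x = ev \<tau> a" "A \<subseteq> car C" "finite A"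
    "\<And>b. set b \<subseteq> car M \<Longrightarrow> same_type LE N (up (car C)) (ev \<tau> b) x \<Longrightarrow> same_type L M A b a \<Longrightarrow>
       same_type L M (car C) b a"
proof -
  note CM = modelD(3)[OF C(1)]
  obtain c \<tau> where c: "set c \<subseteq> car M" "terms (length c) \<tau>" "x = ev \<tau> c"
    using ev_exists[of x "car M"] x unfolding car_up by blast
  have "\<exists>a A. set a \<subseteq> car M \<and> terms (length a) \<tau> \<and> x = ev \<tau> a \<and> A \<subseteq> car C \<and> finite A \<and>
    (\<forall>b. set b \<subseteq> car M \<longrightarrow> same_type LE N (up (car C)) (ev \<tau> b) x \<longrightarrow> same_type L M A b a \<longrightarrow>
       same_type L M (car C) b a)"
  proof (rule ccontr)
    assume none: "\<not> ?thesis"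
    have step: "\<exists>e D. gi_move L M (car C) (b, A) (e, D) \<and> set e \<subseteq> car M \<and> terms (length e) \<tau> \<and>
        same_type LE N (up (car C)) (ev \<tau> e) x"
      if b: "set b \<subseteq> car M" "terms (length b) \<tau>" and bx: "same_type LE N (up (car C)) (ev \<tau> b) x"
        and A: "A \<subseteq> car C" "finite A" for b A
    proof -
      have AM: "A \<subseteq> car M" using A(1) CM by blast
      have eN: "set (ev \<tau> b) \<subseteq> car N" using ev_in_up[OF b(2,1)] unfolding car_up .
      have "\<eta> ` A \<subseteq> up (car C)" "finite (\<eta> ` A)" using eta_subset_up[of A] up_mono[OF A(1)] A(2) by auto
      \<comment> \<open>\<open>b\<close> lifts only a tuple with the type of \<open>x\<close>. An
        automorphism over the copy of \<open>A\<close> moves it to a lift of \<open>x\<close>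
        itself, to which \<open>none\<close> applies.\<close>
      from same_typeE[OF bx N_struct eN up_subset_N[OF CM] this]
      obtain h where h: "h \<in> Aut LE N (\<eta> ` A)" "map h (ev \<tau> b) = x" .
      obtain k where k: "k \<in> Aut L M {x \<in> car M. \<eta> x \<in> \<eta> ` A}" "lifts k h" using Aut_home[OF h(1)] .
      have kA: "k \<in> Aut L M A" by (rule Aut_mono[OF k(1)]) (use AM in blast)
      let ?a = "map k b"
      have a: "set ?a \<subseteq> car M" "terms (length ?a) \<tau>" "x = ev \<tau> ?a"
        using Aut_map_closed[OF kA b(1)] b(2) ev_lifts[OF k(2) b] h(2) by auto
      have ab: "same_type L M A b ?a" using same_type_finite[OF M_struct b(1) AM A(2)] kA by blast
      obtain d where d: "set d \<subseteq> car M" "same_type LE N (up (car C)) (ev \<tau> d) x"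
        "same_type L M A d ?a" "\<not> same_type L M (car C) d ?a" using none a A by metis
      \<comment> \<open>\<open>d\<close> and \<open>?a\<close> have different types over
        \<open>C\<close>, so one of them differs from \<open>b\<close> over \<open>C\<close>, while
        both agree with \<open>b\<close> over \<open>A\<close>.\<close>
      have "\<exists>e. set e \<subseteq> car M \<and> terms (length e) \<tau> \<and> same_type LE N (up (car C)) (ev \<tau> e) x \<and>
        same_type L M A e b \<and> \<not> same_type L M (car C) e b"
      proof (cases "same_type L M (car C) d b")
        case True
        then have "\<not> same_type L M (car C) ?a b" using d(4) same_type_sym same_type_trans by metis
        then show ?thesis using a ab same_type_sym same_type_refl by metis
      next
        case False
        have db: "same_type L M A d b" using d(3) ab same_type_sym same_type_trans by metis
        obtain g where "map g d = b" using same_typeE[OF db M_struct d(1) AM order_refl A(2)] by blast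
        then have "terms (length d) \<tau>" using b(2) by auto
        then show ?thesis using d(1,2) db False by blast
      qed
      then obtain e where e: "set e \<subseteq> car M" "terms (length e) \<tau>" "same_type LE N (up (car C)) (ev \<tau> e) x"
        "same_type L M A e b" "\<not> same_type L M (car C) e b" by blast
      have "\<not> (\<forall>B\<subseteq>car C. finite B \<longrightarrow> (\<exists>k\<in>Aut L M B. map k e = b))"
        using e(5) unfolding same_type_iff[OF M_struct e(1) CM] .
      then obtain B where B: "B \<subseteq> car C" "finite B" "\<not> (\<exists>k\<in>Aut L M B. map k e = b)" by blast
      have "\<not> same_type L M (A \<union> B) e b"
      proof
        have ABM: "A \<union> B \<subseteq> car M" using A(1) B(1) CM by blast
        assume st: "same_type L M (A \<union> B) e b"
        show False using same_typeE[OF st M_struct e(1) ABM _ B(2)] B(3) by blast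
      qed
      then have mv: "gi_move L M (car C) (b, A) (e, A \<union> B)"
        unfolding gi_move_def using e A B by auto
      then show ?thesis using e(1,2,3) by blast
    qed
    have "\<not> II_wins_within L M (car C) n (b, A)"
      if "set b \<subseteq> car M" "terms (length b) \<tau>" "same_type LE N (up (car C)) (ev \<tau> b) x" "A \<subseteq> car C" "finite A"
      for n b A using that
    proof (induction n arbitrary: b A)
      case (0 b A)
      show ?case using step[OF 0] by auto
    next
      case (Suc n b A)
      obtain e D where e: "gi_move L M (car C) (b, A) (e, D)" "set e \<subseteq> car M" "terms (length e) \<tau>"
        "same_type LE N (up (car C)) (ev \<tau> e) x" using step[OF Suc.prems] by blast
      show ?case
      proof
        assume "II_wins_within L M (car C) (Suc n) (b, A)"
        from II_wins_withinE[OF this e(1)]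
        obtain B where "finite B" "D \<subseteq> B" "B \<subseteq> car C" "II_wins_within L M (car C) n (e, B)" .
        then show False using Suc.IH[OF e(2-4)] by blast
      qed
    qed
    moreover obtain n where "II_wins_within L M (car C) n (c, {})"
      using AIV c(1) C unfolding AIV_def II_wins_iff by (metis empty_subsetI finite.emptyI)
    ultimately show False using c same_type_refl by blast
  qed
  then show thesis using that by metis
qed

text \<open>The s-primary model over \<open>C\<close> and the lift \<open>a\<close> controls only
  tuples with the type of \<open>a\<close> over \<open>C\<close>, whereas the hypothesis gives the
  type of \<open>x\<close> over \<open>Y\<close>. Isolation of \<open>a\<close> closes this gap with
  finitely many parameters.\<close>

lemma AII_Keq: "AII \<delta> Keq N" unfolding AII_def
proof (intro allI impI)
  fix x Y assume x: "set x \<subseteq> car N" and Y: "model \<delta> Keq N Y" "countable (car Y)"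
  obtain C where C: "model \<delta> \<K> M C" "Y = eqst Im C" using Y(1) model_Keq by blast
  have cC: "countable (car C)" using Y(2) countable_model[OF C(1)] C(2) by blast
  note CM = modelD(3)[OF C(1)]
  have Y_up: "car Y = up (car C)" unfolding C(2) car_up ..
  from isolated_lift[OF C(1) cC x]
  obtain a \<tau> A where a: "set a \<subseteq> car M" "terms (length a) \<tau>" "x = ev \<tau> a" and A: "A \<subseteq> car C" "finite A"
    and iso: "\<And>b. set b \<subseteq> car M \<Longrightarrow> same_type LE N (up (car C)) (ev \<tau> b) x \<Longrightarrow> same_type L M A b a \<Longrightarrow>
       same_type L M (car C) b a" by blast
  obtain B where "s_primary \<delta> \<K> M a C B" using AII a(1) C(1) cC unfolding AII_def by blast
  then obtain s where B: "model \<delta> \<K> M B" and cB: "car B = car C \<union> set a \<union> range s"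
    and prim: "\<And>n. \<exists>An\<subseteq>car C. finite An \<and> (\<forall>a' s'. set a' \<subseteq> car M \<longrightarrow> set s' \<subseteq> car M \<longrightarrow>
      length s' = Suc n \<longrightarrow> same_type L M (car C) a' a \<longrightarrow>
      same_type L M An (a' @ s') (a @ map s [0..<Suc n]) \<longrightarrow>
      same_type L M (car C) (a' @ s') (a @ map s [0..<Suc n]))" unfolding s_primary_def by blast
  note BM = modelD(3)[OF B]
  have countB: "countable (car B)" unfolding cB using cC by (simp add: countable_finite)
  have cup: "countable (up (car B))" using countB countable_model[OF B] unfolding car_up by blast
  have "x0 \<in> car B \<Longrightarrow> \<eta> x0 \<in> up (car B)" for x0 by (rule eta_in_up)
  then have ne: "up (car B) \<noteq> {}" using cB by blast
  \<comment> \<open>All imaginaries of \<open>B\<close> are enumerated, since an element of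
    \<open>up (car B)\<close> may have representatives that mix \<open>C\<close>, \<open>a\<close>
    and the sequence \<open>s\<close>.\<close>
  define S where "S = from_nat_into (up (car B))"
  have S: "range S = up (car B)" unfolding S_def by (rule range_from_nat_into[OF ne cup])
  have CB: "up (car C) \<subseteq> up (car B)" by (rule up_mono) (use cB in blast)
  have xB: "set x \<subseteq> up (car B)" unfolding a(3) by (rule ev_in_up[OF a(2)]) (use cB in blast)
  have "s_primary \<delta> Keq N x Y (eqst Im B)" unfolding s_primary_def voc_Keq
  proof (intro conjI exI[of _ S] allI)
    show "model \<delta> Keq N (eqst Im B)" using B model_Keq by blast
    show "car (eqst Im B) = car Y \<union> set x \<union> range S" unfolding S Y_up car_up using CB xB by blast
    fix n
    let ?t = "map S [0..<Suc n]"
    have "set ?t \<subseteq> up (car B)" using S by auto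
    then obtain w \<sigma> where w: "set w \<subseteq> car B" "terms (length w) \<sigma>" "?t = ev \<sigma> w" using ev_exists by blast
    have "finite (set w \<inter> range s)" by simp
    then obtain I where I: "finite I" "set w \<inter> range s = s ` I"
      using finite_subset_image[of "set w \<inter> range s" s UNIV] by blast
    \<comment> \<open>\<open>w\<close> lifts the first n+1 imaginaries and uses only finitely many
      entries of \<open>s\<close>; \<open>m\<close> exceeds their indices. \<open>?u\<close> takes
      \<open>Suc m\<close> entries to match the initial segments in
      \<open>s_primary\<close>.\<close>
    obtain m where m: "\<forall>i\<in>I. i < m" using finite_nat_set_iff_bounded[of I] I(1) by blast
    let ?u = "a @ map s [0..<Suc m]"
    have "finite (set w \<inter> car C)" by simp
    then obtain d where d: "set d = set w \<inter> car C" using finite_list by blast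
    have wdu: "set w \<subseteq> set d \<union> set ?u"
    proof
      fix y assume y: "y \<in> set w"
      then have "y \<in> car C \<or> y \<in> set a \<or> y \<in> range s" using w(1) cB by blast
      then show "y \<in> set d \<union> set ?u"
      proof (elim disjE)
        assume "y \<in> range s"
        then obtain i where "i \<in> I" "y = s i" using y I(2) by blast
        then have "i \<in> set [0..<Suc m]" using m by auto
        then show ?thesis using \<open>y = s i\<close> by auto
      qed (use y d in auto)
    qed
    obtain Am where Am: "Am \<subseteq> car C" "finite Am"
      "\<And>a' s'. set a' \<subseteq> car M \<Longrightarrow> set s' \<subseteq> car M \<Longrightarrow> length s' = Suc m \<Longrightarrow> same_type L M (car C) a' a \<Longrightarrow>
        same_type L M Am (a' @ s') ?u \<Longrightarrow> same_type L M (car C) (a' @ s') ?u"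
      using prim[of m] by blast
    \<comment> \<open>\<open>A\<close> isolates the lift \<open>a\<close>, \<open>Am\<close>
      isolates the initial segment of \<open>s\<close> over \<open>C\<close>, and \<open>d\<close>
      lists the entries of \<open>w\<close> in \<open>C\<close>, which every automorphism used below
      has to fix.\<close>
    let ?A = "A \<union> Am \<union> set d"
    have AC: "?A \<subseteq> car C" "finite ?A" using A Am(1,2) d by auto
    have AM: "?A \<subseteq> car M" using AC(1) CM by blast
    have wM: "set w \<subseteq> car M" using w(1) BM by blast
    have uM: "set ?u \<subseteq> car M" "set (map s [0..<Suc m]) \<subseteq> car M" using a(1) cB BM by auto
    show "\<exists>An\<subseteq>car Y. finite An \<and> (\<forall>a' s'. set a' \<subseteq> car N \<longrightarrow> set s' \<subseteq> car N \<longrightarrow> length s' = Suc n \<longrightarrow>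
        same_type LE N (car Y) a' x \<longrightarrow> same_type LE N An (a' @ s') (x @ ?t) \<longrightarrow>
        same_type LE N (car Y) (a' @ s') (x @ ?t))"
    proof (intro exI[of _ "\<eta> ` ?A"] conjI allI impI)
      show sub: "\<eta> ` ?A \<subseteq> car Y" unfolding Y_up using eta_subset_up[of ?A] up_mono[OF AC(1)] by blast
      show "finite (\<eta> ` ?A)" using AC(2) by simp
      fix a' s' assume a': "set a' \<subseteq> car N" and s': "set s' \<subseteq> car N" and len: "length s' = Suc n"
        and st: "same_type LE N (car Y) a' x" and stA: "same_type LE N (\<eta> ` ?A) (a' @ s') (x @ ?t)"
      have YN: "car Y \<subseteq> car N" unfolding Y_up by (rule up_subset_N[OF CM])
      have xtN: "set (x @ ?t) \<subseteq> car N" using x \<open>set ?t \<subseteq> up (car B)\<close> up_subset_N[OF BM] by auto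
      have AN: "\<eta> ` ?A \<subseteq> car N" using sub YN by blast
      from same_typeE[OF same_type_sym[OF stA] N_struct xtN AN order_refl] AC(2)
      obtain h where h: "h \<in> Aut LE N (\<eta> ` ?A)" "map h (x @ ?t) = a' @ s'" by blast
      have "length ?t = length s'" using len by simp
      then have ht: "map h x = a'" "map h ?t = s'" using h(2) by (auto simp del: upt_Suc simp: append_eq_append_conv)
      obtain k where k0: "k \<in> Aut L M {x \<in> car M. \<eta> x \<in> \<eta> ` ?A}" "lifts k h" using Aut_home[OF h(1)] .
      have k: "k \<in> Aut L M ?A" by (rule Aut_mono[OF k0(1)]) (use AM in blast)
      have a'e: "a' = ev \<tau> (map k a)" using ev_lifts[OF k0(2) a(1,2)] ht(1) a(3) by simp
      have s'e: "s' = ev \<sigma> (map k w)"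
        by (rule trans[OF ht(2)[symmetric, unfolded w(3)] ev_lifts[OF k0(2) wM w(2)]])
      have kaM: "set (map k a) \<subseteq> car M" by (rule Aut_map_closed[OF k a(1)])
      have kuM: "set (map k ?u) \<subseteq> car M" by (rule Aut_map_closed[OF k uM(1)])
      have st_k: "same_type L M F (map k b) b" if F: "F \<subseteq> ?A" and b: "set b \<subseteq> car M" for F b
      proof (rule same_type_sym)
        have "F \<subseteq> car M" "finite F" using F AM AC(2) finite_subset by blast+
        then show "same_type L M F b (map k b)"
          using same_type_finite[OF M_struct b] Aut_mono[OF k F] by blast
      qed
      \<comment> \<open>\<open>k\<close> gives agreement over \<open>A\<close> only; isolation
        raises it to all of \<open>C\<close>, as needed for the primary model.\<close>
      have "same_type L M (car C) (map k a) a"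
        by (rule iso[OF kaM]) (use st a'e Y_up st_k[of A a] a(1) in auto)
      moreover have "same_type L M Am (map k a @ map k (map s [0..<Suc m])) ?u"
        using st_k[OF _ uM(1), of Am] by (simp only: map_append) blast
      ultimately have su: "same_type L M (car C) (map k a @ map k (map s [0..<Suc m])) ?u"
        by (intro Am(3)[OF kaM Aut_map_closed[OF k uM(2)]]) simp_all
      have as'N: "set (a' @ s') \<subseteq> car N" using a' s' by simp
      show "same_type LE N (car Y) (a' @ s') (x @ ?t)"
      proof (rule same_typeI[OF N_struct as'N YN])
        fix F assume F: "F \<subseteq> car Y" "finite F"
        from up_finite[OF F(2) F(1)[unfolded Y_up]]
        obtain Z where Z: "Z \<subseteq> car C" "finite Z" "F \<subseteq> up Z" by blast
        have Zd: "Z \<union> set d \<subseteq> car C" "finite (Z \<union> set d)" using Z(1,2) d by auto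
        have kuM': "set (map k a @ map k (map s [0..<Suc m])) \<subseteq> car M" using kuM by (simp del: upt_Suc)
        \<comment> \<open>\<open>l\<close> undoes \<open>k\<close> on \<open>?u\<close>, and both
          fix \<open>d\<close>. Hence l after k fixes \<open>w\<close>, and lifting \<open>l\<close>
          takes the given imaginaries back to \<open>x\<close> and \<open>?t\<close>.\<close>
        obtain l where l: "l \<in> Aut L M (Z \<union> set d)" "map l (map k a @ map k (map s [0..<Suc m])) = ?u"
          using same_typeE[OF su M_struct kuM' CM Zd] .
        have lu: "map (l \<circ> k) ?u = ?u" using l(2) by (simp del: upt_Suc)
        have lk: "l (k y) = y" if "y \<in> set w" for y
        proof -
          have "y \<in> set d \<or> y \<in> set ?u" using wdu that by blast
          then show ?thesis
          proof
            assume y: "y \<in> set d"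
            then have "k y = y" using Aut_fix[OF k] by blast
            then show ?thesis using Aut_fix[OF l(1)] y by simp
          next
            assume "y \<in> set ?u"
            from map_id_fix[OF lu this] show ?thesis by simp
          qed
        qed
        have lw: "map l (map k w) = w" using lk by (auto intro!: map_idI)
        have la: "map l (map k a) = a" using l(2) by simp
        have "Z \<subseteq> car M" using Z(1) CM by blast
        obtain g where g: "g \<in> Aut LE N (up (Z \<union> set d))" "lifts l g"
          using Aut_lift[OF l(1)] Zd(1) CM by blast
        have "map g a' = x" unfolding a'e using ev_lifts[OF g(2) kaM] a(2,3) la by simp
        moreover have "map g s' = ?t" unfolding s'e
          using ev_lifts[OF g(2) Aut_map_closed[OF k wM]] w(2,3) lw by simp
        ultimately have "map g (a' @ s') = x @ ?t" by simp
        moreover have "F \<subseteq> up (Z \<union> set d)" using Z(3) up_mono[of Z "Z \<union> set d"] by blast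
        ultimately show "\<exists>g\<in>Aut LE N F. map g (a' @ s') = x @ ?t" using Aut_mono[OF g(1)] by blast
      qed
    qed
  qed
  then show "\<exists>W. s_primary \<delta> Keq N x Y W" by blast
qed

theorem fur_class_Keq: "fur_class \<kappa> \<delta> Keq (eq_struct \<K> M \<E> M)"
  unfolding fur_class_def eq_struct_eqst
  using aec_Keq monster_Keq amalgamation_Keq joint_embedding_Keq LS_bound_Keq arbitrarily_large_Keq
    infinite_Keq AI_Keq AII_Keq AIII_Keq AIV_Keq AV_Keq AVI_Keq by blast

end

theorem theorem2p75:
  fixes \<kappa> \<delta> :: "'k rel"
    and \<K> :: "('f, 'r, 'a) aclass"
    and M :: "('f, 'r, 'a) struct"
    and \<E> :: "'a list rel set"
  assumes "Card_order \<kappa>" and "regularCard \<kappa>" and "natLeq <o \<kappa>"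
    and "Card_order \<delta>" and "natLeq <o \<delta>" and "\<delta> <o \<kappa>"
    and "fur_class \<kappa> \<delta> \<K> M"
    and "eq_collection \<K> M \<E>"
  shows "fur_class \<kappa> \<delta> (eq_class \<K> M \<E>) (eq_struct \<K> M \<E> M)"
proof -
  interpret fur_eq \<kappa> \<delta> \<K> M \<E> by unfold_locales (fact assms)+
  show ?thesis by (rule fur_class_Keq)
qed

end
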